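(* Assume $n\ge 2$. (i) For $k=1$ and $k=n-1$, the measure $\mu_{\mathcal O_k}$ extends by zero to a distribution $\mu_{\mathcal O_k}$ on $M_n(\mathbb{F})$, and this extension satisfies the transformation property $\mu_{\mathcal O_k}(L\otimes R(g,h)\psi)=|\det g|^k|\det h|^{-k}\mu_{\mathcal O_k}(\psi)$ for all $\psi\in\mathcal S(M_n(\mathbb{F}))$. (ii) With suitable normalizations of $\mu_{\mathcal O_1},\mu_{\mathcal O_{n-1}}$, for all $\psi\in\mathcal S(M_n(\mathbb{F}))$, $$\mu_{\mathcal O_{n-1}}(\psi)=\widehat{\mu_{\mathcal O_1}}(\psi)=\int_{\mathbb{F}^\times\backslash\mathsf{W}_{\mathbb{F}^\times}}\int_{M_n(\mathbb{F})}\chi(\langle zw,w\rangle)\psi(z)\,dz\,d(\mathbb{F}^\times w),$$ where each consecutive integral converges absolutely; the right hand side, denoted $\mathrm{chc}(\psi)$, is a distribution on $M_n(\mathbb{F})$.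
   Context: $\mathbb{F}$ is a non-archimedean local field of characteristic $0$, ring of integers $\mathfrak o_{\mathbb{F}}$, absolute value $|\cdot|$, and $\chi$ a unitary character of $(\mathbb{F},+)$ with kernel $\mathfrak o_{\mathbb{F}}$. $\mathsf{X}=M_{n,1}(\mathbb{F})$ (columns), $\mathsf{Y}=M_{1,n}(\mathbb{F})$ (rows), $\mathsf{W}=\mathsf{X}\oplus\mathsf{Y}$ with symplectic form $\langle(x,y),(x',y')\rangle=y'x-yx'$; $z\in M_n(\mathbb{F})=\mathrm{End}(\mathsf{X})$ acts on $\mathsf{W}$ by $z(x,y)=(zx,-yz)$, so $\langle z w,w\rangle=2yzx$ for $w=(x,y)$. Haar measures: $dw$ on $\mathsf{W}$ with $\mathrm{vol}(\mathfrak o^n\oplus\mathfrak o^n)=1$, $dz$ on $M_n(\mathbb{F})$ with $\mathrm{vol}(M_n(\mathfrak o_{\mathbb{F}}))=1$, $da$ on $\mathbb{F}$ with $\mathrm{vol}(\mathfrak o_{\mathbb{F}})=1$. $\mathbb{F}^\times$ acts on $\mathsf{W}_{\mathbb{F}^\times}=(\mathsf{X}\setminus\{0\})\oplus(\mathsf{Y}\setminus\{0\})$ freely by $a(x,y)=(xa,ya^{-1})$, and the measure $d(\mathbb{F}^\times w)$ on the orbit space is defined by $\int_{\mathsf{W}_{\mathbb{F}^\times}}\phi(w)dw=\int_{\mathbb{F}^\times\backslash\mathsf{W}_{\mathbb{F}^\times}}\int_{\mathbb{F}^\times}\phi(a(w))\frac{da}{|a|}d(\mathbb{F}^\times w)$.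 $\mathrm{GL}_n(\mathbb{F})\times\mathrm{GL}_n(\mathbb{F})$ acts on functions by $L\otimes R(g,h)\psi(x)=\psi(g^{-1}xh)$. $\mathcal O_k$ is the set of rank $k$ matrices in $M_n(\mathbb{F})$ (a single orbit under $x\mapsto gxh^{-1}$) and $\mu_{\mathcal O_k}$ is the (unique up to positive scalar) positive measure on $\mathcal O_k$ with $\mu_{\mathcal O_k}(L\otimes R(g,h)\psi)=|\det g|^k|\det h|^{-k}\mu_{\mathcal O_k}(\psi)$ for $\psi\in C_c(\mathcal O_k)$. Fourier transform on $M_n(\mathbb{F})$: $\hat f(z)=\int f(y)\chi(-\mathrm{tr}(zy))dy$, and $\hat\mu(\psi)=\mu(\hat\psi)$. $\mathcal S$ denotes locally constant compactly supported functions. *)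

theory Defs
  imports "HOL-Analysis.Analysis"
begin

text \<open>The field is a type of class field with a metric topology; the metric is the one
induced by the absolute value absv.  A non-archimedean local field is a field with a
non-trivial ultrametric absolute value whose ring of integers is compact (equivalently,
the field is locally compact and non-discrete); characteristic 0 is CHAR = 0.\<close>

definition nonarch_local_field :: "('a::{field,metric_space} \<Rightarrow> real) \<Rightarrow> bool" where
  "nonarch_local_field absv \<longleftrightarrow>
     CHAR('a) = 0 \<and>
     (\<forall>x. 0 \<le> absv x) \<and> (\<forall>x. absv x = 0 \<longleftrightarrow> x = 0) \<and>
     (\<forall>x y. absv (x * y) = absv x * absv y) \<and>
     (\<forall>x y. absv (x + y) \<le> max (absv x) (absv y)) \<and>
     (\<exists>x. absv x \<noteq> 0 \<and> absv x \<noteq> 1) \<and>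
     (\<forall>x y. dist x y = absv (x - y)) \<and>
     compact {x. absv x \<le> 1}"

definition intring :: "('a::field \<Rightarrow> real) \<Rightarrow> 'a set" where
  "intring absv = {x. absv x \<le> 1}"

definition additive_char :: "('a::field \<Rightarrow> real) \<Rightarrow> ('a \<Rightarrow> complex) \<Rightarrow> bool" where
  "additive_char absv chr \<longleftrightarrow>
     (\<forall>x y. chr (x + y) = chr x * chr y) \<and> (\<forall>x. cmod (chr x) = 1) \<and>
     {x. chr x = 1} = intring absv"

text \<open>A translation invariant Borel measure giving the compact open set U measure 1
(this characterises the normalised Haar measure uniquely).\<close>
definition haar_normalized :: "'b::{topological_space,plus} measure \<Rightarrow> 'b set \<Rightarrow> bool" where
  "haar_normalized \<mu> U \<longleftrightarrow>
     sets \<mu> = sets borel \<and>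
     (\<forall>c A. A \<in> sets borel \<longrightarrow> emeasure \<mu> ((\<lambda>x. x + c) ` A) = emeasure \<mu> A) \<and>
     emeasure \<mu> U = 1"

text \<open>Haar measure da on F with vol(o)=1; |.| is the normalised absolute value,
i.e. d(ax) = |a| dx.\<close>
definition haar_F :: "('a::{field,metric_space} \<Rightarrow> real) \<Rightarrow> 'a measure \<Rightarrow> bool" where
  "haar_F absv \<mu> \<longleftrightarrow> haar_normalized \<mu> (intring absv) \<and>
     (\<forall>a A. a \<noteq> 0 \<longrightarrow> A \<in> sets borel \<longrightarrow>
        emeasure \<mu> ((\<lambda>x. a * x) ` A) = ennreal (absv a) * emeasure \<mu> A)"

definition haar_mat :: "('a::{field,metric_space} \<Rightarrow> real) \<Rightarrow> ('a^'n^'n) measure \<Rightarrow> bool" where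
  "haar_mat absv \<mu> \<longleftrightarrow> haar_normalized \<mu> {z. \<forall>i j. absv (z $ i $ j) \<le> 1}"

text \<open>W = X + Y, with X columns and Y rows, both modelled as 'a^'n.\<close>
type_synonym ('a,'n) W = "('a^'n) \<times> ('a^'n)"

definition haar_W :: "('a::{field,metric_space} \<Rightarrow> real) \<Rightarrow> ('a,'n::finite) W measure \<Rightarrow> bool" where
  "haar_W absv \<mu> \<longleftrightarrow> haar_normalized \<mu> {(x,y). \<forall>i. absv (x $ i) \<le> 1 \<and> absv (y $ i) \<le> 1}"

definition rowcol :: "'a::field^'n \<Rightarrow> 'a^'n \<Rightarrow> 'a" where
  "rowcol y x = (\<Sum>i\<in>UNIV. y $ i * x $ i)"

definition sympl :: "('a::field,'n::finite) W \<Rightarrow> ('a,'n) W \<Rightarrow> 'a" where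
  "sympl w w' = rowcol (snd w') (fst w) - rowcol (snd w) (fst w')"

definition Wact :: "'a::field^'n^'n \<Rightarrow> ('a,'n::finite) W \<Rightarrow> ('a,'n) W" where
  "Wact z w = (z *v fst w, - (snd w v* z))"

definition torus_act :: "'a::field \<Rightarrow> ('a,'n::finite) W \<Rightarrow> ('a,'n) W" where
  "torus_act a w = (a *s fst w, inverse a *s snd w)"

definition Wx :: "('a::field,'n::finite) W set" where
  "Wx = {(x,y). x \<noteq> 0 \<and> y \<noteq> 0}"

text \<open>Borel sets of the orbit space, pulled back to F^x-invariant Borel subsets of Wx.\<close>
definition inv_sets :: "('a::{field,metric_space},'n::finite) W set set" where
  "inv_sets = {A. A \<in> sets borel \<and> A \<subseteq> Wx \<and>
                  (\<forall>a w. a \<noteq> 0 \<longrightarrow> w \<in> A \<longrightarrow> torus_act a w \<in> A)}"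

definition orbit_quot_measure ::
  "('a::{field,metric_space} \<Rightarrow> real) \<Rightarrow> 'a measure \<Rightarrow> ('a,'n::finite) W measure \<Rightarrow> ('a,'n) W measure \<Rightarrow> bool" where
  "orbit_quot_measure absv \<mu>F \<mu>W \<nu> \<longleftrightarrow>
     space \<nu> = Wx \<and> sets \<nu> = inv_sets \<and>
     (\<forall>\<phi> \<in> borel_measurable borel.
        (\<integral>\<^sup>+ w \<in> Wx. \<phi> w \<partial>\<mu>W) =
        (\<integral>\<^sup>+ w. (\<integral>\<^sup>+ a. indicator (-{0}) a * \<phi> (torus_act a w) * ennreal (1 / absv a) \<partial>\<mu>F) \<partial>\<nu>))"

definition schwartz :: "('b::topological_space \<Rightarrow> complex) \<Rightarrow> bool" where
  "schwartz \<psi> \<longleftrightarrow> (\<forall>x. \<exists>U. open U \<and> x \<in> U \<and> (\<forall>y\<in>U. \<psi> y = \<psi> x)) \<and>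
                    (\<exists>K. compact K \<and> (\<forall>x. x \<notin> K \<longrightarrow> \<psi> x = 0))"

definition Cc_on :: "'b::topological_space set \<Rightarrow> ('b \<Rightarrow> complex) \<Rightarrow> bool" where
  "Cc_on Orb \<psi> \<longleftrightarrow> continuous_on Orb \<psi> \<and> (\<forall>x. x \<notin> Orb \<longrightarrow> \<psi> x = 0) \<and>
                   (\<exists>K. compact K \<and> K \<subseteq> Orb \<and> (\<forall>x\<in>Orb - K. \<psi> x = 0))"

definition rank_orbit :: "nat \<Rightarrow> ('a::field^'n^'n) set" where
  "rank_orbit k = {z. rank z = k}"

definition LR :: "'a::field^'n^'n \<Rightarrow> 'a^'n^'n \<Rightarrow> ('a^'n^'n \<Rightarrow> complex) \<Rightarrow> ('a^'n^'n \<Rightarrow> complex)" where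
  "LR g h \<psi> = (\<lambda>x. \<psi> (matrix_inv g ** x ** h))"

definition orbit_measure :: "('a::{field,metric_space} \<Rightarrow> real) \<Rightarrow> nat \<Rightarrow> ('a^'n::finite^'n) measure \<Rightarrow> bool" where
  "orbit_measure absv k \<mu> \<longleftrightarrow>
     sets \<mu> = sets borel \<and>
     emeasure \<mu> (- rank_orbit k) = 0 \<and>
     emeasure \<mu> (rank_orbit k) \<noteq> 0 \<and>
     (\<forall>K. compact K \<and> K \<subseteq> rank_orbit k \<longrightarrow> emeasure \<mu> K < \<infinity>) \<and>
     (\<forall>\<psi> g h. Cc_on (rank_orbit k) \<psi> \<longrightarrow> invertible g \<longrightarrow> invertible h \<longrightarrow>
        integral\<^sup>L \<mu> (LR g h \<psi>) =
          complex_of_real (absv (det g) ^ k / absv (det h) ^ k) * integral\<^sup>L \<mu> \<psi>)"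

definition fourier :: "('a^'n^'n) measure \<Rightarrow> ('a::field \<Rightarrow> complex) \<Rightarrow> ('a^'n::finite^'n \<Rightarrow> complex) \<Rightarrow> ('a^'n^'n \<Rightarrow> complex)" where
  "fourier \<mu>M chr f = (\<lambda>z. \<integral> y. f y * chr (- trace (z ** y)) \<partial>\<mu>M)"

definition chc_inner :: "('a^'n^'n) measure \<Rightarrow> ('a::field \<Rightarrow> complex) \<Rightarrow> ('a^'n::finite^'n \<Rightarrow> complex) \<Rightarrow> ('a,'n) W \<Rightarrow> complex" where
  "chc_inner \<mu>M chr \<psi> w = (\<integral> z. chr (sympl (Wact z w) w) * \<psi> z \<partial>\<mu>M)"

definition chc :: "('a^'n^'n) measure \<Rightarrow> ('a,'n) W measure \<Rightarrow> ('a::field \<Rightarrow> complex) \<Rightarrow> ('a^'n::finite^'n \<Rightarrow> complex) \<Rightarrow> complex" where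
  "chc \<mu>M \<nu> chr \<psi> = (\<integral> w. chc_inner \<mu>M chr \<psi> w \<partial>\<nu>)"

end

theory Submission
  imports Defs
begin

text \<open>
  Integrating over the matrices \<open>x y\<close> with \<open>x\<close> a column and \<open>y\<close> a row of norm 1 gives a measure on the
  rank one matrices, with the required transformation behaviour because \<open>y\<close> runs through a fundamental
  domain for the scaling action. Its Fourier transform can be computed one \<open>y\<close> at a time: by Fourier
  inversion it is the integral over \<open>{z. y z = 0}\<close>, hence a positive measure supported on matrices of
  rank at most \<open>n - 1\<close>, and almost all of these have rank exactly \<open>n - 1\<close>. Both measures are finite on
  compact subsets of the space of all matrices.

  Any measure on an orbit with the prescribed transformation behaviour is proportional to the explicit
  one: two such measures have the same null sets, and their Radon-Nikodym density is invariant under the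
  group, hence constant by Fubini. The same argument yields uniqueness of Haar measure and thereby the
  Jacobians of linear maps. Finally, the quotient measure on the orbit space of the torus is pushed to
  the rank one measure by \<open>(x, y) \<mapsto> x y\<close>, and \<open>\<langle>z w, w\<rangle> = 2 y z x\<close> turns the inner integral of chc into
  the Fourier transform of \<open>\<psi>\<close> at \<open>- 2 x y\<close>.
\<close>

section \<open>Matrices over a field\<close>

text \<open>The hypotheses test an orbit measure only on functions supported in compact subsets of
  the orbit, so they say nothing directly about its mass near matrices of smaller rank. Comparison
  with an explicit model supplies the finiteness there, and with it part (i).

  For uniqueness the group carries additive Haar measure on pairs of matrices, restricted to
  invertible pairs: the Fubini argument only asks for a sigma-finite measure whose null sets are
  respected by translations.

  The transformation law of the corank one measure is inherited through the Fourier transform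
  instead of being verified on the fibres: substitution in the Fourier integral contributes the
  exponent n, and the rank one measure takes away 1.

  Besides the proportionality factors, two constants enter the normalizations: the volume of the
  unit group, left over when a torus orbit is cut by \<open>vabs y = 1\<close>, and the absolute
  value of \<open>det (mat (- 2))\<close>, left over from the factor 2 in the pairing.\<close>

lemma matrix_mult_entry: "(A ** B) $ i $ j = (\<Sum>k\<in>UNIV. A $ i $ k * B $ k $ j)"
  by (simp add: matrix_matrix_mult_def)

text \<open>A simultaneous shear: from the left it adds \<open>v $ r\<close> times row
  \<open>i\<close> to every other row \<open>r\<close>, so one factor clears a whole column. The
  entry \<open>v $ i\<close> is masked, which keeps the diagonal equal to 1.\<close>

definition transvec_col :: "'n \<Rightarrow> 'a::field^'n \<Rightarrow> 'a^'n^'n" where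
  "transvec_col i v = (\<chi> r s. of_bool (r = s) + (if s = i \<and> r \<noteq> i then v $ r else 0))"

definition transvec_row :: "'n \<Rightarrow> 'a::field^'n \<Rightarrow> 'a^'n^'n" where
  "transvec_row i v = (\<chi> r s. of_bool (r = s) + (if r = i \<and> s \<noteq> i then v $ s else 0))"

definition diag_mat :: "('n \<Rightarrow> 'a::field) \<Rightarrow> 'a^'n^'n" where
  "diag_mat d = (\<chi> r s. if r = s then d r else 0)"

lemma transvec_col_mult_entry:
  "(transvec_col i v ** A) $ r $ s = A $ r $ s + (if r \<noteq> i then v $ r * A $ i $ s else 0)"
proof -
  have "(transvec_col i v ** A) $ r $ s
      = (\<Sum>k\<in>UNIV. (if k = r then A $ k $ s else 0) + (if k = i then (if r \<noteq> i then v $ r * A $ k $ s else 0) else 0))"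
    unfolding matrix_mult_entry transvec_col_def by (intro sum.cong) (auto simp: algebra_simps)
  then show ?thesis by (simp add: sum.distrib)
qed

lemma mult_transvec_row_entry:
  "(A ** transvec_row i v) $ r $ s = A $ r $ s + (if s \<noteq> i then A $ r $ i * v $ s else 0)"
proof -
  have "(A ** transvec_row i v) $ r $ s
      = (\<Sum>k\<in>UNIV. (if k = s then A $ r $ k else 0) + (if k = i then (if s \<noteq> i then A $ r $ k * v $ s else 0) else 0))"
    unfolding matrix_mult_entry transvec_row_def by (intro sum.cong) (auto simp: algebra_simps)
  then show ?thesis by (simp add: sum.distrib)
qed

lemma mult_transvec_col_entry:
  "(A ** transvec_col i v) $ r $ s = A $ r $ s + (if s = i then (\<Sum>k\<in>-{i}. A $ r $ k * v $ k) else 0)"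
proof -
  have "(A ** transvec_col i v) $ r $ s
      = (\<Sum>k\<in>UNIV. (if k = s then A $ r $ k else 0) + (if k \<in> -{i} then (if s = i then A $ r $ k * v $ k else 0) else 0))"
    unfolding matrix_mult_entry transvec_col_def by (intro sum.cong) (auto simp: algebra_simps)
  also have "\<dots> = A $ r $ s + (\<Sum>k\<in>-{i}. if s = i then A $ r $ k * v $ k else 0)"
    unfolding sum.distrib using sum.inter_restrict[of UNIV "\<lambda>k. if s = i then A $ r $ k * v $ k else 0" "-{i}"] by simp
  finally show ?thesis by simp
qed

lemma diag_mat_mult_entry: "(diag_mat d ** A) $ r $ s = d r * A $ r $ s"
proof -
  have "(diag_mat d ** A) $ r $ s = (\<Sum>k\<in>UNIV. if k = r then d r * A $ k $ s else 0)"
    unfolding matrix_mult_entry diag_mat_def by (intro sum.cong) auto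
  then show ?thesis by simp
qed

lemma mult_diag_mat_entry: "(A ** diag_mat d) $ r $ s = A $ r $ s * d s"
proof -
  have "(A ** diag_mat d) $ r $ s = (\<Sum>k\<in>UNIV. if k = s then A $ r $ k * d s else 0)"
    unfolding matrix_mult_entry diag_mat_def by (intro sum.cong) auto
  then show ?thesis by simp
qed

lemma transvec_col_add: "transvec_col i v ** transvec_col i w = transvec_col i (v + w)"
  unfolding vec_eq_iff transvec_col_mult_entry by (auto simp: transvec_col_def algebra_simps)

lemma transvec_row_add: "transvec_row i v ** transvec_row i w = transvec_row i (v + w)"
  unfolding vec_eq_iff mult_transvec_row_entry by (auto simp: transvec_row_def algebra_simps)

lemma transvec_0: "transvec_col i 0 = mat 1" "transvec_row i 0 = mat 1"
  by (auto simp: vec_eq_iff transvec_col_def transvec_row_def mat_def)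

lemma invertible_mat_1 [simp]: "invertible (mat 1 :: 'a::semiring_1^'n^'n)"
  unfolding invertible_def by (auto intro!: exI[of _ "mat 1"])

lemma invertible_mult_eqI:
  assumes "A ** B = mat 1" shows "invertible (A :: 'a::field^'n^'n)" "invertible B"
  using assms matrix_left_right_inverse[of A B] unfolding invertible_def by auto

lemma invertible_transvec [simp]:
  "invertible (transvec_col i v)" "invertible (transvec_row i v)"
  using transvec_col_add[of i v "-v"] transvec_row_add[of i v "-v"]
  by (auto simp: transvec_0 intro: invertible_mult_eqI)

lemma diag_mat_mult: "diag_mat c ** diag_mat d = diag_mat (\<lambda>i. c i * d i)"
  by (auto simp: vec_eq_iff diag_mat_mult_entry) (auto simp: diag_mat_def)

lemma diag_mat_1: "diag_mat (\<lambda>i. 1) = mat 1"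
  by (auto simp: vec_eq_iff diag_mat_def mat_def)

lemma invertible_diag_mat:
  assumes "\<And>i. d i \<noteq> 0" shows "invertible (diag_mat d)"
proof (rule invertible_mult_eqI)
  show "diag_mat d ** diag_mat (\<lambda>i. inverse (d i)) = mat 1"
    using assms by (simp add: diag_mat_mult diag_mat_1)
qed

text \<open>Scalings and permutations are left out on purpose: over a field in which 2 is nonzero,
  every multiplicative function with nonzero values is 1 on these products, so diagonalizing with
  them does not change such a function.\<close>

inductive transvec_prod :: "'a::field^'n^'n \<Rightarrow> bool" where
  one: "transvec_prod (mat 1)"
| col: "transvec_prod P \<Longrightarrow> transvec_prod (transvec_col i v ** P)"
| row: "transvec_prod P \<Longrightarrow> transvec_prod (transvec_row i v ** P)"

lemma transvec_prod_mult:
  "transvec_prod P \<Longrightarrow> transvec_prod Q \<Longrightarrow> transvec_prod (P ** Q)"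
  by (induction rule: transvec_prod.induct)
     (auto simp: matrix_mul_assoc[symmetric] intro: transvec_prod.intros)

lemma transvec_prod_col: "transvec_prod (transvec_col i v)"
  and transvec_prod_row: "transvec_prod (transvec_row i v)"
  using transvec_prod.col[OF transvec_prod.one, of i v] transvec_prod.row[OF transvec_prod.one, of i v]
  by auto

lemma transvec_prod_invertible: "transvec_prod P \<Longrightarrow> invertible P"
  by (induction rule: transvec_prod.induct) (auto intro: invertible_mult)

text \<open>Gaussian elimination by induction on the block \<open>S\<close> that is still arbitrary:
  off-diagonal entries meeting the complement of \<open>S\<close> are already 0, and each round
  moves one pivot index out of \<open>S\<close>.\<close>

lemma diagonalize_by_transvec_aux:
  fixes A :: "'a::field^'n^'n"
  assumes "finite S" "\<And>i j. i \<noteq> j \<Longrightarrow> i \<notin> S \<or> j \<notin> S \<Longrightarrow> A $ i $ j = 0"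
  shows "\<exists>P Q d. transvec_prod P \<and> transvec_prod Q \<and> P ** A ** Q = diag_mat d"
  using assms
proof (induction "card S" arbitrary: S A rule: less_induct)
  case (less S A)
  show ?case
  proof (cases "\<exists>i\<in>S. \<exists>j\<in>S. A $ i $ j \<noteq> 0")
    case False
    then have "A = diag_mat (\<lambda>i. A $ i $ i)"
      using less.prems(2) unfolding vec_eq_iff diag_mat_def by simp metis
    then have "mat 1 ** A ** mat 1 = diag_mat (\<lambda>i. A $ i $ i)" by simp
    then show ?thesis using transvec_prod.one by blast
  next
    case True
    then obtain i j where ij: "i \<in> S" "j \<in> S" "A $ i $ j \<noteq> 0" by blast
    have "\<exists>Q. transvec_prod Q \<and> (A ** Q) $ i $ i \<noteq> 0 \<and>
           (\<forall>r s. r \<noteq> s \<longrightarrow> r \<notin> S \<or> s \<notin> S \<longrightarrow> (A ** Q) $ r $ s = 0)"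
    proof (cases "A $ i $ i = 0")
      case False
      then show ?thesis using less.prems(2) transvec_prod.one by (intro exI[of _ "mat 1"]) auto
    next
      case i0: True
      then have neq: "i \<noteq> j" using ij by auto
      \<comment> \<open>Without permutations, a zero diagonal entry is repaired by adding column
        \<open>j\<close> to column \<open>i\<close>. Both indices lie in \<open>S\<close>, so no
        zero outside the block is destroyed.\<close>
      let ?v = "axis j 1 :: 'a^'n"
      have S: "(\<Sum>k\<in>-{i}. A $ r $ k * ?v $ k) = A $ r $ j" for r
        using neq by (simp add: axis_def if_distrib cong: if_cong)
      have e: "(A ** transvec_col i ?v) $ r $ s = A $ r $ s + (if s = i then A $ r $ j else 0)" for r s
        unfolding mult_transvec_col_entry S by simp
      have z: "A $ r $ s + (if s = i then A $ r $ j else 0) = 0" if "r \<noteq> s" "r \<notin> S \<or> s \<notin> S" for r s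
        using that less.prems(2)[of r s] less.prems(2)[of r j] ij by auto
      show ?thesis
      proof (intro exI[of _ "transvec_col i ?v"] conjI allI impI)
        show "(A ** transvec_col i ?v) $ i $ i \<noteq> 0" using ij i0 by (simp add: e)
        show "(A ** transvec_col i ?v) $ r $ s = 0" if "r \<noteq> s" "r \<notin> S \<or> s \<notin> S" for r s
          using z[OF that] by (simp only: e)
      qed (rule transvec_prod_col)
    qed
    then obtain Q where Q: "transvec_prod Q" "(A ** Q) $ i $ i \<noteq> 0"
      "\<And>r s. r \<noteq> s \<Longrightarrow> r \<notin> S \<or> s \<notin> S \<Longrightarrow> (A ** Q) $ r $ s = 0" by blast
    define B where "B = A ** Q"
    define p where "p = B $ i $ i"
    have p: "p \<noteq> 0" using Q by (simp add: p_def B_def)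
    \<comment> \<open>In \<open>C\<close> column \<open>i\<close> is cleared except for the pivot
      \<open>p\<close>; in \<open>D\<close> row \<open>i\<close> is cleared as well, so that
      \<open>i\<close> can leave the block.\<close>
    define C where "C = transvec_col i (\<chi> r. - B $ r $ i / p) ** B"
    have C: "C $ r $ s = B $ r $ s - (if r \<noteq> i then B $ r $ i / p * B $ i $ s else 0)" for r s
      unfolding C_def transvec_col_mult_entry by simp
    define D where "D = C ** transvec_row i (\<chi> s. - C $ i $ s / p)"
    have D: "D $ r $ s = C $ r $ s - (if s \<noteq> i then C $ r $ i * (C $ i $ s / p) else 0)" for r s
      unfolding D_def mult_transvec_row_entry by simp
    have D0: "D $ r $ s = 0" if "r \<noteq> s" "r \<notin> S - {i} \<or> s \<notin> S - {i}" for r s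
      using that Q(3)[of r s] Q(3)[of r i] Q(3)[of i s] p
      unfolding D C B_def[symmetric] by (auto simp: p_def)
    have "card (S - {i}) < card S" using ij(1) less.prems(1) by (rule card_Diff1_less[rotated])
    then obtain P' Q' d where PQ: "transvec_prod P'" "transvec_prod Q'" "P' ** D ** Q' = diag_mat d"
      using less.hyps[of "S - {i}" D, OF _ _ D0] less.prems(1) by auto
    have "(P' ** transvec_col i (\<chi> r. - B $ r $ i / p)) ** A
        ** (Q ** transvec_row i (\<chi> s. - C $ i $ s / p) ** Q') = diag_mat d"
      using PQ(3) unfolding D_def C_def B_def by (simp add: matrix_mul_assoc)
    moreover have "transvec_prod (P' ** transvec_col i (\<chi> r. - B $ r $ i / p))"
      "transvec_prod (Q ** transvec_row i (\<chi> s. - C $ i $ s / p) ** Q')"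
      using PQ Q(1) by (auto intro!: transvec_prod_mult transvec_prod_col transvec_prod_row)
    ultimately show ?thesis by blast
  qed
qed

lemma diagonalize_by_transvec:
  fixes A :: "'a::field^'n^'n"
  obtains P Q d where "transvec_prod P" "transvec_prod Q" "P ** A ** Q = diag_mat d"
  using diagonalize_by_transvec_aux[of UNIV A] by auto

text \<open>The square of a transvection is conjugate to it by a diagonal matrix, so every character of the
  general linear group is trivial on transvections.\<close>

lemma multiplicative_transvec:
  fixes m :: "'a::field^'n^'n \<Rightarrow> 'b::idom"
  assumes mult: "\<And>A B. invertible A \<Longrightarrow> invertible B \<Longrightarrow> m (A ** B) = m A * m B"
    and nz: "\<And>A. invertible A \<Longrightarrow> m A \<noteq> 0" and two: "(2::'a) \<noteq> 0"
    and P: "transvec_prod P"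
  shows "m P = 1"
proof -
  have id: "m (mat 1) = 1"
    using mult[of "mat 1" "mat 1"] nz[of "mat 1"] by simp
  have conj: "m A = 1" if "A ** A ** D = D ** A" "invertible A" "invertible D" for A D
  proof -
    have "m A * m A * m D = m D * m A"
      using that mult by (metis invertible_mult)
    then show ?thesis using nz that by simp
  qed
  let ?D = "\<lambda>c i. diag_mat (\<lambda>j. if j = i then c else 1) :: 'a^'n^'n"
  have D: "invertible (?D c i)" if "c \<noteq> 0" for c i
    by (rule invertible_diag_mat) (use that in auto)
  have "m (transvec_col i v) = 1" for i v
  proof (rule conj)
    show "transvec_col i v ** transvec_col i v ** ?D (1/2) i = ?D (1/2) i ** transvec_col i v"
      using two unfolding transvec_col_add vec_eq_iff diag_mat_mult_entry mult_diag_mat_entry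
      by (auto simp: transvec_col_def field_simps)
  qed (use D two in auto)
  moreover have "m (transvec_row i v) = 1" for i v
  proof (rule conj)
    show "transvec_row i v ** transvec_row i v ** ?D 2 i = ?D 2 i ** transvec_row i v"
      using two unfolding transvec_row_add vec_eq_iff diag_mat_mult_entry mult_diag_mat_entry
      by (auto simp: transvec_row_def field_simps)
  qed (use D two in auto)
  ultimately show ?thesis
    by (intro transvec_prod.induct[OF P, of "\<lambda>P. m P = 1"])
       (auto simp: id mult transvec_prod_invertible)
qed

lemma multiplicative_diag:
  fixes m :: "'a::field^'n^'n \<Rightarrow> 'b::idom"
  assumes mult: "\<And>A B. invertible A \<Longrightarrow> invertible B \<Longrightarrow> m (A ** B) = m A * m B"
    and nz: "\<And>A. invertible A \<Longrightarrow> m A \<noteq> 0" and d: "\<And>i. d i \<noteq> 0"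
  shows "m (diag_mat d) = (\<Prod>i\<in>UNIV. m (diag_mat (\<lambda>j. if j = i then d i else 1)))"
proof -
  have id: "m (mat 1) = 1"
    using mult[of "mat 1" "mat 1"] nz[of "mat 1"] by simp
  have "m (diag_mat (\<lambda>i. if i \<in> S then d i else 1)) =
     (\<Prod>i\<in>S. m (diag_mat (\<lambda>j. if j = i then d i else 1)))" if "finite S" for S :: "'n set"
    using that
  proof (induction S)
    case empty
    then show ?case by (simp add: diag_mat_1 id)
  next
    case (insert x S)
    have "diag_mat (\<lambda>i. if i \<in> insert x S then d i else 1) =
       diag_mat (\<lambda>j. if j = x then d x else 1) ** diag_mat (\<lambda>i. if i \<in> S then d i else 1)"
      using insert by (auto simp: diag_mat_mult intro!: arg_cong[of _ _ diag_mat])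
    then show ?case
      using insert d by (subst prod.insert) (auto simp: mult invertible_diag_mat)
  qed
  from this[of UNIV] show ?thesis by simp
qed

text \<open>Both \<open>m\<close> and the determinant are unchanged when transvections reduce
  \<open>A\<close> to diagonal form, so \<open>m\<close> is known once it is known on diagonal
  matrices with a single nontrivial entry. The function \<open>absv\<close> is abstract here because
  it is later instantiated with the reciprocal of the absolute value.\<close>

lemma multiplicative_eq_det:
  fixes m :: "'a::field^'n^'n \<Rightarrow> real" and absv :: "'a \<Rightarrow> real"
  assumes mult: "\<And>A B. invertible A \<Longrightarrow> invertible B \<Longrightarrow> m (A ** B) = m A * m B"
    and nz: "\<And>A. invertible A \<Longrightarrow> m A \<noteq> 0" and two: "(2::'a) \<noteq> 0"
    and absv: "\<And>x y. absv (x * y) = absv x * absv y" "\<And>x. x \<noteq> 0 \<Longrightarrow> absv x \<noteq> 0"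
    and diag: "\<And>i a. a \<noteq> 0 \<Longrightarrow> m (diag_mat (\<lambda>j. if j = i then a else 1)) = absv a ^ r"
    and A: "invertible A"
  shows "m A = absv (det A) ^ r"
proof -
  obtain P Q d where PQ: "transvec_prod P" "transvec_prod Q" "P ** A ** Q = diag_mat d"
    using diagonalize_by_transvec .
  have det: "det (A ** B) = det A * det B" "invertible A \<Longrightarrow> det A \<noteq> 0" for A B :: "'a^'n^'n"
    by (auto simp: det_mul invertible_det_nz)
  have inv: "invertible P" "invertible Q" using PQ transvec_prod_invertible by auto
  have m: "m (diag_mat d) = m A"
    using multiplicative_transvec[OF mult nz two PQ(1)] multiplicative_transvec[OF mult nz two PQ(2)] inv A
    unfolding PQ(3)[symmetric] by (simp add: mult invertible_mult)
  have detd: "det (diag_mat d) = det A"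
    using multiplicative_transvec[of det, OF det two PQ(1)] multiplicative_transvec[of det, OF det two PQ(2)]
    unfolding PQ(3)[symmetric] by (simp add: det_mul)
  have pd: "det (diag_mat d) = prod d UNIV"
    by (simp add: diag_mat_def det_diagonal)
  have d: "d i \<noteq> 0" for i
    using detd det(2)[OF A] prod_zero[of UNIV d] unfolding pd by auto
  have "absv (\<Prod>i\<in>S. d i) = (\<Prod>i\<in>S. absv (d i))" for S :: "'n set"
  proof (induction S rule: infinite_finite_induct)
    case empty
    then show ?case using absv(1)[of 1 1] absv(2)[of 1] by simp
  qed (auto simp: absv)
  moreover have "m (diag_mat d) = (\<Prod>i\<in>UNIV. absv (d i) ^ r)"
    by (rule trans[OF multiplicative_diag[of m d, OF mult nz d]]) (auto intro!: prod.cong diag d)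
  ultimately show ?thesis
    unfolding m[symmetric] detd[symmetric] pd by (simp add: prod_power_distrib)
qed

section \<open>Rank of products, sums and diagonal matrices; equivalence of matrices of equal
  rank\<close>

lemma rank_mult_le_right: "rank ((A :: 'a::field^'n^'n) ** B) \<le> rank B"
proof -
  have "row i (A ** B) = (\<Sum>k\<in>UNIV. A $ i $ k *s row k B)" for i
    by (simp add: vec_eq_iff row_def matrix_mult_entry sum_component)
  then have "rows (A ** B) \<subseteq> vec.span (rows B)"
    by (fastforce simp: rows_def intro: vec.span_sum vec.span_scale vec.span_base)
  then show ?thesis
    unfolding row_rank_def_gen using vec.dim_subset vec.dim_span by metis
qed

lemma rank_mult_le_left: "rank ((A :: 'a::field^'n^'n) ** B) \<le> rank A"
proof -
  have "row i (A ** B) = transpose B *v row i A" for i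
    by (simp add: vec_eq_iff row_def matrix_mult_entry matrix_vector_mult_def transpose_def mult.commute)
  then have "rows (A ** B) = (*v) (transpose B) ` rows A"
    by (auto simp: rows_def)
  then show ?thesis
    unfolding row_rank_def_gen using vec.dim_image_le[OF matrix_vector_mul_linear_gen] by metis
qed

lemma rank_mult_invertible:
  fixes A B g h :: "'a::field^'n^'n"
  assumes "invertible g" "invertible h"
  shows "rank (g ** A ** h) = rank A"
proof (rule antisym)
  show "rank (g ** A ** h) \<le> rank A"
    using rank_mult_le_left rank_mult_le_right le_trans by blast
  obtain g' h' where "g' ** g = mat 1" "h ** h' = mat 1"
    using assms unfolding invertible_def by auto
  then have "A = g' ** (g ** A ** h) ** h'"
    by (metis matrix_mul_assoc matrix_mul_lid matrix_mul_rid)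
  then show "rank A \<le> rank (g ** A ** h)"
    using rank_mult_le_left rank_mult_le_right le_trans by metis
qed

lemma rank_add_le: "rank ((A :: 'a::field^'n^'n) + B) \<le> rank A + rank B"
proof -
  obtain S where S: "S \<subseteq> rows A" "vec.independent S" "rows A \<subseteq> vec.span S" "card S = rank A"
    using vec.basis_exists[of "rows A"] unfolding row_rank_def_gen by metis
  obtain T where T: "T \<subseteq> rows B" "vec.independent T" "rows B \<subseteq> vec.span T" "card T = rank B"
    using vec.basis_exists[of "rows B"] unfolding row_rank_def_gen by metis
  have "rows (A + B) \<subseteq> vec.span (S \<union> T)"
  proof
    fix x assume "x \<in> rows (A + B)"
    then obtain i where "x = row i A + row i B"
      by (auto simp: rows_def row_def vec_eq_iff)
    moreover have "row i A \<in> vec.span (S \<union> T)" "row i B \<in> vec.span (S \<union> T)"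
      using S(3) T(3) vec.span_mono[of S "S \<union> T"] vec.span_mono[of T "S \<union> T"]
      by (auto simp: rows_def)
    ultimately show "x \<in> vec.span (S \<union> T)" by (simp add: vec.span_add)
  qed
  moreover have "finite (S \<union> T)"
    using S T vec.finiteI_independent by blast
  ultimately have "rank (A + B) \<le> card (S \<union> T)"
    unfolding row_rank_def_gen by (rule vec.dim_le_card)
  then show ?thesis using card_Un_le[of S T] S T by simp
qed

lemma rank_diag_mat: "rank (diag_mat d :: 'a::field^'n^'n) = card {i. d i \<noteq> 0}"
proof -
  have r: "row i (diag_mat d) = d i *s axis i 1" for i
    by (auto simp: row_def diag_mat_def axis_def vec_eq_iff)
  have span: "vec.span (rows (diag_mat d)) = vec.span ((\<lambda>i. axis i 1 :: 'a^'n) ` {i. d i \<noteq> 0})" (is "_ = vec.span ?A")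
  proof (rule antisym)
    show "vec.span (rows (diag_mat d)) \<subseteq> vec.span ?A"
    proof (rule vec.span_minimal)
      show "rows (diag_mat d) \<subseteq> vec.span ?A"
      proof
        fix x assume "x \<in> rows (diag_mat d)"
        then obtain i where "x = d i *s axis i 1" by (auto simp: rows_def r)
        then show "x \<in> vec.span ?A"
          using vec.span_scale[OF vec.span_base, of "axis i 1" ?A "d i"]
          by (cases "d i = 0") (auto simp: vec.span_zero)
      qed
    qed auto
    show "vec.span ?A \<subseteq> vec.span (rows (diag_mat d))"
    proof (rule vec.span_minimal)
      show "?A \<subseteq> vec.span (rows (diag_mat d))"
      proof safe
        fix i assume "d i \<noteq> 0"
        then have "axis i 1 = inverse (d i) *s row i (diag_mat d)"
          by (simp add: r)
        then show "axis i 1 \<in> vec.span (rows (diag_mat d))"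
          using vec.span_scale[OF vec.span_base, of "row i (diag_mat d)" "rows (diag_mat d)" "inverse (d i)"]
          by (auto simp: rows_def)
      qed
    qed auto
  qed
  have "vec.independent ?A"
    by (rule vec.independent_mono[OF independent_cart_basis]) (auto simp: cart_basis_def)
  then have "vec.dim ?A = card ?A" by (rule vec.dim_eq_card_independent)
  also have "\<dots> = card {i. d i \<noteq> 0}"
    by (rule card_image) (auto simp: inj_on_def axis_eq_axis)
  finally show ?thesis
    unfolding row_rank_def_gen using span vec.dim_span by metis
qed

lemma rank_mat_1: "rank (mat 1 :: 'a::field^'n^'n) = CARD('n)"
  using rank_diag_mat[of "\<lambda>_. 1 :: 'a"] by (simp add: diag_mat_1)

lemma rank_invertible_iff: "rank (A :: 'a::field^'n^'n) = CARD('n) \<longleftrightarrow> invertible A"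
proof
  assume "invertible A"
  then show "rank A = CARD('n)"
    using rank_mult_invertible[of A "mat 1" "mat 1"] by (simp add: rank_mat_1)
next
  assume A: "rank A = CARD('n)"
  obtain P Q d where PQ: "transvec_prod P" "transvec_prod Q" "P ** A ** Q = diag_mat d"
    using diagonalize_by_transvec .
  then have "card {i. d i \<noteq> 0} = CARD('n)"
    using A rank_mult_invertible transvec_prod_invertible rank_diag_mat by metis
  then have "{i. d i \<noteq> 0} = UNIV"
    by (metis card_subset_eq finite_code subset_UNIV)
  then have "det (P ** A ** Q) \<noteq> 0"
    unfolding PQ(3) by (auto simp: diag_mat_def det_diagonal)
  then show "invertible A" by (simp add: det_mul invertible_det_nz)
qed

lemma rank_le_CARD: "rank (A :: 'a::field^'n^'n) \<le> CARD('n)"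
  using rank_mult_le_left[of "mat 1" A] by (simp add: rank_mat_1)

text \<open>A permutation matches the supports of \<open>e\<close> and \<open>d\<close>, and a
  diagonal matrix corrects the values there. Off the support the correction is 1, which keeps that
  matrix invertible.\<close>

lemma diag_mat_equiv:
  fixes d e :: "'n::finite \<Rightarrow> 'a::field"
  assumes "card {i. d i \<noteq> 0} = card {i. e i \<noteq> 0}"
  shows "\<exists>g h. invertible g \<and> invertible h \<and> diag_mat e = g ** diag_mat d ** h"
proof -
  obtain f1 where f1: "bij_betw f1 {i. e i \<noteq> 0} {i. d i \<noteq> 0}"
    using assms finite_same_card_bij by (metis finite_code)
  have "card (-{i. e i \<noteq> 0}) = card (-{i. d i \<noteq> 0})"
    using assms by (simp add: Compl_eq_Diff_UNIV card_Diff_subset)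
  then obtain f2 where f2: "bij_betw f2 (-{i. e i \<noteq> 0}) (-{i. d i \<noteq> 0})"
    using finite_same_card_bij by (metis finite_code)
  define f where "f i = (if e i \<noteq> 0 then f1 i else f2 i)" for i
  have b1: "bij_betw f {i. e i \<noteq> 0} {i. d i \<noteq> 0}"
    using f1 by (rule bij_betw_cong[THEN iffD1, rotated]) (auto simp: f_def)
  have b2: "bij_betw f (-{i. e i \<noteq> 0}) (-{i. d i \<noteq> 0})"
    using f2 by (rule bij_betw_cong[THEN iffD1, rotated]) (auto simp: f_def)
  have "bij_betw f ({i. e i \<noteq> 0} \<union> -{i. e i \<noteq> 0}) ({i. d i \<noteq> 0} \<union> -{i. d i \<noteq> 0})"
    by (rule bij_betw_combine[OF b1 b2]) auto
  then have f: "bij f" by simp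
  have de: "d (f i) \<noteq> 0 \<longleftrightarrow> e i \<noteq> 0" for i
    using b1 b2 by (auto simp: bij_betw_def)
  define c where "c i = (if e i = 0 then 1 else e i / d (f i))" for i
  have c: "c i \<noteq> 0" "c i * d (f i) = e i" for i using de[of i] by (auto simp: c_def)
  define p :: "'a^'n^'n" where "p = (\<chi> i j. of_bool (j = f i))"
  define q :: "'a^'n^'n" where "q = (\<chi> j i. of_bool (j = f i))"
  have pq: "p ** q = mat 1"
    using bij_is_inj[OF f]
    by (auto simp: vec_eq_iff matrix_mult_entry p_def q_def mat_def of_bool_def if_distrib[of "\<lambda>x. x * _"] inj_eq cong: if_cong)
  have "(diag_mat c ** p) ** diag_mat d ** q = diag_mat e"
  proof -
    have "((diag_mat c ** p) ** diag_mat d ** q) $ i $ k = diag_mat e $ i $ k" for i k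
    proof -
      have "((diag_mat c ** p) ** diag_mat d ** q) $ i $ k
         = (\<Sum>j\<in>UNIV. if j = f i then (if f i = f k then c i * d j else 0) else 0)"
        unfolding matrix_mult_entry[of _ q] mult_diag_mat_entry diag_mat_mult_entry
        by (intro sum.cong) (auto simp: p_def q_def)
      also have "\<dots> = diag_mat e $ i $ k"
        using bij_is_inj[OF f] c by (auto simp: diag_mat_def inj_eq)
      finally show ?thesis .
    qed
    then show ?thesis by (simp add: vec_eq_iff)
  qed
  moreover have "invertible (diag_mat c ** p)" "invertible q"
    using invertible_mult_eqI[OF pq] c invertible_diag_mat invertible_mult by blast+
  ultimately show ?thesis by metis
qed

lemma matrix_inv_mult:
  fixes A :: "'a::field^'n^'n"
  assumes "invertible A"
  shows "A ** matrix_inv A = mat 1" "matrix_inv A ** A = mat 1" "invertible (matrix_inv A)"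
proof -
  show 1: "A ** matrix_inv A = mat 1" "matrix_inv A ** A = mat 1"
    using someI_ex[OF assms[unfolded invertible_def]] unfolding matrix_inv_def by auto
  show "invertible (matrix_inv A)" using 1 invertible_mult_eqI by blast
qed

lemma matrix_inv_cancel:
  fixes A :: "'a::field^'n^'n"
  assumes "invertible A"
  shows "A ** (matrix_inv A ** B) = B" "matrix_inv A ** (A ** B) = B"
    "B ** A ** matrix_inv A = B" "B ** matrix_inv A ** A = B"
  using matrix_inv_mult[OF assms] matrix_mul_assoc by (metis matrix_mul_lid matrix_mul_rid)+

text \<open>Transitivity of the two-sided action on \<open>rank_orbit k\<close>: both matrices are
  brought to diagonal form, where only the number of nonzero entries matters.\<close>

lemma rank_eq_imp_equiv:
  fixes A B :: "'a::field^'n^'n"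
  assumes "rank A = rank B"
  obtains g h where "invertible g" "invertible h" "B = g ** A ** h"
proof -
  obtain P Q d where PQ: "transvec_prod P" "transvec_prod Q" "P ** A ** Q = diag_mat d"
    using diagonalize_by_transvec .
  obtain P' Q' d' where PQ': "transvec_prod P'" "transvec_prod Q'" "P' ** B ** Q' = diag_mat d'"
    using diagonalize_by_transvec .
  have inv: "invertible P" "invertible Q" "invertible P'" "invertible Q'"
    using PQ PQ' transvec_prod_invertible by auto
  have "card {i. d i \<noteq> 0} = card {i. d' i \<noteq> 0}"
    using assms inv PQ PQ' rank_mult_invertible rank_diag_mat by metis
  then obtain g h where gh: "invertible g" "invertible h" "diag_mat d' = g ** diag_mat d ** h"
    using diag_mat_equiv by blast
  have "B = matrix_inv P' ** (P' ** B ** Q') ** matrix_inv Q'"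
    using inv by (simp add: matrix_mul_assoc matrix_inv_cancel matrix_inv_mult)
  also have "\<dots> = (matrix_inv P' ** g ** P) ** A ** (Q ** h ** matrix_inv Q')"
    unfolding PQ'(3) gh(3) PQ(3)[symmetric] by (simp add: matrix_mul_assoc)
  finally have "B = (matrix_inv P' ** g ** P) ** A ** (Q ** h ** matrix_inv Q')" .
  moreover have "invertible (matrix_inv P' ** g ** P)" "invertible (Q ** h ** matrix_inv Q')"
    using inv gh by (auto intro!: invertible_mult matrix_inv_mult(3))
  ultimately show ?thesis using that by blast
qed

section \<open>Uniqueness of relatively invariant measures\<close>

lemma nn_integral_scaled_action:
  assumes f: "T \<in> M \<rightarrow>\<^sub>M M"
    and inv: "\<And>A. A \<in> sets M \<Longrightarrow> emeasure M (T -` A \<inter> space M) = c * emeasure M A"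
    and h: "h \<in> borel_measurable M"
  shows "(\<integral>\<^sup>+ p. h (T p) \<partial>M) = c * (\<integral>\<^sup>+ p. h p \<partial>M)"
proof -
  have "distr M M T = scale_measure c M"
    by (rule measure_eqI) (auto simp: emeasure_distr[OF f] inv)
  then have "(\<integral>\<^sup>+ p. h p \<partial>distr M M T) = c * (\<integral>\<^sup>+ p. h p \<partial>M)"
    using h by (simp add: nn_integral_scale_measure)
  then show ?thesis using f h by (simp add: nn_integral_distr)
qed

lemma AE_nonzero_ex:
  assumes "emeasure M (space M) \<noteq> 0" "AE p in M. P p"
  shows "\<exists>p\<in>space M. P p"
proof (rule ccontr)
  assume "\<not> ?thesis"
  then have "AE p in M. False"
    using AE_space[of M] assms(2) by (auto elim: eventually_elim2)
  then show False using assms(1) AE_iff_measurable[of "space M" M "\<lambda>_. False"] by auto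
qed

text \<open>\<open>G\<close> is a mere measure space. The group law enters only through
  \<open>act_inverse\<close>. Transitivity, together with the behaviour of null sets of
  \<open>G\<close> under translation, enters only through \<open>null\<close>: the orbit maps of any
  two points of \<open>Orb\<close> pull back the same null sets.\<close>

locale relatively_invariant =
  fixes G :: "'g measure" and M N :: "'b measure" and act :: "'g \<Rightarrow> 'b \<Rightarrow> 'b"
    and \<delta> :: "'g \<Rightarrow> real" and Orb :: "'b set"
  assumes sfG: "sigma_finite_measure G" and sfM: "sigma_finite_measure M"
    and sfN: "sigma_finite_measure N"
    and G_nonzero: "emeasure G (space G) \<noteq> 0"
    and M_nonzero: "emeasure M (space M) \<noteq> 0" and N_nonzero: "emeasure N (space N) \<noteq> 0"
    and sets_eq: "sets N = sets M"
    and act_meas: "(\<lambda>(g, p). act g p) \<in> G \<Otimes>\<^sub>M M \<rightarrow>\<^sub>M M"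
    and act_inverse: "\<And>g. g \<in> space G \<Longrightarrow> \<exists>g'\<in>space G. \<forall>p\<in>space M. act g' (act g p) = p"
    and \<delta>_pos: "\<And>g. g \<in> space G \<Longrightarrow> \<delta> g > 0"
    and \<delta>_meas: "\<delta> \<in> borel_measurable G"
    and invM: "\<And>g A. g \<in> space G \<Longrightarrow> A \<in> sets M \<Longrightarrow>
           emeasure M (act g -` A \<inter> space M) = ennreal (\<delta> g) * emeasure M A"
    and invN: "\<And>g A. g \<in> space G \<Longrightarrow> A \<in> sets M \<Longrightarrow>
           emeasure N (act g -` A \<inter> space M) = ennreal (\<delta> g) * emeasure N A"
    and OrbM: "AE p in M. p \<in> Orb" and OrbN: "AE p in N. p \<in> Orb" and Orb_space: "Orb \<subseteq> space M"
    and null: "\<And>p p' A. p \<in> Orb \<Longrightarrow> p' \<in> Orb \<Longrightarrow> A \<in> sets M \<Longrightarrow>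
           emeasure G {g \<in> space G. act g p \<in> A} = 0 \<Longrightarrow> emeasure G {g \<in> space G. act g p' \<in> A} = 0"
begin

text \<open>Fubini for the indicator of \<open>act g p \<in> A\<close>. Integrating over
  \<open>p\<close> before \<open>g\<close> gives \<open>emeasure K A\<close> times the integral of
  \<open>\<delta>\<close>; the other order integrates a function of \<open>p\<close> that, by
  \<open>null\<close>, vanishes everywhere or nowhere on \<open>Orb\<close>. The resulting criterion
  does not mention \<open>K\<close>, so it applies to \<open>M\<close> and \<open>N\<close>
  alike.\<close>

lemma null_sets_iff_aux:
  assumes K: "sigma_finite_measure K" "sets K = sets M" "emeasure K (space K) \<noteq> 0"
    and inv: "\<And>g A. g \<in> space G \<Longrightarrow> A \<in> sets M \<Longrightarrow>
           emeasure K (act g -` A \<inter> space M) = ennreal (\<delta> g) * emeasure K A"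
    and Orb: "AE p in K. p \<in> Orb"
    and A: "A \<in> sets M"
  shows "emeasure K A = 0 \<longleftrightarrow> (\<forall>p\<in>Orb. emeasure G {g \<in> space G. act g p \<in> A} = 0)"
proof -
  interpret G: sigma_finite_measure G by (rule sfG)
  interpret K: sigma_finite_measure K by (rule K)
  interpret GK: pair_sigma_finite G K by unfold_locales
  have spK: "space K = space M" using sets_eq_imp_space_eq[OF K(2)] .
  have meas[measurable]: "(\<lambda>(g, p). act g p) \<in> G \<Otimes>\<^sub>M K \<rightarrow>\<^sub>M M"
    using act_meas K(2) by (simp cong: measurable_cong_sets sets_pair_measure_cong)
  note [measurable] = A \<delta>_meas
  have ind: "(\<lambda>(g, p). indicator A (act g p) :: ennreal) \<in> borel_measurable (G \<Otimes>\<^sub>M K)"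
    using borel_measurable_indicator[OF A, THEN measurable_compose[OF meas]]
    by (simp add: case_prod_beta')
  have g1: "(\<lambda>p. act g p) \<in> M \<rightarrow>\<^sub>M M" if "g \<in> space G" for g
    using measurable_compose[OF measurable_Pair1'[OF that] act_meas] by simp
  have p1: "(\<lambda>g. act g p) \<in> G \<rightarrow>\<^sub>M M" if "p \<in> space M" for p
    using measurable_compose[OF measurable_Pair2'[OF that] act_meas] by simp
  have "(\<integral>\<^sup>+ g. (\<integral>\<^sup>+ p. indicator A (act g p) \<partial>K) \<partial>G) = (\<integral>\<^sup>+ p. (\<integral>\<^sup>+ g. indicator A (act g p) \<partial>G) \<partial>K)"
    using GK.Fubini[OF ind] by simp
  also have "(\<integral>\<^sup>+ g. (\<integral>\<^sup>+ p. indicator A (act g p) \<partial>K) \<partial>G) = (\<integral>\<^sup>+ g. ennreal (\<delta> g) * emeasure K A \<partial>G)"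
  proof (rule nn_integral_cong)
    fix g assume g: "g \<in> space G"
    have "(\<integral>\<^sup>+ p. indicator A (act g p) \<partial>K) = (\<integral>\<^sup>+ p. indicator (act g -` A \<inter> space M) p \<partial>K)"
      by (rule nn_integral_cong) (auto simp: indicator_def spK)
    also have "\<dots> = emeasure K (act g -` A \<inter> space M)"
      using measurable_sets[OF g1[OF g] A] K(2) by simp
    finally show "(\<integral>\<^sup>+ p. indicator A (act g p) \<partial>K) = ennreal (\<delta> g) * emeasure K A"
      using inv[OF g A] by simp
  qed
  also have "\<dots> = (\<integral>\<^sup>+ g. ennreal (\<delta> g) \<partial>G) * emeasure K A"
    by (rule nn_integral_multc) measurable
  also have "(\<integral>\<^sup>+ p. (\<integral>\<^sup>+ g. indicator A (act g p) \<partial>G) \<partial>K)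
      = (\<integral>\<^sup>+ p. emeasure G {g \<in> space G. act g p \<in> A} \<partial>K)"
  proof (rule nn_integral_cong)
    fix p assume p: "p \<in> space K"
    have "(\<integral>\<^sup>+ g. indicator A (act g p) \<partial>G) = (\<integral>\<^sup>+ g. indicator {g \<in> space G. act g p \<in> A} g \<partial>G)"
      by (rule nn_integral_cong) (auto simp: indicator_def)
    also have "\<dots> = emeasure G {g \<in> space G. act g p \<in> A}"
      using measurable_sets[OF p1 A, of p] p spK by (simp add: vimage_def Int_def conj_commute)
    finally show "(\<integral>\<^sup>+ g. indicator A (act g p) \<partial>G) = emeasure G {g \<in> space G. act g p \<in> A}" .
  qed
  finally have eq: "(\<integral>\<^sup>+ g. ennreal (\<delta> g) \<partial>G) * emeasure K A
     = (\<integral>\<^sup>+ p. emeasure G {g \<in> space G. act g p \<in> A} \<partial>K)" .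
  \<comment> \<open>The integral may be infinite. Being nonzero is enough for the product to vanish
    exactly when \<open>emeasure K A\<close> does.\<close>
  have nz: "(\<integral>\<^sup>+ g. ennreal (\<delta> g) \<partial>G) \<noteq> 0"
  proof
    assume "(\<integral>\<^sup>+ g. ennreal (\<delta> g) \<partial>G) = 0"
    then have "AE g in G. ennreal (\<delta> g) = 0" by (subst (asm) nn_integral_0_iff_AE) auto
    then show False using AE_nonzero_ex[OF G_nonzero] \<delta>_pos by force
  qed
  have meas2: "(\<lambda>p. emeasure G {g \<in> space G. act g p \<in> A}) \<in> borel_measurable K"
  proof -
    have "(\<lambda>p. \<integral>\<^sup>+ g. indicator A (act g p) \<partial>G) \<in> borel_measurable K"
      by (intro G.borel_measurable_nn_integral) (use measurable_compose[OF measurable_pair_swap' ind] in \<open>simp add: case_prod_beta'\<close>)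
    then show ?thesis
    proof (rule measurable_cong[THEN iffD1, rotated])
      fix p assume p: "p \<in> space K"
      have "(\<integral>\<^sup>+ g. indicator A (act g p) \<partial>G) = (\<integral>\<^sup>+ g. indicator {g \<in> space G. act g p \<in> A} g \<partial>G)"
        by (rule nn_integral_cong) (auto simp: indicator_def)
      also have "\<dots> = emeasure G {g \<in> space G. act g p \<in> A}"
        using measurable_sets[OF p1 A, of p] p spK by (simp add: vimage_def Int_def conj_commute)
      finally show "(\<integral>\<^sup>+ g. indicator A (act g p) \<partial>G) = emeasure G {g \<in> space G. act g p \<in> A}" .
    qed
  qed
  show ?thesis
  proof
    assume "emeasure K A = 0"
    with eq have "AE p in K. emeasure G {g \<in> space G. act g p \<in> A} = 0"
      using nn_integral_0_iff_AE[OF meas2] by simp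
    with Orb have ae: "AE p in K. p \<in> Orb \<and> emeasure G {g \<in> space G. act g p \<in> A} = 0"
      by eventually_elim auto
    show "\<forall>p\<in>Orb. emeasure G {g \<in> space G. act g p \<in> A} = 0"
      using AE_nonzero_ex[OF K(3) ae] null A by blast
  next
    assume a: "\<forall>p\<in>Orb. emeasure G {g \<in> space G. act g p \<in> A} = 0"
    have "AE p in K. emeasure G {g \<in> space G. act g p \<in> A} = 0"
      using Orb by eventually_elim (use a in auto)
    then have "(\<integral>\<^sup>+ p. emeasure G {g \<in> space G. act g p \<in> A} \<partial>K) = 0"
      using nn_integral_0_iff_AE[OF meas2] by simp
    then show "emeasure K A = 0" using eq nz by auto
  qed
qed

lemma null_M_iff:
  "A \<in> sets M \<Longrightarrow> emeasure M A = 0 \<longleftrightarrow> (\<forall>p\<in>Orb. emeasure G {g \<in> space G. act g p \<in> A} = 0)"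
  by (rule null_sets_iff_aux[OF sfM refl M_nonzero _ OrbM]) (auto simp: invM)

lemma null_N_iff:
  "A \<in> sets M \<Longrightarrow> emeasure N A = 0 \<longleftrightarrow> (\<forall>p\<in>Orb. emeasure G {g \<in> space G. act g p \<in> A} = 0)"
  by (rule null_sets_iff_aux[OF sfN sets_eq N_nonzero _ OrbN]) (auto simp: invN)

text \<open>The density of \<open>N\<close> with respect to \<open>M\<close> is invariant under the action up to null sets,
  so by Fubini it is constant along almost every orbit map, hence constant.\<close>

theorem proportional: "\<exists>c::real. c > 0 \<and> N = scale_measure (ennreal c) M"
proof -
  interpret G: sigma_finite_measure G by (rule sfG)
  interpret M: sigma_finite_measure M by (rule sfM)
  interpret N: sigma_finite_measure N by (rule sfN)
  interpret GM: pair_sigma_finite G M by unfold_locales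
  have ac: "absolutely_continuous M N"
    unfolding absolutely_continuous_def null_sets_def
    by (auto simp: sets_eq null_M_iff null_N_iff)
  then obtain r where r[measurable]: "r \<in> borel_measurable M" and N: "density M r = N"
    using M.Radon_Nikodym[OF ac sets_eq] by auto
  note [measurable] = act_meas
  have g1[measurable]: "act g \<in> M \<rightarrow>\<^sub>M M" if "g \<in> space G" for g
    using measurable_compose[OF measurable_Pair1'[OF that] act_meas] by simp
  have ae_g: "AE p in M. r (act g p) = r p" if g: "g \<in> space G" for g
  proof -
    note [measurable] = g1[OF g]
    have "density M (\<lambda>p. r (act g p)) = density M r"
    proof (rule measure_eqI)
      fix B assume "B \<in> sets (density M (\<lambda>p. r (act g p)))"
      then have B[measurable]: "B \<in> sets M" by simp
      obtain g' where g': "g' \<in> space G" "\<And>p. p \<in> space M \<Longrightarrow> act g' (act g p) = p"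
        using act_inverse[OF g] by blast
      \<comment> \<open>Chosen so that its preimage under \<open>act g\<close> is \<open>B\<close>.
        The change of variables for \<open>M\<close> and the scaling of \<open>N\<close> carry the
        same factor \<open>\<delta> g\<close>, so the translated density integrates over
        \<open>B\<close> to \<open>emeasure N B\<close>, just as \<open>r\<close> does.\<close>
      define A where "A = act g' -` B \<inter> space M"
      have A[measurable]: "A \<in> sets M" unfolding A_def using measurable_sets[OF g1[OF g'(1)] B] .
      have AB: "indicator A (act g p) = (indicator B p :: ennreal)" if "p \<in> space M" for p
        using that g' measurable_space[OF g1[OF g] that] by (auto simp: A_def indicator_def)
      have vB: "act g -` A \<inter> space M = B"
        using sets.sets_into_space[OF B] g' measurable_space[OF g1[OF g]] by (auto simp: A_def)
      have "emeasure (density M (\<lambda>p. r (act g p))) B = (\<integral>\<^sup>+ p. r (act g p) * indicator A (act g p) \<partial>M)"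
        by (subst emeasure_density) (auto intro!: nn_integral_cong simp: AB)
      also have "\<dots> = ennreal (\<delta> g) * (\<integral>\<^sup>+ p. r p * indicator A p \<partial>M)"
        by (rule nn_integral_scaled_action[of _ _ _ "\<lambda>p. r p * indicator A p"]) (use invM g in auto)
      also have "\<dots> = ennreal (\<delta> g) * emeasure N A"
        unfolding N[symmetric] by (simp add: emeasure_density)
      also have "\<dots> = emeasure N B" using invN[OF g A] vB by simp
      finally show "emeasure (density M (\<lambda>p. r (act g p))) B = emeasure (density M r) B"
        using N by simp
    qed simp
    then show ?thesis by (intro M.density_unique) auto
  qed
  have "AE x in G \<Otimes>\<^sub>M M. (case x of (g, p) \<Rightarrow> r (act g p) = r p)"
    by (rule GM.AE_pair_measure) (use ae_g in \<open>auto intro!: AE_I2\<close>)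
  then have "AE g in G. AE p in M. r (act g p) = r p"
    using GM.AE_pair by fastforce
  then have "AE p in M. AE g in G. r (act g p) = r p"
    by (subst (asm) GM.AE_commute) auto
  with OrbM have "AE p in M. p \<in> Orb \<and> (AE g in G. r (act g p) = r p)"
    by eventually_elim auto
  then obtain p where p: "p \<in> Orb" "AE g in G. r (act g p) = r p"
    using AE_nonzero_ex[OF M_nonzero] by blast
  define A where "A = {q \<in> space M. r q \<noteq> r p}"
  have A[measurable]: "A \<in> sets M" unfolding A_def by measurable
  have pM: "p \<in> space M" using p(1) Orb_space by auto
  have p1: "(\<lambda>g. act g p) \<in> G \<rightarrow>\<^sub>M M"
    using measurable_compose[OF measurable_Pair2'[OF pM] act_meas] by simp
  have eqN: "{g \<in> space G. \<not> r (act g p) = r p} = {g \<in> space G. act g p \<in> A}"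
    using measurable_space[OF p1] by (auto simp: A_def)
  have setN: "{g \<in> space G. act g p \<in> A} \<in> sets G"
    using measurable_sets[OF p1 A] by (simp add: vimage_def Int_def conj_commute)
  have "emeasure G {g \<in> space G. act g p \<in> A} = 0"
    using p(2) AE_iff_measurable[OF setN eqN] by blast
  then have "\<forall>p\<in>Orb. emeasure G {g \<in> space G. act g p \<in> A} = 0"
    using null p(1) A by blast
  then have "emeasure M A = 0" using null_M_iff[OF A] by simp
  then have "AE q in M. r q = r p"
    by (subst AE_iff_measurable[of A]) (auto simp: A_def)
  then have "density M r = density M (\<lambda>_. r p)"
    by (intro density_cong) auto
  then have Nc: "emeasure N B = r p * emeasure M B" if "B \<in> sets M" for B
    using that N by (metis emeasure_density_const)
  have "r p \<noteq> 0"
    using Nc[OF sets.top] N_nonzero sets_eq_imp_space_eq[OF sets_eq] by auto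
  \<comment> \<open>A constantly infinite density would leave \<open>N\<close> only the values 0 and
    infinity; sigma-finiteness would then force \<open>N\<close> to vanish.\<close>
  moreover have "r p \<noteq> \<infinity>"
  proof
    assume inf: "r p = \<infinity>"
    obtain S :: "nat \<Rightarrow> 'b set" where S: "range S \<subseteq> sets N" "(\<Union>i. S i) = space N" "\<And>i. emeasure N (S i) \<noteq> \<infinity>"
      using N.sigma_finite by metis
    have "emeasure N (S i) = 0" for i
    proof -
      have i: "S i \<in> sets M" using S(1) sets_eq by auto
      have "emeasure M (S i) = 0"
      proof (rule ccontr)
        assume "emeasure M (S i) \<noteq> 0"
        then have "emeasure N (S i) = \<infinity>" using Nc[OF i] inf by (simp add: ennreal_top_mult)
        then show False using S(3) by simp
      qed
      then show ?thesis using Nc[OF i] by simp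
    qed
    then have "emeasure N (\<Union>i. S i) = 0"
      using S(1) by (intro emeasure_UN_eq_0) auto
    then show False using S(2) N_nonzero by simp
  qed
  ultimately obtain c where c: "c > 0" "r p = ennreal c"
    by (cases "r p") (auto simp: ennreal_eq_0_iff less_le)
  have "N = scale_measure (ennreal c) M"
    by (rule measure_eqI) (use Nc c sets_eq in auto)
  then show ?thesis using c by blast
qed

end

section \<open>Topology of local fields and their matrix spaces\<close>

text \<open>A predicate on types instead of a class, because separability of the field is derived
  from the hypotheses on \<open>absv\<close> inside a locale.\<close>

definition separable_metric :: "'b::metric_space itself \<Rightarrow> bool" where
  "separable_metric _ \<longleftrightarrow> (\<exists>D::'b set. countable D \<and> (\<forall>x. \<forall>e>0. \<exists>d\<in>D. dist d x < e))"

lemma separable_metric_vec: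
  assumes "separable_metric TYPE('b::metric_space)"
  shows "separable_metric TYPE('b^'n)"
proof -
  obtain D :: "'b set" where D: "countable D" "\<And>x e. e > 0 \<Longrightarrow> \<exists>d\<in>D. dist d x < e"
    using assms unfolding separable_metric_def by blast
  have "countable (vec_lambda ` (PiE (UNIV::'n set) (\<lambda>_. D)))"
    by (intro countable_image countable_PiE D) auto
  moreover have "\<exists>d\<in>vec_lambda ` (PiE (UNIV::'n set) (\<lambda>_. D)). dist d x < e" if "e > 0" for x :: "'b^'n" and e
  proof -
    have e: "e / (2 * CARD('n)) > 0" using that by simp
    have "\<exists>f. \<forall>i. f i \<in> D \<and> dist (f i) (x $ i) < e / (2 * CARD('n))"
      using D(2)[OF e] by (intro choice allI) blast
    then obtain f where f: "\<And>i. f i \<in> D" "\<And>i. dist (f i) (x $ i) < e / (2 * CARD('n))"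
      by blast
    have "dist (vec_lambda f) x \<le> (\<Sum>i\<in>UNIV. dist (f i) (x $ i))"
      unfolding dist_vec_def by (rule order_trans[OF L2_set_le_sum]) auto
    also have "\<dots> \<le> (\<Sum>i\<in>(UNIV::'n set). e / (2 * CARD('n)))"
      by (intro sum_mono less_imp_le f)
    also have "\<dots> < e" using that by simp
    finally show ?thesis using f by blast
  qed
  ultimately show ?thesis unfolding separable_metric_def by blast
qed

lemma separable_metric_prod:
  assumes "separable_metric TYPE('b::metric_space)" "separable_metric TYPE('c::metric_space)"
  shows "separable_metric TYPE('b \<times> 'c)"
proof -
  obtain D :: "'b set" where D: "countable D" "\<And>x e. e > 0 \<Longrightarrow> \<exists>d\<in>D. dist d x < e"
    using assms unfolding separable_metric_def by blast
  obtain E :: "'c set" where E: "countable E" "\<And>x e. e > 0 \<Longrightarrow> \<exists>d\<in>E. dist d x < e"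
    using assms unfolding separable_metric_def by blast
  have "\<exists>d\<in>D \<times> E. dist d p < e" if e: "e > 0" for p :: "'b \<times> 'c" and e
  proof -
    obtain d where d: "d \<in> D" "dist d (fst p) < e / 2" using D(2)[OF half_gt_zero[OF e]] by blast
    obtain d' where d': "d' \<in> E" "dist d' (snd p) < e / 2" using E(2)[OF half_gt_zero[OF e]] by blast
    have "dist (d, d') p \<le> dist d (fst p) + dist d' (snd p)"
      unfolding dist_prod_def by (auto intro: order_trans[OF sqrt_sum_squares_le_sum_abs])
    then show ?thesis using d d' by (intro bexI[of _ "(d, d')"]) auto
  qed
  then show ?thesis unfolding separable_metric_def using D(1) E(1) by (intro exI[of _ "D \<times> E"]) auto
qed

lemma separable_metric_basis:
  assumes "separable_metric TYPE('b::metric_space)"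
  obtains B :: "'b::metric_space set set" where "countable B" "topological_basis B"
proof -
  obtain D :: "'b set" where D: "countable D" "\<And>x e. e > 0 \<Longrightarrow> \<exists>d\<in>D. dist d x < e"
    using assms unfolding separable_metric_def by blast
  let ?B = "(\<lambda>(d,n). ball d (1 / real (Suc n))) ` (D \<times> (UNIV :: nat set))"
  have "countable ?B" using D by auto
  moreover have "topological_basis ?B"
  proof (rule topological_basisI)
    fix S :: "'b set" and x assume S: "open S" "x \<in> S"
    then obtain e where e: "e > 0" "ball x e \<subseteq> S" by (meson open_contains_ball)
    obtain n where n: "1 / real (Suc n) < e / 2" using nat_approx_posE[of "e/2"] e by auto
    obtain d where d: "d \<in> D" "dist d x < 1 / real (Suc n)"
      using D(2)[of "1 / real (Suc n)" x] by auto
    have "ball d (1 / real (Suc n)) \<subseteq> S"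
    proof
      fix y assume "y \<in> ball d (1 / real (Suc n))"
      then have "dist x y < e" using d n dist_triangle3[of x y d] by (auto simp: dist_commute)
      then show "y \<in> S" using e by auto
    qed
    then show "\<exists>B'\<in>?B. x \<in> B' \<and> B' \<subseteq> S" using d by (intro bexI[of _ "ball d (1 / real (Suc n))"]) auto
  qed auto
  ultimately show ?thesis using that by blast
qed

text \<open>With countable bases every open set of the product is a countable union of open
  rectangles. This identification is what lets Fubini be applied to functions whose measurability
  comes from continuity.\<close>

lemma borel_prod_separable:
  assumes "separable_metric TYPE('b::metric_space)" "separable_metric TYPE('c::metric_space)"
  shows "sets (borel \<Otimes>\<^sub>M borel) = sets (borel :: ('b \<times> 'c) measure)"
proof -
  obtain B :: "'b set set" where B: "countable B" "topological_basis B"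
    using separable_metric_basis assms(1) .
  obtain C :: "'c set set" where C: "countable C" "topological_basis C"
    using separable_metric_basis assms(2) .
  have "sets borel \<subseteq> sets (borel \<Otimes>\<^sub>M borel :: ('b \<times> 'c) measure)"
  proof -
    have gen: "S \<in> sets (borel \<Otimes>\<^sub>M borel :: ('b \<times> 'c) measure)" if S: "open S" for S :: "('b \<times> 'c) set"
    proof -
      let ?I = "{(b, c). b \<in> B \<and> c \<in> C \<and> b \<times> c \<subseteq> S}"
      have eq: "S = (\<Union>(b, c)\<in>?I. b \<times> c)"
      proof safe
        fix x y assume "(x, y) \<in> S"
        then obtain U V where UV: "open U" "open V" "(x, y) \<in> U \<times> V" "U \<times> V \<subseteq> S"
          using S open_prod_elim by metis
        obtain b where "b \<in> B" "x \<in> b" "b \<subseteq> U"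
          using UV topological_basisE[OF B(2), of U x] by auto
        moreover obtain c where "c \<in> C" "y \<in> c" "c \<subseteq> V"
          using UV topological_basisE[OF C(2), of V y] by auto
        ultimately show "(x, y) \<in> (\<Union>(b, c)\<in>?I. b \<times> c)" using UV by blast
      qed auto
      have "countable ?I"
        by (rule countable_subset[of _ "B \<times> C"]) (use B C in auto)
      moreover have "b \<times> c \<in> sets (borel \<Otimes>\<^sub>M borel)" if "b \<in> B" "c \<in> C" for b c
        using that topological_basis_open[OF B(2)] topological_basis_open[OF C(2)]
        by (intro pair_measureI borel_open) auto
      ultimately have "(\<Union>(b, c)\<in>?I. b \<times> c) \<in> sets (borel \<Otimes>\<^sub>M borel)"
        by (intro sets.countable_UN') auto
      then show ?thesis using eq by simp
    qed
    have "sets borel = sigma_sets UNIV {S :: ('b \<times> 'c) set. open S}"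
      by (simp add: borel_def)
    also have "\<dots> \<subseteq> sets (borel \<Otimes>\<^sub>M borel)"
      using gen sets.sigma_sets_subset[of "{S. open S}" "borel \<Otimes>\<^sub>M borel :: ('b \<times> 'c) measure"]
      by (auto simp: space_pair_measure)
    finally show ?thesis .
  qed
  moreover have "sets (borel \<Otimes>\<^sub>M borel :: ('b \<times> 'c) measure) \<subseteq> sets borel"
  proof -
    have "a \<times> b \<in> sets (borel :: ('b \<times> 'c) measure)" if "a \<in> sets borel" "b \<in> sets borel" for a b
    proof -
      have "fst -` a \<inter> space borel \<in> sets (borel :: ('b \<times> 'c) measure)"
        by (rule measurable_sets[OF borel_measurable_continuous_onI that(1)]) (simp add: continuous_on_fst)
      moreover have "snd -` b \<inter> space borel \<in> sets (borel :: ('b \<times> 'c) measure)"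
        by (rule measurable_sets[OF borel_measurable_continuous_onI that(2)]) (simp add: continuous_on_snd)
      ultimately have "(fst -` a) \<inter> (snd -` b) \<in> sets (borel :: ('b \<times> 'c) measure)" by auto
      moreover have "a \<times> b = (fst -` a) \<inter> (snd -` b)" by auto
      ultimately show ?thesis by simp
    qed
    then show ?thesis
      by (intro sets_pair_in_sets) auto
  qed
  ultimately show ?thesis by auto
qed

lemma compact_vec_box:
  fixes K :: "'b::t2_space set"
  assumes "compact K"
  shows "compact {x::'b^'n. \<forall>i. x $ i \<in> K}"
proof -
  have "compactin (product_topology (\<lambda>i. euclidean) UNIV) (PiE (UNIV::'n set) (\<lambda>_. K))"
    using assms by (subst compactin_PiE) auto
  then have "compact (PiE (UNIV::'n set) (\<lambda>_. K))"
    by (simp add: euclidean_product_topology)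
  moreover have "continuous_on (PiE (UNIV::'n set) (\<lambda>_. K)) (\<lambda>f. \<chi> i. f i)"
    by (intro continuous_on_vec_lambda continuous_on_product_coordinates[THEN continuous_on_subset]) auto
  ultimately have "compact ((\<lambda>f. \<chi> i. f i) ` PiE (UNIV::'n set) (\<lambda>_. K))"
    by (rule compact_continuous_image[rotated])
  moreover have "(\<lambda>f. \<chi> i. f i) ` PiE (UNIV::'n set) (\<lambda>_. K) = {x. \<forall>i. x $ i \<in> K}"
  proof safe
    fix x :: "'b^'n" assume "\<forall>i. x $ i \<in> K"
    then show "x \<in> (\<lambda>f. \<chi> i. f i) ` PiE (UNIV::'n set) (\<lambda>_. K)"
      by (intro image_eqI[of _ _ "\<lambda>i. x $ i"]) auto
  qed auto
  ultimately show ?thesis by simp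
qed

section \<open>The absolute value, continuity of the field operations, ultrametric boxes and
  Schwartz functions\<close>

locale local_field =
  fixes absv :: "'a::{field,metric_space} \<Rightarrow> real"
  assumes nonarch: "nonarch_local_field absv"
begin

lemma abs_nonneg [simp]: "0 \<le> absv x"
  and abs_eq_0 [simp]: "absv x = 0 \<longleftrightarrow> x = 0"
  and abs_mult: "absv (x * y) = absv x * absv y"
  and abs_add_le: "absv (x + y) \<le> max (absv x) (absv y)"
  and dist_eq_abs: "dist x y = absv (x - y)"
  and compact_int: "compact {x. absv x \<le> 1}"
  using nonarch unfolding nonarch_local_field_def by auto

lemma abs_0 [simp]: "absv 0 = 0" by simp

lemma abs_pos_iff [simp]: "0 < absv x \<longleftrightarrow> x \<noteq> 0"
  by (simp add: less_le)

lemma two_nonzero [simp]: "(2::'a) \<noteq> 0"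
proof -
  have "CHAR('a) = 0" using nonarch unfolding nonarch_local_field_def by auto
  then have "of_nat 2 \<noteq> (0::'a)" by (subst of_nat_eq_0_iff_char_dvd) auto
  then show ?thesis by simp
qed

lemma abs_1 [simp]: "absv 1 = 1"
  using abs_mult[of 1 1] abs_eq_0[of 1] by simp

lemma abs_minus [simp]: "absv (- x) = absv x"
proof -
  have "absv (-1) ^ 2 = 1" by (simp add: power2_eq_square abs_mult[symmetric])
  then have "absv (-1) = 1" by (metis abs_nonneg power2_eq_1_iff real_minus_mult_self_le neg_0_le_iff_le not_one_le_zero)
  then show ?thesis using abs_mult[of "-1" x] by simp
qed

lemma abs_inverse: "absv (inverse x) = inverse (absv x)"
proof (cases "x = 0")
  case False
  then have "absv x * absv (inverse x) = 1" by (simp add: abs_mult[symmetric])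
  then show ?thesis using False by (simp add: field_simps)
qed simp

lemma abs_divide: "absv (x / y) = absv x / absv y"
  by (simp add: divide_inverse abs_mult abs_inverse)

lemma abs_power: "absv (x ^ n) = absv x ^ n"
  by (induction n) (auto simp: abs_mult)

lemma abs_diff_le: "absv (x - y) \<le> max (absv x) (absv y)"
  using abs_add_le[of x "-y"] by simp

lemma abs_diff_commute: "absv (x - y) = absv (y - x)"
  using abs_minus[of "x - y"] by simp

text \<open>The isosceles principle: in an ultrametric triangle the two longest sides are
  equal.\<close>

lemma abs_diff_less_imp_eq: "absv (x - y) < absv y \<Longrightarrow> absv x = absv y"
  using abs_add_le[of "x - y" y] abs_diff_le[of x "x - y"] by auto

lemma ex_abs_gt: obtains a where "absv a > R" "absv a > 1"
proof -
  obtain x where x: "absv x \<noteq> 0" "absv x \<noteq> 1"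
    using nonarch unfolding nonarch_local_field_def by auto
  obtain b where b: "absv b > 1"
  proof (cases "absv x > 1")
    case False
    then have "absv (inverse x) > 1" using x by (simp add: abs_inverse one_less_inverse)
    then show ?thesis using that by blast
  qed (use that in blast)
  obtain n where "max R 1 < absv b ^ n" using real_arch_pow[OF b] by blast
  then show ?thesis using that[of "b ^ n"] by (simp add: abs_power)
qed

lemma ex_abs_less: assumes "e > 0" obtains a where "a \<noteq> 0" "absv a < e"
proof -
  obtain a where a: "absv a > inverse e" "absv a > 1" using ex_abs_gt .
  then have "absv (inverse a) < e"
    using assms less_imp_inverse_less[of "inverse e" "absv a"] unfolding abs_inverse by simp
  moreover have "inverse a \<noteq> 0" using a by auto
  ultimately show ?thesis using that by blast
qed

lemma abs_sum_le: "finite S \<Longrightarrow> 0 \<le> r \<Longrightarrow> (\<And>i. i \<in> S \<Longrightarrow> absv (f i) \<le> r) \<Longrightarrow> absv (sum f S) \<le> r"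
proof (induction S rule: finite_induct)
  case (insert x F)
  then have "absv (f x) \<le> r" "absv (sum f F) \<le> r" by auto
  then show ?case unfolding sum.insert[OF insert(1,2)] using abs_add_le[of "f x" "sum f F"] by linarith
qed auto

lemma tendsto_add_F:
  fixes f g :: "'b \<Rightarrow> 'a"
  assumes "(f \<longlongrightarrow> l) F" "(g \<longlongrightarrow> m) F"
  shows "((\<lambda>x. f x + g x) \<longlongrightarrow> l + m) F"
proof (rule tendstoI)
  fix e :: real assume "e > 0"
  then have "eventually (\<lambda>x. dist (f x) l < e) F" "eventually (\<lambda>x. dist (g x) m < e) F"
    using assms by (auto dest: tendstoD)
  then show "eventually (\<lambda>x. dist (f x + g x) (l + m) < e) F"
  proof eventually_elim
    case (elim x)
    then show ?case using abs_add_le[of "f x - l" "g x - m"] by (simp add: dist_eq_abs algebra_simps)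
  qed
qed

lemma tendsto_mult_F:
  fixes f g :: "'b \<Rightarrow> 'a"
  assumes "(f \<longlongrightarrow> l) F" "(g \<longlongrightarrow> m) F"
  shows "((\<lambda>x. f x * g x) \<longlongrightarrow> l * m) F"
proof (rule tendstoI)
  fix e :: real assume e: "e > 0"
  \<comment> \<open>The split \<open>f x * (g x - m) + (f x - l) * m\<close> is estimated with
    \<open>absv (f x) < 1 + absv l\<close>, which requires \<open>d \<le> 1\<close>; the two
    summands are then controlled by \<open>d * (1 + absv l + absv m) \<le> e\<close>.\<close>
  define d where "d = min 1 (e / (1 + absv l + absv m))"
  have pos: "1 + absv l + absv m > 0" using abs_nonneg[of l] abs_nonneg[of m] by linarith
  have d: "d > 0" "d \<le> 1" "d * (1 + absv l + absv m) \<le> e"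
    using e pos by (auto simp: d_def pos_le_divide_eq[symmetric])
  have "eventually (\<lambda>x. dist (f x) l < d) F" "eventually (\<lambda>x. dist (g x) m < d) F"
    using assms d by (auto dest: tendstoD)
  then show "eventually (\<lambda>x. dist (f x * g x) (l * m) < e) F"
  proof eventually_elim
    case (elim x)
    then have fl: "absv (f x - l) < d" and gm: "absv (g x - m) < d" by (auto simp: dist_eq_abs)
    have fb: "absv (f x) < 1 + absv l" using abs_add_le[of "f x - l" l] fl d abs_nonneg[of l] unfolding diff_add_cancel by linarith
    have eq: "f x * g x - l * m = f x * (g x - m) + (f x - l) * m" by (simp add: algebra_simps)
    have "absv (f x * (g x - m)) < (1 + absv l) * d"
      unfolding abs_mult using fb gm d by (intro mult_strict_mono) (auto intro: add_pos_nonneg)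
    moreover have dm: "0 \<le> d * absv m" "0 \<le> d * absv l" "(1 + absv l) * d + d * absv m \<le> e"
      using d by (auto simp: algebra_simps)
    ultimately have 1: "absv (f x * (g x - m)) < e" by linarith
    have "absv ((f x - l) * m) \<le> d * absv m"
      unfolding abs_mult using fl by (intro mult_right_mono) auto
    also have "\<dots> < e" using mult_pos_pos[OF add_pos_nonneg[OF zero_less_one abs_nonneg[of l]] d(1)] dm(3) by linarith
    finally have 2: "absv ((f x - l) * m) < e" .
    show ?case unfolding dist_eq_abs eq using 1 2 abs_add_le[of "f x * (g x - m)" "(f x - l) * m"] by auto
  qed
qed

lemma continuous_on_add_F:
  fixes f g :: "'b::topological_space \<Rightarrow> 'a"
  shows "continuous_on S f \<Longrightarrow> continuous_on S g \<Longrightarrow> continuous_on S (\<lambda>x. f x + g x)"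
  unfolding continuous_on_def by (auto intro: tendsto_add_F)

lemma continuous_on_mult_F:
  fixes f g :: "'b::topological_space \<Rightarrow> 'a"
  shows "continuous_on S f \<Longrightarrow> continuous_on S g \<Longrightarrow> continuous_on S (\<lambda>x. f x * g x)"
  unfolding continuous_on_def by (auto intro: tendsto_mult_F)

lemma continuous_on_minus_F:
  fixes f :: "'b::topological_space \<Rightarrow> 'a"
  shows "continuous_on S f \<Longrightarrow> continuous_on S (\<lambda>x. - f x)"
  using continuous_on_mult_F[of S "\<lambda>x. -1" f] by simp

lemma continuous_on_diff_F:
  fixes f g :: "'b::topological_space \<Rightarrow> 'a"
  shows "continuous_on S f \<Longrightarrow> continuous_on S g \<Longrightarrow> continuous_on S (\<lambda>x. f x - g x)"
  using continuous_on_add_F[of S f "\<lambda>x. - g x"] continuous_on_minus_F[of S g] by simp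

lemma continuous_on_sum_F:
  fixes f :: "'i \<Rightarrow> 'b::topological_space \<Rightarrow> 'a"
  shows "(\<And>i. i \<in> I \<Longrightarrow> continuous_on S (f i)) \<Longrightarrow> continuous_on S (\<lambda>x. \<Sum>i\<in>I. f i x)"
  by (induction I rule: infinite_finite_induct) (auto intro: continuous_on_add_F)

lemma continuous_on_prod_F:
  fixes f :: "'i \<Rightarrow> 'b::topological_space \<Rightarrow> 'a"
  shows "(\<And>i. i \<in> I \<Longrightarrow> continuous_on S (f i)) \<Longrightarrow> continuous_on S (\<lambda>x. \<Prod>i\<in>I. f i x)"
  by (induction I rule: infinite_finite_induct) (auto intro: continuous_on_mult_F)

lemma continuous_on_abs: "continuous_on S f \<Longrightarrow> continuous_on S (\<lambda>x. absv (f x))"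
proof -
  assume "continuous_on S f"
  then have "continuous_on S (\<lambda>x. dist (f x) 0)" by (intro continuous_on_dist continuous_on_const)
  then show ?thesis by (simp add: dist_eq_abs)
qed

text \<open>The absolute value is constant on the ball of radius \<open>absv x\<close> around
  \<open>x\<close>, so there the inverses differ by exactly
  \<open>absv (x' - x) / (absv x * absv x)\<close>.\<close>

lemma continuous_on_inverse_F: "continuous_on (-{0}) (inverse :: 'a \<Rightarrow> 'a)"
  unfolding continuous_on_iff
proof safe
  fix x :: 'a and e :: real assume x: "x \<noteq> 0" and e: "e > 0"
  define d where "d = min (absv x) (e * absv x * absv x)"
  have "dist (inverse x') (inverse x) < e" if "x' \<noteq> 0" "dist x' x < d" for x'
  proof -
    have d: "absv (x' - x) < absv x" "absv (x' - x) < e * absv x * absv x"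
      using that by (auto simp: d_def dist_eq_abs)
    have eq: "absv x' = absv x" using abs_diff_less_imp_eq d by blast
    have "inverse x' - inverse x = (x - x') / (x * x')" using x that by (simp add: field_simps)
    then have "absv (inverse x' - inverse x) = absv (x' - x) / (absv x * absv x)"
      by (simp add: abs_divide abs_mult eq abs_diff_commute)
    also have "\<dots> < e" using d x by (simp add: divide_less_eq mult.assoc)
    finally show ?thesis by (simp add: dist_eq_abs)
  qed
  moreover have "d > 0" using x e by (simp add: d_def)
  ultimately show "\<exists>d>0. \<forall>x'\<in>- {0}. dist x' x < d \<longrightarrow> dist (inverse x') (inverse x) < e" by auto
qed

lemma compact_abs_le: "compact {x. absv x \<le> r}"
proof -
  obtain a where a: "absv a > r" "absv a > 1" using ex_abs_gt .
  have "compact ((\<lambda>x. a * x) ` {x. absv x \<le> 1})"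
    by (intro compact_continuous_image compact_int continuous_on_mult_F continuous_on_const continuous_on_id)
  moreover have "closed {x. absv x \<le> r}"
    by (intro closed_Collect_le continuous_on_abs continuous_on_id continuous_on_const)
  moreover have "{x. absv x \<le> r} \<subseteq> (\<lambda>x. a * x) ` {x. absv x \<le> 1}"
  proof safe
    fix x assume "absv x \<le> r"
    then have "absv (x / a) \<le> 1" using a by (simp add: abs_divide divide_le_eq_1)
    then show "x \<in> (\<lambda>x. a * x) ` {x. absv x \<le> 1}" using a by (intro image_eqI[of _ _ "x / a"]) auto
  qed
  ultimately show ?thesis by (metis closed_Int_compact inf.absorb1)
qed

lemma separable_F: "separable_metric TYPE('a)"
proof -
  have "\<exists>k. finite k \<and> {x::'a. absv x \<le> real m} \<subseteq> (\<Union>x\<in>k. ball x (1 / real (Suc n)))" for m n :: nat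
  proof -
    have "0 < 1 / real (Suc n)" by simp
    then show ?thesis using compact_abs_le[of "real m"] unfolding compact_eq_totally_bounded by blast
  qed
  then obtain k where k: "\<And>m n. finite (k m n)"
    "\<And>m n. {x::'a. absv x \<le> real m} \<subseteq> (\<Union>x\<in>k m n. ball x (1 / real (Suc n)))" by metis
  show ?thesis unfolding separable_metric_def
  proof (intro exI[of _ "\<Union>m n. k m n"] conjI allI impI)
    show "countable (\<Union>m n. k m n)" by (simp add: countable_finite k)
    fix x :: 'a and e :: real assume "e > 0"
    then obtain n where n: "1 / real (Suc n) < e" using nat_approx_posE by metis
    obtain m where "absv x \<le> real m" using real_arch_simple by blast
    then obtain d where "d \<in> k m n" "dist d x < 1 / real (Suc n)" using k(2)[of m n] by auto
    then show "\<exists>d\<in>\<Union>m n. k m n. dist d x < e" using n by (meson UN_I UNIV_I less_trans)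
  qed
qed

lemma separable_V: "separable_metric TYPE('a^'n)"
  and separable_M: "separable_metric TYPE('a^'m^'n)"
  by (intro separable_metric_vec separable_F)+

lemma continuous_on_vec_iff:
  fixes f :: "'b::topological_space \<Rightarrow> 'c::topological_space^'n"
  shows "continuous_on S f \<longleftrightarrow> (\<forall>i. continuous_on S (\<lambda>x. f x $ i))"
  using continuous_on_vec_lambda[of S "\<lambda>i x. f x $ i"] by (auto intro: continuous_on_component)

lemma continuous_on_matrix_mult:
  fixes f g :: "'b::topological_space \<Rightarrow> 'a^'n^'n"
  assumes "continuous_on S f" "continuous_on S g"
  shows "continuous_on S (\<lambda>x. f x ** g x)"
  using assms unfolding continuous_on_vec_iff matrix_mult_entry
  by (auto intro!: continuous_on_sum_F continuous_on_mult_F)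

lemma continuous_on_det:
  fixes f :: "'b::topological_space \<Rightarrow> 'a^'n^'n"
  assumes "continuous_on S f"
  shows "continuous_on S (\<lambda>x. det (f x))"
  using assms unfolding continuous_on_vec_iff det_def
  by (auto intro!: continuous_on_sum_F continuous_on_mult_F continuous_on_prod_F)

lemma continuous_on_diff_V:
  fixes f g :: "'b::topological_space \<Rightarrow> 'a^'n"
  shows "continuous_on S f \<Longrightarrow> continuous_on S g \<Longrightarrow> continuous_on S (\<lambda>x. f x - g x)"
  unfolding continuous_on_vec_iff by (auto intro!: continuous_on_diff_F)

lemma continuous_on_diff_M:
  fixes f g :: "'b::topological_space \<Rightarrow> 'a^'n^'m"
  shows "continuous_on S f \<Longrightarrow> continuous_on S g \<Longrightarrow> continuous_on S (\<lambda>x. f x - g x)"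
  unfolding continuous_on_vec_iff[of _ f] continuous_on_vec_iff[of _ g]
    continuous_on_vec_iff[of _ "\<lambda>x. f x - g x"] by (auto intro!: continuous_on_diff_V)

text \<open>The metric on vector types combines the entries by a square root of squares and is not
  ultrametric. The maximum norms \<open>vabs\<close> and \<open>mabs\<close> are, and their boxes
  are compact, open for positive radius, and either nested or disjoint.\<close>

definition vabs :: "'a^'n \<Rightarrow> real" where
  "vabs x = Max (range (\<lambda>i. absv (x $ i)))"

definition mabs :: "'a^'m^'n \<Rightarrow> real" where
  "mabs z = Max (range (\<lambda>i. vabs (z $ i)))"

lemma vabs_le_iff: "vabs x \<le> r \<longleftrightarrow> (\<forall>i. absv (x $ i) \<le> r)"
  unfolding vabs_def by (subst Max_le_iff) auto

lemma mabs_le_iff: "mabs z \<le> r \<longleftrightarrow> (\<forall>i j. absv (z $ i $ j) \<le> r)"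
  unfolding mabs_def by (subst Max_le_iff) (auto simp: vabs_le_iff)

lemma abs_le_vabs: "absv (x $ i) \<le> vabs x"
  using vabs_le_iff by blast

lemma abs_le_mabs: "absv (x $ i $ j) \<le> mabs x"
  using mabs_le_iff by blast

lemma vabs_nonneg [simp]: "0 \<le> vabs x"
  using abs_le_vabs[of x undefined] abs_nonneg order_trans by blast

lemma mabs_nonneg [simp]: "0 \<le> mabs x"
  using abs_le_mabs[of x undefined undefined] abs_nonneg order_trans by blast

lemma mabs_0 [simp]: "mabs 0 = 0"
  by (simp add: mabs_def vabs_def)

lemma vabs_attained: "\<exists>i. vabs x = absv (x $ i)"
proof -
  have "Max (range (\<lambda>i. absv (x $ i))) \<in> range (\<lambda>i. absv (x $ i))" by (rule Max_in) auto
  then show ?thesis unfolding vabs_def by (rule rangeE) blast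
qed

lemma vabs_eq_0_iff [simp]: "vabs x = 0 \<longleftrightarrow> x = 0"
proof -
  have "vabs x = 0 \<longleftrightarrow> vabs x \<le> 0" using vabs_nonneg[of x] by linarith
  also have "\<dots> \<longleftrightarrow> (\<forall>i. absv (x $ i) = 0)"
    unfolding vabs_le_iff using abs_nonneg antisym by (metis order_refl)
  finally show ?thesis by (simp add: vec_eq_iff)
qed

lemma vabs_scale: "vabs (a *s x) = absv a * vabs x"
proof (rule antisym)
  show "vabs (a *s x) \<le> absv a * vabs x"
    by (auto simp: vabs_le_iff abs_mult abs_le_vabs intro!: mult_left_mono)
  obtain i where "vabs x = absv (x $ i)" using vabs_attained by blast
  then have "absv a * vabs x = absv ((a *s x) $ i)" by (simp add: abs_mult)
  then show "absv a * vabs x \<le> vabs (a *s x)" using abs_le_vabs by metis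
qed

lemma mabs_add_le: "mabs (x + y) \<le> r" if "mabs x \<le> r" "mabs y \<le> r"
  using that abs_add_le order_trans unfolding mabs_le_iff vector_add_component
  by (metis max.bounded_iff)

lemma mabs_minus [simp]: "mabs (- x) = mabs x"
  by (simp add: mabs_def vabs_def)

lemma mabs_diff_le: "mabs (x - y) \<le> r" if "mabs x \<le> r" "mabs y \<le> r"
  using mabs_add_le[of x r "-y"] that by simp

lemma vabs_add_le: "vabs (x + y) \<le> r" if "vabs x \<le> r" "vabs y \<le> r"
  using that abs_add_le order_trans unfolding vabs_le_iff vector_add_component
  by (metis max.bounded_iff)

lemma vabs_minus [simp]: "vabs (- x) = vabs x"
  by (simp add: vabs_def)

lemma vabs_diff_le: "vabs (x - y) \<le> r" if "vabs x \<le> r" "vabs y \<le> r"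
  using vabs_add_le[of x r "-y"] that by simp

lemma mabs_mult_le: "mabs (A ** B :: 'a^'n^'n) \<le> mabs A * mabs B"
  unfolding mabs_le_iff matrix_mult_entry
  by (auto intro!: abs_sum_le mult_mono simp: abs_mult abs_le_mabs)

lemma vabs_vm_le: "vabs (y v* z) \<le> vabs y * mabs z"
  unfolding vabs_le_iff vector_matrix_mult_def
  by (auto intro!: abs_sum_le mult_mono simp: abs_mult abs_le_mabs abs_le_vabs)

lemma abs_rowcol_le: "absv (rowcol y x) \<le> vabs y * vabs x"
  unfolding rowcol_def
  by (auto intro!: abs_sum_le mult_mono simp: abs_mult abs_le_vabs)

lemma open_abs_ball: "r > 0 \<Longrightarrow> open {x. absv (x - c) \<le> r}"
proof (rule openI)
  fix x assume r: "r > 0" and x: "x \<in> {x. absv (x - c) \<le> r}"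
  have "ball x r \<subseteq> {x. absv (x - c) \<le> r}"
  proof
    fix y assume "y \<in> ball x r"
    then have "absv (y - x) < r" by (simp add: dist_eq_abs abs_diff_commute)
    then show "y \<in> {x. absv (x - c) \<le> r}"
      using x abs_add_le[of "y - x" "x - c"] by auto
  qed
  then show "\<exists>e>0. ball x e \<subseteq> {x. absv (x - c) \<le> r}" using r by blast
qed

lemma closed_abs_ball: "closed {x. absv (x - c) \<le> r}"
  by (intro closed_Collect_le continuous_on_abs continuous_on_diff_F continuous_on_id continuous_on_const)

lemma open_vbox: "r > 0 \<Longrightarrow> open {x. vabs (x - c) \<le> r}"
  using open_vector_box[of "\<lambda>i. {y. absv (y - c $ i) \<le> r}"] open_abs_ball by (auto simp: vabs_le_iff)

lemma closed_vbox: "closed {x. vabs (x - c) \<le> r}"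
  using closed_vector_box[of "\<lambda>i. {y. absv (y - c $ i) \<le> r}"] closed_abs_ball by (auto simp: vabs_le_iff)

lemma mbox_eq: "{x. mabs (x - c) \<le> r} = {x. \<forall>i. x $ i \<in> {y. vabs (y - c $ i) \<le> r}}"
  by (auto simp: vabs_le_iff mabs_le_iff)

lemma open_mbox: "r > 0 \<Longrightarrow> open {x. mabs (x - c) \<le> r}"
  unfolding mbox_eq by (intro open_vector_box open_vbox allI)

lemma closed_mbox: "closed {x. mabs (x - c) \<le> r}"
  unfolding mbox_eq by (intro closed_vector_box closed_vbox allI)

lemma compact_vbox: "compact {x::'a^'n. vabs x \<le> r}"
  using compact_vec_box[OF compact_abs_le[of r]] by (simp add: vabs_le_iff)

lemma compact_mbox_0: "compact {x::'a^'n^'m. mabs x \<le> r}"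
  using compact_vec_box[OF compact_vbox[of r]] by (simp add: mabs_le_iff vabs_le_iff)

lemma compact_mbox: "compact {x::'a^'n^'m. mabs (x - c) \<le> r}"
proof -
  have "{x. mabs (x - c) \<le> r} \<subseteq> {x. mabs x \<le> max r (mabs c)}"
  proof safe
    fix x assume "mabs (x - c) \<le> r"
    then show "mabs x \<le> max r (mabs c)"
      using mabs_add_le[of "x - c" "max r (mabs c)" c] by auto
  qed
  then show ?thesis
    using closed_Int_compact[OF closed_mbox compact_mbox_0] by (metis inf.absorb1)
qed

lemma mbox_subset_open:
  fixes c :: "'a^'n^'m"
  assumes "open S" "c \<in> S"
  obtains r where "r > 0" "{x. mabs (x - c) \<le> r} \<subseteq> S"
proof -
  obtain e where e: "e > 0" "ball c e \<subseteq> S" using assms by (meson open_contains_ball)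
  \<comment> \<open>The distance is at most the sum of the entry distances, of which there are
    \<open>CARD('m) * CARD('n)\<close>; the factor 2 makes the final inequality strict.\<close>
  define r where "r = e / (2 * (CARD('m) * CARD('n)))"
  have "{x. mabs (x - c) \<le> r} \<subseteq> S"
  proof safe
    fix x assume x: "mabs (x - c) \<le> r"
    have "dist x c \<le> (\<Sum>i\<in>UNIV. dist (x $ i) (c $ i))"
      unfolding dist_vec_def[of x] by (rule order_trans[OF L2_set_le_sum]) auto
    also have "\<dots> \<le> (\<Sum>i\<in>(UNIV::'m set). \<Sum>j\<in>(UNIV::'n set). r)"
    proof (rule sum_mono)
      fix i
      have "dist (x $ i) (c $ i) \<le> (\<Sum>j\<in>UNIV. dist (x $ i $ j) (c $ i $ j))"
        unfolding dist_vec_def by (rule order_trans[OF L2_set_le_sum]) auto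
      also have "\<dots> \<le> (\<Sum>j\<in>(UNIV::'n set). r)"
        using x by (intro sum_mono) (auto simp: dist_eq_abs mabs_le_iff)
      finally show "dist (x $ i) (c $ i) \<le> (\<Sum>j\<in>(UNIV::'n set). r)" .
    qed
    also have "\<dots> < e" using e by (simp add: r_def)
    finally show "x \<in> S" using e by (auto simp: dist_commute)
  qed
  moreover have "r > 0" using e by (simp add: r_def)
  ultimately show ?thesis using that by blast
qed

lemma compact_imp_mabs_bounded:
  fixes K :: "('a^'n^'m) set"
  assumes "compact K" obtains R where "R > 0" "\<And>x. x \<in> K \<Longrightarrow> mabs x \<le> R"
proof -
  obtain R where R: "\<And>x. x \<in> K \<Longrightarrow> dist 0 x \<le> R"
    using compact_imp_bounded[OF assms] bounded_any_center by metis
  have "mabs x \<le> max R 1" if "x \<in> K" for x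
    unfolding mabs_le_iff
  proof safe
    fix i j
    have "absv (x $ i $ j) = dist ((0::'a^'n^'m) $ i $ j) (x $ i $ j)" by (simp add: dist_eq_abs)
    also have "\<dots> \<le> dist ((0::'a^'n^'m) $ i) (x $ i)" by (rule dist_vec_nth_le)
    also have "\<dots> \<le> dist 0 x" by (rule dist_vec_nth_le)
    finally show "absv (x $ i $ j) \<le> max R 1" using R[OF that] by simp
  qed
  then show ?thesis using that[of "max R 1"] by auto
qed

text \<open>Every point of an ultrametric ball is a centre of it.\<close>

lemma mbox_eq_of_mem:
  assumes "mabs (c - d) \<le> r"
  shows "{x. mabs (x - c) \<le> r} = {x. mabs (x - d) \<le> r}"
proof -
  have "mabs (x - d) \<le> r" if "mabs (x - c) \<le> r" for x
    using mabs_add_le[of "x - c" r "c - d"] that assms by simp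
  moreover have "mabs (x - c) \<le> r" if "mabs (x - d) \<le> r" for x
    using mabs_diff_le[of "x - d" r "c - d"] that assms by simp
  ultimately show ?thesis by blast
qed

text \<open>Ultrametric balls are nested or disjoint, so together with the empty set they form an
  intersection-stable generator of the Borel sets.\<close>

lemma mbox_Int:
  assumes "r \<le> s"
  shows "{x. mabs (x - c) \<le> r} \<inter> {x. mabs (x - d) \<le> s} \<in> {{}, {x. mabs (x - c) \<le> r}}"
proof (cases "mabs (c - d) \<le> s")
  case True
  have "{x. mabs (x - c) \<le> r} \<subseteq> {x. mabs (x - d) \<le> s}"
  proof
    fix x assume "x \<in> {x. mabs (x - c) \<le> r}"
    then have "mabs (x - c + (c - d)) \<le> s" using True assms by (intro mabs_add_le) auto
    then show "x \<in> {x. mabs (x - d) \<le> s}" by simp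
  qed
  then show ?thesis by auto
next
  case False
  have "\<not> (mabs (x - c) \<le> r \<and> mabs (x - d) \<le> s)" for x
    using mabs_diff_le[of "x - d" s "x - c"] False assms by fastforce
  then have "{x. mabs (x - c) \<le> r} \<inter> {x. mabs (x - d) \<le> s} = {}" by blast
  then show ?thesis by blast
qed

text \<open>Finitely many boxes on which \<open>\<psi>\<close> is constant cover its support. A
  shift no longer than the smallest of their radii cannot leave a box, because the norm is
  ultrametric.\<close>

lemma schwartz_uniform:
  fixes \<psi> :: "'a^'n^'m \<Rightarrow> complex"
  assumes "schwartz \<psi>"
  obtains r where "r > 0" "\<And>x t. mabs t \<le> r \<Longrightarrow> \<psi> (x + t) = \<psi> x"
proof -
  obtain K where K: "compact K" "\<And>x. x \<notin> K \<Longrightarrow> \<psi> x = 0"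
    using assms unfolding schwartz_def by auto
  have "\<exists>r>0. \<forall>y. mabs (y - x) \<le> r \<longrightarrow> \<psi> y = \<psi> x" for x
  proof -
    obtain U where U: "open U" "x \<in> U" "\<forall>y\<in>U. \<psi> y = \<psi> x"
      using assms unfolding schwartz_def by meson
    obtain r where "r > 0" "{y. mabs (y - x) \<le> r} \<subseteq> U" using mbox_subset_open[OF U(1,2)] .
    then show ?thesis using U by blast
  qed
  then obtain r where r: "\<And>x. r x > 0" "\<And>x y. mabs (y - x) \<le> r x \<Longrightarrow> \<psi> y = \<psi> x" by metis
  have self: "mabs (x - x) \<le> r x" for x using r(1)[of x] by (simp add: mabs_le_iff)
  have cov: "K \<subseteq> (\<Union>x\<in>K. {y. mabs (y - x) \<le> r x})" using self by blast
  obtain F where "F \<subseteq> K" and F: "finite F" "K \<subseteq> (\<Union>x\<in>F. {y. mabs (y - x) \<le> r x})"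
    by (rule compactE_image[OF K(1) open_mbox[OF r(1)] cov])
  define s where "s = Min (insert 1 (r ` F))"
  have s: "s > 0" "\<And>x. x \<in> F \<Longrightarrow> s \<le> r x"
    using F r by (auto simp: s_def)
  have *: "\<psi> (x + t) = \<psi> x" if t: "mabs t \<le> s" and xK: "x \<in> K" for x t
  proof -
    obtain y where y: "y \<in> F" "mabs (x - y) \<le> r y" using F(2) xK by blast
    then have "mabs (x + t - y) \<le> r y"
      using mabs_add_le[of "x - y" "r y" t] s(2)[OF y(1)] t by (simp add: algebra_simps)
    then show ?thesis using r(2)[of "x + t" y] r(2)[OF y(2)] by simp
  qed
  \<comment> \<open>Outside \<open>K\<close> the value is 0; if the shifted point lies in
    \<open>K\<close>, the claim is applied there with the shift \<open>- t\<close>.\<close>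
  have "\<psi> (x + t) = \<psi> x" if t: "mabs t \<le> s" for x t
  proof (cases "x \<in> K")
    case False
    show ?thesis
    proof (cases "x + t \<in> K")
      case True
      then show ?thesis using *[of "-t" "x + t"] t by simp
    next
      case False': False
      then show ?thesis using K False by simp
    qed
  qed (use * t in blast)
  then show ?thesis using that s by blast
qed

lemma schwartzI:
  fixes \<psi> :: "'a^'n^'m \<Rightarrow> complex"
  assumes "r > 0" "\<And>x t. mabs t \<le> r \<Longrightarrow> \<psi> (x + t) = \<psi> x" "\<And>x. \<psi> x \<noteq> 0 \<Longrightarrow> mabs x \<le> R"
  shows "schwartz \<psi>"
  unfolding schwartz_def
proof safe
  fix x
  have "\<psi> y = \<psi> x" if "mabs (y - x) \<le> r" for y
    using assms(2)[OF that, of x] by simp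
  moreover have "x \<in> {y. mabs (y - x) \<le> r}" using assms(1) by simp
  ultimately show "\<exists>U. open U \<and> x \<in> U \<and> (\<forall>y\<in>U. \<psi> y = \<psi> x)"
    using open_mbox[OF assms(1), of x] by blast
next
  show "\<exists>K. compact K \<and> (\<forall>x. x \<notin> K \<longrightarrow> \<psi> x = 0)"
    using compact_mbox_0[of R] assms(3) by blast
qed

lemma schwartz_continuous:
  fixes \<psi> :: "'b::topological_space \<Rightarrow> complex"
  assumes "schwartz \<psi>" shows "continuous_on S \<psi>"
proof (rule continuous_on_subset[of UNIV])
  show "continuous_on UNIV \<psi>"
  proof (subst continuous_on_open_vimage[OF open_UNIV], safe)
    fix B :: "complex set" assume "open B"
    show "open (\<psi> -` B \<inter> UNIV)"
    proof (rule Topological_Spaces.openI)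
      fix x assume x: "x \<in> \<psi> -` B \<inter> UNIV"
      obtain U where U: "open U" "x \<in> U" "\<forall>y\<in>U. \<psi> y = \<psi> x"
        using assms unfolding schwartz_def by meson
      have "U \<subseteq> \<psi> -` B \<inter> UNIV"
      proof
        fix y assume "y \<in> U"
        then have "\<psi> y = \<psi> x" using U(3) by blast
        then show "y \<in> \<psi> -` B \<inter> UNIV" using x by simp
      qed
      then show "\<exists>T. open T \<and> x \<in> T \<and> T \<subseteq> \<psi> -` B \<inter> UNIV" using U(1,2) by blast
    qed
  qed
qed auto

lemma schwartz_bounds:
  fixes \<psi> :: "'a^'n^'m \<Rightarrow> complex"
  assumes "schwartz \<psi>"
  obtains B R where "B > 0" "R > 0" "\<And>x. cmod (\<psi> x) \<le> B" "\<And>x. \<psi> x \<noteq> 0 \<Longrightarrow> mabs x \<le> R"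
proof -
  obtain K where K: "compact K" "\<And>x. x \<notin> K \<Longrightarrow> \<psi> x = 0"
    using assms unfolding schwartz_def by auto
  have "bounded (\<psi> ` K)"
    using compact_imp_bounded compact_continuous_image K(1) schwartz_continuous[OF assms] by blast
  then obtain B where B: "\<And>x. x \<in> K \<Longrightarrow> cmod (\<psi> x) \<le> B" by (auto simp: bounded_iff)
  obtain R where R: "R > 0" "\<And>x. x \<in> K \<Longrightarrow> mabs x \<le> R"
    using compact_imp_mabs_bounded[OF K(1)] by blast
  have "cmod (\<psi> x) \<le> max B 1" for x
  proof (cases "x \<in> K")
    case True
    then show ?thesis using B[of x] by simp
  qed (simp add: K le_max_iff_disj)
  moreover have "mabs x \<le> R" if "\<psi> x \<noteq> 0" for x using that K(2) R(2) by blast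
  ultimately show ?thesis using that[of "max B 1" R] R(1) by simp
qed

end

section \<open>Haar measures and moduli of linear maps\<close>

text \<open>One setting for the field, the vectors, the matrices and the symplectic space. The
  compact open set \<open>U\<close> fixes the scale, and its translates provide both countable
  covers and finite covers of compact sets.\<close>

locale haar_space =
  fixes \<mu> :: "'b::{metric_space,ab_group_add} measure" and U :: "'b set"
  assumes separable: "separable_metric TYPE('b)"
    and continuous_diff: "continuous_on UNIV (\<lambda>p::'b \<times> 'b. fst p - snd p)"
    and open_U: "open U" and compact_U: "compact U" and zero_U: "0 \<in> U"
    and haar: "haar_normalized \<mu> U"
begin

lemma sets_haar [simp, measurable_cong]: "sets \<mu> = sets borel"
  and emeasure_translate: "A \<in> sets borel \<Longrightarrow> emeasure \<mu> ((\<lambda>x. x + c) ` A) = emeasure \<mu> A"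
  and emeasure_U [simp]: "emeasure \<mu> U = 1"
  using haar unfolding haar_normalized_def by auto

lemma space_haar [simp]: "space \<mu> = UNIV"
  using sets_eq_imp_space_eq[OF sets_haar] by simp

lemma continuous_on_diff_b:
  fixes f g :: "'c::topological_space \<Rightarrow> 'b"
  assumes "continuous_on S f" "continuous_on S g"
  shows "continuous_on S (\<lambda>x. f x - g x)"
  using continuous_on_compose2[OF continuous_diff continuous_on_Pair[OF assms]] by simp

lemma continuous_on_add_b:
  fixes f g :: "'c::topological_space \<Rightarrow> 'b"
  assumes "continuous_on S f" "continuous_on S g"
  shows "continuous_on S (\<lambda>x. f x + g x)"
  using continuous_on_diff_b[OF assms(1) continuous_on_diff_b[OF continuous_on_const[of _ 0] assms(2)]]
  by simp

lemma vimage_translate: "(\<lambda>x. c + x) -` A = (\<lambda>x. x + (- c)) ` A"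
  for c :: 'b
proof safe
  fix x assume "c + x \<in> A"
  then show "x \<in> (\<lambda>x. x + (- c)) ` A" by (intro image_eqI[of _ _ "c + x"]) auto
qed auto

lemma emeasure_vimage_translate: "A \<in> sets borel \<Longrightarrow> emeasure \<mu> ((\<lambda>x. c + x) -` A) = emeasure \<mu> A"
  unfolding vimage_translate by (rule emeasure_translate)

lemma countable_translates:
  assumes "open V" "0 \<in> V"
  obtains D :: "'b set" where "countable D" "(\<Union>d\<in>D. (\<lambda>x. x + d) ` V) = UNIV"
proof -
  obtain D :: "'b set" where D: "countable D" "\<And>x e. e > 0 \<Longrightarrow> \<exists>d\<in>D. dist d x < e"
    using separable unfolding separable_metric_def by blast
  have "x \<in> (\<Union>d\<in>D. (\<lambda>x. x + d) ` V)" for x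
  proof -
    have "open ((\<lambda>d. x - d) -` V)"
      by (rule open_vimage[OF assms(1)]) (intro continuous_on_diff_b continuous_on_const continuous_on_id)
    moreover have "x \<in> (\<lambda>d. x - d) -` V" using assms by simp
    ultimately obtain e where e: "e > 0" "ball x e \<subseteq> (\<lambda>d. x - d) -` V" by (meson open_contains_ball)
    obtain d where d: "d \<in> D" "dist d x < e" using D(2)[OF e(1)] by blast
    then have "d \<in> ball x e" by (simp add: dist_commute)
    then have "x - d \<in> V" using e by blast
    then show ?thesis using d(1) by (intro UN_I[of d] image_eqI[of _ _ "x - d"]) auto
  qed
  then show ?thesis using that[OF D(1)] by blast
qed

lemma open_translate: "open V \<Longrightarrow> open ((\<lambda>x. x + d) ` V)" for d :: 'b
proof -
  assume "open V"
  then have "open ((\<lambda>x. - d + x) -` V)"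
    by (rule open_vimage) (intro continuous_on_add_b continuous_on_const continuous_on_id)
  then show ?thesis unfolding vimage_translate by simp
qed

text \<open>Countably many translates of \<open>V\<close> cover the space, so a null
  \<open>V\<close> would make the whole space null.\<close>

lemma emeasure_open_pos:
  assumes "open V" "0 \<in> V" shows "emeasure \<mu> V \<noteq> 0"
proof
  assume 0: "emeasure \<mu> V = 0"
  obtain D :: "'b set" where D: "countable D" "(\<Union>d\<in>D. (\<lambda>x. x + d) ` V) = UNIV"
    using countable_translates[OF assms] .
  have "(\<Union>d\<in>D. (\<lambda>x. x + d) ` V) \<in> null_sets \<mu>"
    using D(1) 0 assms by (intro null_sets_UN') (auto simp: emeasure_translate null_sets_def intro!: borel_open open_translate)
  then have "emeasure \<mu> UNIV = 0" using D by (simp add: null_sets_def)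
  moreover have "emeasure \<mu> U \<le> emeasure \<mu> UNIV" by (rule emeasure_mono) auto
  ultimately show False by simp
qed

lemma emeasure_compact_finite:
  assumes "compact K" shows "emeasure \<mu> K < \<infinity>"
proof -
  have "K \<subseteq> (\<Union>d\<in>UNIV. (\<lambda>x. x + d) ` U)"
    using zero_U by force
  then obtain D where D: "finite D" "K \<subseteq> (\<Union>d\<in>D. (\<lambda>x. x + d) ` U)"
    using compactE_image[OF assms, of UNIV "\<lambda>d. (\<lambda>x. x + d) ` U"] open_translate[OF open_U] by metis
  have "emeasure \<mu> K \<le> emeasure \<mu> (\<Union>d\<in>D. (\<lambda>x. x + d) ` U)"
    by (rule emeasure_mono) (use D in \<open>auto intro!: borel_open open_translate[OF open_U]\<close>)
  also have "\<dots> \<le> (\<Sum>d\<in>D. emeasure \<mu> ((\<lambda>x. x + d) ` U))"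
    by (rule emeasure_subadditive_finite) (use D in \<open>auto intro!: borel_open open_translate[OF open_U]\<close>)
  also have "\<dots> = of_nat (card D)"
    by (simp add: emeasure_translate borel_open[OF open_U])
  also have "\<dots> < \<infinity>" by (simp add: of_nat_less_top)
  finally show ?thesis .
qed

lemma sigma_finite_translation_invariant:
  assumes sets: "sets \<nu> = sets borel" and fin: "emeasure \<nu> U < \<infinity>"
    and inv: "\<And>c A. A \<in> sets borel \<Longrightarrow> emeasure \<nu> ((\<lambda>x. x + c) ` A) = emeasure \<nu> A"
  shows "sigma_finite_measure \<nu>"
proof
  obtain D :: "'b set" where D: "countable D" "(\<Union>d\<in>D. (\<lambda>x. x + d) ` U) = UNIV"
    using countable_translates[OF open_U zero_U] .
  have "space \<nu> = UNIV" using sets_eq_imp_space_eq[OF sets] by simp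
  then show "\<exists>A. countable A \<and> A \<subseteq> sets \<nu> \<and> \<Union> A = space \<nu> \<and> (\<forall>a\<in>A. emeasure \<nu> a \<noteq> \<infinity>)"
    using D fin open_U sets
    by (intro exI[of _ "(\<lambda>d. (\<lambda>x. x + d) ` U) ` D"])
       (auto simp: inv intro!: borel_open open_translate less_imp_neq)
qed

sublocale sigma_finite_measure \<mu>
  by (rule sigma_finite_translation_invariant) (auto simp: emeasure_translate)

text \<open>The group acts on itself by translation with factor 1. The sets compared in the
  condition \<open>null\<close> are translates of each other, so they have equal measure.\<close>

lemma haar_unique:
  assumes sets: "sets \<nu> = sets borel" and fin: "emeasure \<nu> U < \<infinity>" and nz: "emeasure \<nu> U \<noteq> 0"
    and inv: "\<And>c A. A \<in> sets borel \<Longrightarrow> emeasure \<nu> ((\<lambda>x. x + c) ` A) = emeasure \<nu> A"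
  shows "\<nu> = scale_measure (emeasure \<nu> U) \<mu>"
proof -
  have space: "space \<nu> = UNIV" using sets_eq_imp_space_eq[OF sets] by simp
  have vinv: "emeasure \<nu> ((\<lambda>x. c + x) -` A) = emeasure \<nu> A" if "A \<in> sets borel" for c A
    unfolding vimage_translate by (rule inv[OF that])
  have big: "emeasure m UNIV \<noteq> 0" if "sets m = sets borel" "emeasure m U \<noteq> 0" for m :: "'b measure"
    using that emeasure_mono[of U UNIV m] open_U by (auto simp: sets_eq_imp_space_eq[OF that(1)])
  interpret relatively_invariant \<mu> \<mu> \<nu> "(+)" "\<lambda>_. 1" UNIV
  proof
    have "(\<lambda>(x, y). x + y :: 'b) \<in> borel_measurable borel"
      unfolding case_prod_beta'
      by (intro borel_measurable_continuous_onI continuous_on_add_b continuous_on_fst continuous_on_snd continuous_on_id)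
    then show "(\<lambda>(g, p). g + p) \<in> \<mu> \<Otimes>\<^sub>M \<mu> \<rightarrow>\<^sub>M \<mu>"
      using borel_prod_separable[OF separable separable]
      by (simp cong: measurable_cong_sets sets_pair_measure_cong)
    show "\<exists>A. countable A \<and> A \<subseteq> sets \<nu> \<and> \<Union> A = space \<nu> \<and> (\<forall>a\<in>A. emeasure \<nu> a \<noteq> \<infinity>)"
      using sigma_finite_translation_invariant[OF sets fin inv] sigma_finite_measure.sigma_finite_countable by blast
    show "\<exists>g'\<in>space \<mu>. \<forall>p\<in>space \<mu>. g' + (g + p) = p" for g by (intro bexI[of _ "-g"]) auto
    show "emeasure \<mu> {g \<in> space \<mu>. g + p' \<in> A} = 0"
      if A: "A \<in> sets \<mu>" and 0: "emeasure \<mu> {g \<in> space \<mu>. g + p \<in> A} = 0" for p p' A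
    proof -
      have eq: "{g \<in> space \<mu>. g + q \<in> A} = (\<lambda>x. q + x) -` A" for q by (auto simp: add.commute)
      show ?thesis using A 0 unfolding eq by (simp add: emeasure_vimage_translate)
    qed
    show "emeasure \<mu> (space \<mu>) \<noteq> 0" using big[of \<mu>] by simp
    show "emeasure \<nu> (space \<nu>) \<noteq> 0" using big[OF sets nz] space by simp
  qed (use sets vinv emeasure_vimage_translate in auto)
  obtain c :: real where c: "c > 0" "\<nu> = scale_measure (ennreal c) \<mu>" using proportional by blast
  then have "emeasure \<nu> U = ennreal c" by simp
  then show ?thesis using c(2) by simp
qed

text \<open>The image of \<open>\<mu>\<close> under \<open>f\<close> is again translation invariant,
  since a translation by \<open>c\<close> after \<open>f\<close> is a translation by
  \<open>g c\<close> before it. Hence it is a multiple of \<open>\<mu>\<close>, and the factor is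
  the modulus.\<close>

lemma haar_additive_map:
  assumes add: "\<And>x y. f (x + y) = f x + f y" and inv: "\<And>x. g (f x) = x" "\<And>x. f (g x) = x"
    and cont: "continuous_on UNIV f" "continuous_on UNIV g"
  shows "\<exists>c::real. c > 0 \<and> (\<forall>A\<in>sets borel. emeasure \<mu> (f -` A) = ennreal c * emeasure \<mu> A)"
proof -
  have f[measurable]: "f \<in> borel_measurable borel" using cont(1) by (rule borel_measurable_continuous_onI)
  define \<nu> where "\<nu> = distr \<mu> borel f"
  have e: "emeasure \<nu> A = emeasure \<mu> (f -` A)" if "A \<in> sets borel" for A
    using that by (simp add: \<nu>_def emeasure_distr)
  have fU: "f -` U = g ` U"
    using inv by (auto simp: image_iff) metis
  have f0: "f 0 = 0" using add[of 0 0] by simp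
  have "compact (f -` U)" unfolding fU
    using compact_U cont(2) by (intro compact_continuous_image) (auto intro: continuous_on_subset)
  then have fin: "emeasure \<nu> U < \<infinity>" using emeasure_compact_finite e[OF borel_open[OF open_U]] by simp
  have "open (f -` U)" using open_U cont(1) by (rule open_vimage)
  then have nz: "emeasure \<nu> U \<noteq> 0"
    using emeasure_open_pos[of "f -` U"] zero_U f0 e[OF borel_open[OF open_U]] by simp
  have "\<nu> = scale_measure (emeasure \<nu> U) \<mu>"
  proof (rule haar_unique[OF _ fin nz])
    show "sets \<nu> = sets borel" by (simp add: \<nu>_def)
    fix c and A :: "'b set" assume A: "A \<in> sets borel"
    have "f -` ((\<lambda>x. x + c) ` A) = (\<lambda>x. x + g c) ` (f -` A)"
    proof (intro equalityI subsetI)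
      fix x assume "x \<in> f -` ((\<lambda>x. x + c) ` A)"
      then obtain a where a: "f x = a + c" "a \<in> A" by auto
      have "f (x + - g c) = a"
      proof -
        have "f (x + - g c) + c = f (x + - g c + g c)" unfolding add inv ..
        also have "\<dots> = a + c" using a by simp
        finally show ?thesis by simp
      qed
      then show "x \<in> (\<lambda>x. x + g c) ` (f -` A)" using a by (intro image_eqI[of _ _ "x + - g c"]) auto
    next
      fix x assume "x \<in> (\<lambda>x. x + g c) ` (f -` A)"
      then obtain x' where "f x' \<in> A" "x = x' + g c" by auto
      then show "x \<in> f -` ((\<lambda>x. x + c) ` A)" by (simp add: add inv)
    qed
    moreover have "(\<lambda>x. x + c) ` A \<in> sets borel"
    proof -
      have m: "(\<lambda>x. - c + x) \<in> borel_measurable borel"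
        by (intro borel_measurable_continuous_onI continuous_on_add_b continuous_on_const continuous_on_id)
      show ?thesis using measurable_sets[OF m A] vimage_translate[of "- c" A] by simp
    qed
    moreover have "f -` A \<in> sets borel" using measurable_sets[OF f A] by simp
    ultimately show "emeasure \<nu> ((\<lambda>x. x + c) ` A) = emeasure \<nu> A"
      using e A by (simp add: emeasure_translate)
  qed
  then have *: "emeasure \<nu> A = emeasure \<nu> U * emeasure \<mu> A" for A
    by (metis emeasure_scale_measure)
  obtain c where c: "emeasure \<nu> U = ennreal c" "c > 0"
    using fin nz by (cases "emeasure \<nu> U") (auto simp: less_le)
  have "emeasure \<mu> (f -` A) = ennreal c * emeasure \<mu> A" if "A \<in> sets borel" for A
    using e[OF that] *[of A] unfolding c(1) by simp
  then show ?thesis using c(2) by blast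
qed

end

locale local_field_haar = local_field absv
  for absv :: "'a::{field,metric_space} \<Rightarrow> real" +
  fixes \<mu>F :: "'a measure"
  assumes haar_F: "haar_F absv \<mu>F"
begin

sublocale F: haar_space \<mu>F "{x. absv x \<le> 1}"
proof
  show "continuous_on UNIV (\<lambda>p::'a \<times> 'a. fst p - snd p)"
    by (intro continuous_on_diff_F continuous_on_fst continuous_on_snd continuous_on_id)
  show "open {x. absv x \<le> 1}" using open_abs_ball[of 1 0] by simp
  show "haar_normalized \<mu>F {x. absv x \<le> 1}"
    using haar_F unfolding haar_F_def intring_def by simp
qed (auto simp: compact_abs_le separable_F)

lemma emeasure_F_scale:
  "a \<noteq> 0 \<Longrightarrow> A \<in> sets borel \<Longrightarrow> emeasure \<mu>F ((\<lambda>x. a * x) ` A) = ennreal (absv a) * emeasure \<mu>F A"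
  using haar_F unfolding haar_F_def by auto

lemma emeasure_F_ball:
  assumes "a \<noteq> 0" shows "emeasure \<mu>F {x. absv x \<le> absv a} = ennreal (absv a)"
proof -
  have "{x. absv x \<le> absv a} = (\<lambda>x. a * x) ` {x. absv x \<le> 1}"
  proof (intro equalityI subsetI)
    fix x assume "x \<in> {x. absv x \<le> absv a}"
    then have "absv (x / a) \<le> 1" using assms by (simp add: abs_divide)
    then show "x \<in> (\<lambda>x. a * x) ` {x. absv x \<le> 1}" using assms by (intro image_eqI[of _ _ "x / a"]) auto
  qed (use assms in \<open>auto simp: abs_mult mult_le_cancel_left1\<close>)
  then show ?thesis
    using emeasure_F_scale[OF assms, of "{x. absv x \<le> 1}"] F.emeasure_U F.open_U by simp
qed

text \<open>The map multiplies one coordinate by \<open>a\<close>: \<open>pr\<close> reads this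
  coordinate and \<open>emb\<close> is the corresponding axis. Its modulus is found on
  \<open>U\<close>, whose preimage is a slab where this coordinate has absolute value at most
  \<open>1 / absv a\<close>. Stated abstractly, the result covers entries of columns and of
  matrices.\<close>

lemma coordinate_scaling:
  fixes \<mu> :: "'b::{metric_space,ab_group_add} measure"
  assumes H: "haar_space \<mu> U"
    and pr: "\<And>u v. pr (u + v) = pr u + pr v" "continuous_on UNIV pr"
    and emb: "\<And>a b. emb (a + b) = emb a + emb b" "continuous_on UNIV emb"
    and pe: "\<And>a. pr (emb a) = (a::'a)"
    and box: "\<And>v. v \<in> U \<longleftrightarrow> absv (pr v) \<le> 1 \<and> v - emb (pr v) \<in> U"
    and a: "a \<noteq> 0" and A: "A \<in> sets borel"
  shows "emeasure \<mu> ((\<lambda>v. v + emb ((a - 1) * pr v)) -` A) = ennreal (1 / absv a) * emeasure \<mu> A"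
proof -
  interpret haar_space \<mu> U by (rule H)
  let ?f = "\<lambda>c v. v + emb ((c - 1) * pr v)"
  have emb0: "emb 0 = 0" using emb(1)[of 0 0] by simp
  have emb_neg: "emb (- c) = - emb c" for c
    using emb(1)[of c "-c"] emb0 by (simp add: eq_neg_iff_add_eq_0 add.commute)
  have emb_diff: "emb (c - d) = emb c - emb d" for c d
    using emb(1)[of c "-d"] emb_neg by simp
  have pr_f: "pr (?f c v) = c * pr v" for c v
    by (simp add: pr pe algebra_simps)
  have ff: "?f c (?f d v) = ?f (c * d) v" for c d v
    unfolding pr_f by (simp add: add.assoc emb(1)[symmetric] algebra_simps)
  have cont: "continuous_on UNIV (?f c)" for c
    by (intro continuous_on_add_b continuous_on_id continuous_on_compose2[OF emb(2)] continuous_on_mult_F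
        continuous_on_const pr) auto
  have "\<exists>c::real. c > 0 \<and> (\<forall>A\<in>sets borel. emeasure \<mu> (?f a -` A) = ennreal c * emeasure \<mu> A)"
  proof (rule haar_additive_map[where g = "?f (inverse a)"])
    show "?f a (x + y) = ?f a x + ?f a y" for x y
      by (simp add: pr emb distrib_left ac_simps)
    show "?f (inverse a) (?f a x) = x" "?f a (?f (inverse a) x) = x" for x
      unfolding ff using a by (simp_all add: emb0)
  qed (use cont in auto)
  then obtain c :: real where c: "c > 0" "\<And>A. A \<in> sets borel \<Longrightarrow> emeasure \<mu> (?f a -` A) = ennreal c * emeasure \<mu> A"
    by blast
  define S where "S = {v. v - emb (pr v) \<in> U}"
  have contS: "continuous_on UNIV (\<lambda>v. v - emb (pr v))"
    by (intro continuous_on_diff_b continuous_on_id continuous_on_compose2[OF emb(2)] pr) auto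
  have S[measurable]: "S \<in> sets borel"
    using open_vimage[OF open_U contS] by (simp add: S_def vimage_def)
  have pr_m[measurable]: "pr \<in> borel_measurable borel" using pr(2) by (rule borel_measurable_continuous_onI)
  \<comment> \<open>The slice \<open>S\<close> constrains all other coordinates to the unit box.
    Seen through \<open>pr\<close>, it carries a translation invariant measure of mass 1 on the ring
    of integers, hence \<open>\<mu>F\<close>, for which scaling is known.\<close>
  define \<rho> where "\<rho> = distr (density \<mu> (indicator S)) borel pr"
  have \<rho>: "emeasure \<rho> B = emeasure \<mu> (S \<inter> pr -` B)" if B[measurable]: "B \<in> sets borel" for B
  proof -
    have pB: "pr -` B \<in> sets borel" using measurable_sets[OF pr_m B] by simp
    have "emeasure \<rho> B = (\<integral>\<^sup>+ v. indicator S v * indicator (pr -` B) v \<partial>\<mu>)"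
      unfolding \<rho>_def using pB by (simp add: emeasure_distr emeasure_density)
    also have "\<dots> = (\<integral>\<^sup>+ v. indicator (S \<inter> pr -` B) v \<partial>\<mu>)"
      by (simp add: indicator_inter_arith)
    finally show ?thesis using pB by simp
  qed
  have "S \<inter> pr -` {x. absv x \<le> 1} = U"
  proof (rule set_eqI)
    show "v \<in> S \<inter> pr -` {x. absv x \<le> 1} \<longleftrightarrow> v \<in> U" for v
      unfolding box[of v] by (auto simp: S_def)
  qed
  then have \<rho>1: "emeasure \<rho> {x. absv x \<le> 1} = 1" using \<rho>[of "{x. absv x \<le> 1}"] F.open_U by simp
  have "\<rho> = scale_measure (emeasure \<rho> {x. absv x \<le> 1}) \<mu>F"
  proof (rule F.haar_unique)
    show "sets \<rho> = sets borel" by (simp add: \<rho>_def)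
    fix c and B :: "'a set" assume B: "B \<in> sets borel"
    have "S \<inter> pr -` ((\<lambda>x. x + c) ` B) = (\<lambda>v. v + emb c) ` (S \<inter> pr -` B)"
    proof (intro equalityI subsetI)
      fix v assume "v \<in> S \<inter> pr -` ((\<lambda>x. x + c) ` B)"
      then obtain b where b: "v \<in> S" "b \<in> B" "pr v = b + c" by auto
      have "pr (v - emb c) + pr (emb c) = pr v" by (simp add: pr(1)[symmetric])
      then have p: "pr (v - emb c) = b" using b pe by simp
      then have "v - emb c \<in> S" using b by (simp add: S_def emb diff_diff_eq add.commute)
      then show "v \<in> (\<lambda>v. v + emb c) ` (S \<inter> pr -` B)" using p b by (intro image_eqI[of _ _ "v - emb c"]) auto
    next
      fix v assume "v \<in> (\<lambda>v. v + emb c) ` (S \<inter> pr -` B)"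
      then show "v \<in> S \<inter> pr -` ((\<lambda>x. x + c) ` B)" by (auto simp: S_def pr pe emb)
    qed
    moreover have "(\<lambda>x. x + c) ` B \<in> sets borel"
    proof -
      have m: "(\<lambda>x. - c + x) \<in> borel_measurable borel"
        by (intro borel_measurable_continuous_onI continuous_on_add_F continuous_on_const continuous_on_id)
      show ?thesis using measurable_sets[OF m B] F.vimage_translate[of "- c" B] by simp
    qed
    moreover have "S \<inter> pr -` B \<in> sets borel" using measurable_sets[OF pr_m B] by auto
    ultimately show "emeasure \<rho> ((\<lambda>x. x + c) ` B) = emeasure \<rho> B"
      using B by (simp add: \<rho> emeasure_translate)
  qed (auto simp: \<rho>1)
  then have \<rho>F: "emeasure \<rho> B = emeasure \<mu>F B" for B by (simp add: \<rho>1)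
  have "?f a -` U = S \<inter> pr -` {x. absv x \<le> absv (inverse a)}"
  proof -
    have 1: "?f a v - emb (pr (?f a v)) = v - emb (pr v)" for v
      unfolding pr_f by (simp add: emb_diff algebra_simps)
    have 2: "absv (pr (?f a v)) \<le> 1 \<longleftrightarrow> absv (pr v) \<le> absv (inverse a)" for v
      unfolding pr_f abs_mult abs_inverse inverse_eq_divide[of "absv a"]
      using a by (simp add: pos_le_divide_eq mult.commute)
    show ?thesis
    proof (rule set_eqI)
      fix v
      have "v \<in> ?f a -` U \<longleftrightarrow> absv (pr (?f a v)) \<le> 1 \<and> ?f a v - emb (pr (?f a v)) \<in> U"
        unfolding vimage_eq by (rule box)
      then show "v \<in> ?f a -` U \<longleftrightarrow> v \<in> S \<inter> pr -` {x. absv x \<le> absv (inverse a)}"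
        unfolding 1 2 S_def by auto
    qed
  qed
  then have "emeasure \<mu> (?f a -` U) = emeasure \<rho> {x. absv x \<le> absv (inverse a)}"
    using closed_abs_ball[of 0 "absv (inverse a)"] by (simp add: \<rho>)
  also have "\<dots> = ennreal (absv (inverse a))"
    unfolding \<rho>F using a by (intro emeasure_F_ball) simp
  finally have "ennreal c = ennreal (1 / absv a)"
    using c(2)[of U] open_U by (simp add: abs_divide inverse_eq_divide)
  then show ?thesis using c(2)[OF A] by simp
qed

text \<open>The modulus of a linear action is multiplicative whether the action is a left or a right
  one, because real factors commute; the disjunction \<open>comp\<close> admits both. The exponent
  \<open>r\<close> counts the coordinates that are scaled when one diagonal entry is
  changed.\<close>

lemma modulus_det:
  fixes \<mu> :: "'b::{metric_space,ab_group_add} measure" and \<Phi> :: "'a^'n^'n \<Rightarrow> 'b \<Rightarrow> 'b"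
  assumes H: "haar_space \<mu> U"
    and add: "\<And>g x y. \<Phi> g (x + y) = \<Phi> g x + \<Phi> g y"
    and cont: "\<And>g. continuous_on UNIV (\<Phi> g)"
    and one: "\<And>x. \<Phi> (mat 1) x = x"
    and comp: "(\<forall>A B x. \<Phi> (A ** B) x = \<Phi> A (\<Phi> B x)) \<or> (\<forall>A B x. \<Phi> (A ** B) x = \<Phi> B (\<Phi> A x))"
    and diag: "\<And>i a. a \<noteq> 0 \<Longrightarrow> emeasure \<mu> (\<Phi> (diag_mat (\<lambda>j. if j = i then a else 1)) -` U) = ennreal ((1 / absv a) ^ r)"
    and g: "invertible g" and A: "A \<in> sets borel"
  shows "emeasure \<mu> (\<Phi> g -` A) = ennreal ((1 / absv (det g)) ^ r) * emeasure \<mu> A"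
proof -
  interpret haar_space \<mu> U by (rule H)
  have ex: "\<exists>c::real. c > 0 \<and> (\<forall>A\<in>sets borel. emeasure \<mu> (\<Phi> g -` A) = ennreal c * emeasure \<mu> A)"
    if g: "invertible g" for g
  proof (rule haar_additive_map[where g = "\<Phi> (matrix_inv g)"])
    show "\<Phi> (matrix_inv g) (\<Phi> g x) = x" "\<Phi> g (\<Phi> (matrix_inv g) x) = x" for x
      using comp matrix_inv_mult[OF g] one by metis+
  qed (use add cont in auto)
  define m where "m g = enn2real (emeasure \<mu> (\<Phi> g -` U))" for g
  have m: "m g > 0" "\<And>A. A \<in> sets borel \<Longrightarrow> emeasure \<mu> (\<Phi> g -` A) = ennreal (m g) * emeasure \<mu> A"
    if g: "invertible g" for g
  proof -
    obtain c :: real where c: "c > 0" "\<And>A. A \<in> sets borel \<Longrightarrow> emeasure \<mu> (\<Phi> g -` A) = ennreal c * emeasure \<mu> A"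
      using ex[OF g] by blast
    have "m g = c" using c(1) c(2)[of U] open_U by (simp add: m_def)
    then show "m g > 0" "\<And>A. A \<in> sets borel \<Longrightarrow> emeasure \<mu> (\<Phi> g -` A) = ennreal (m g) * emeasure \<mu> A"
      using c by auto
  qed
  have vm: "\<Phi> g -` A \<in> sets borel" if "A \<in> sets borel" for g A
    using measurable_sets[OF borel_measurable_continuous_onI[OF cont] that] by simp
  have mult: "m (A ** B) = m A * m B" if AB: "invertible A" "invertible B" for A B
  proof -
    have "emeasure \<mu> (\<Phi> (A ** B) -` U) = ennreal (m A * m B)"
      using comp
    proof
      assume "\<forall>A B x. \<Phi> (A ** B) x = \<Phi> A (\<Phi> B x)"
      then have "\<Phi> (A ** B) -` U = \<Phi> B -` (\<Phi> A -` U)" by auto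
      then show ?thesis using m[OF AB(1)] m[OF AB(2)] vm[of U A] open_U by (simp add: ennreal_mult'' mult.commute)
    next
      assume "\<forall>A B x. \<Phi> (A ** B) x = \<Phi> B (\<Phi> A x)"
      then have "\<Phi> (A ** B) -` U = \<Phi> A -` (\<Phi> B -` U)" by auto
      then show ?thesis using m[OF AB(1)] m[OF AB(2)] vm[of U B] open_U by (simp add: ennreal_mult'')
    qed
    then show ?thesis using m[OF AB(1)] m[OF AB(2)] by (simp add: m_def[of "A ** B"])
  qed
  have "m g = (1 / absv (det g)) ^ r"
  proof (rule multiplicative_eq_det[where absv = "\<lambda>x. 1 / absv x"])
    show "m (diag_mat (\<lambda>j. if j = i then a else 1)) = (1 / absv a) ^ r" if "a \<noteq> 0" for i a
      using diag[OF that, of i] by (simp add: m_def)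
    show "m A \<noteq> 0" if "invertible A" for A using m(1)[OF that] by simp
  qed (use mult g in \<open>auto simp: abs_mult\<close>)
  then show ?thesis using m(2)[OF g A] by simp
qed

lemma continuous_on_axis:
  assumes "continuous_on S f"
  shows "continuous_on S (\<lambda>x. axis i (f x) :: 'b::{topological_space,zero}^'n)"
proof (unfold continuous_on_vec_iff, rule allI)
  fix k
  show "continuous_on S (\<lambda>x. axis i (f x) $ k)" using assms by (cases "k = i") (auto simp: axis_def)
qed

end

locale haar_vector = local_field_haar absv \<mu>F
  for absv :: "'a::{field,metric_space} \<Rightarrow> real" and \<mu>F :: "'a measure" +
  fixes \<mu>X :: "('a^'n::finite) measure"
  assumes haar_X: "haar_normalized \<mu>X {x. vabs x \<le> 1}"
begin

sublocale X: haar_space \<mu>X "{x. vabs x \<le> 1}"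
proof
  show "continuous_on UNIV (\<lambda>p::('a^'n) \<times> ('a^'n). fst p - snd p)"
    by (intro continuous_on_diff_V continuous_on_fst continuous_on_snd continuous_on_id)
  show "open {x::'a^'n. vabs x \<le> 1}" using open_vbox[of 1 0] by simp
  show "0 \<in> {x::'a^'n. vabs x \<le> 1}" by (simp add: vabs_le_iff)
qed (rule compact_vbox separable_V haar_X)+

lemma emeasure_X_coordinate:
  assumes a: "a \<noteq> 0" and A: "A \<in> sets borel"
  shows "emeasure \<mu>X ((*v) (diag_mat (\<lambda>j. if j = i then a else 1)) -` A) = ennreal (1 / absv a) * emeasure \<mu>X A"
proof -
  have "(*v) (diag_mat (\<lambda>j. if j = i then a else 1)) = (\<lambda>v. v + axis i ((a - 1) * v $ i))"
  proof (rule ext, unfold vec_eq_iff, rule allI)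
    fix v k
    have "(diag_mat (\<lambda>j. if j = i then a else 1) *v v) $ k = (\<Sum>j\<in>UNIV. if j = k then (if k = i then a else 1) * v $ k else 0)"
      unfolding matrix_vector_mult_def diag_mat_def vec_lambda_beta by (intro sum.cong) auto
    then show "(diag_mat (\<lambda>j. if j = i then a else 1) *v v) $ k = (v + axis i ((a - 1) * v $ i)) $ k"
      by (auto simp: axis_def algebra_simps)
  qed
  moreover have "emeasure \<mu>X ((\<lambda>v. v + axis i ((a - 1) * v $ i)) -` A) = ennreal (1 / absv a) * emeasure \<mu>X A"
  proof (rule coordinate_scaling[OF X.haar_space_axioms _ _ _ _ _ _ a A])
    show "axis i (a + b) = axis i a + (axis i b :: 'a^'n)" for a b
      by (auto simp: axis_def vec_eq_iff)
    show "v \<in> {x. vabs x \<le> 1} \<longleftrightarrow> absv (v $ i) \<le> 1 \<and> v - axis i (v $ i) \<in> {x. vabs x \<le> 1}" for v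
      by (auto simp: vabs_le_iff axis_def)
  qed (auto intro: continuous_on_axis continuous_on_component continuous_on_id)
  ultimately show ?thesis by simp
qed

lemma continuous_on_mv:
  fixes f :: "'b::topological_space \<Rightarrow> 'a^'n^'n" and g :: "'b \<Rightarrow> 'a^'n"
  shows "continuous_on S f \<Longrightarrow> continuous_on S g \<Longrightarrow> continuous_on S (\<lambda>x. f x *v g x)"
  unfolding continuous_on_vec_iff matrix_vector_mult_def
  by (auto intro!: continuous_on_sum_F continuous_on_mult_F)

lemma emeasure_X_linear:
  assumes g: "invertible g" and A: "A \<in> sets borel"
  shows "emeasure \<mu>X ((\<lambda>x. g *v x) -` A) = ennreal (1 / absv (det g)) * emeasure \<mu>X A"
proof -
  have "emeasure \<mu>X ((\<lambda>x. g *v x) -` A) = ennreal ((1 / absv (det g)) ^ 1) * emeasure \<mu>X A"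
  proof (rule modulus_det[OF X.haar_space_axioms _ _ _ _ _ g A])
    show "continuous_on UNIV ((*v) g)" for g :: "'a^'n^'n"
      by (intro continuous_on_mv continuous_on_const continuous_on_id)
    show "emeasure \<mu>X ((*v) (diag_mat (\<lambda>j. if j = i then a else 1)) -` {x. vabs x \<le> 1}) = ennreal ((1 / absv a) ^ 1)"
      if "a \<noteq> 0" for i a
      using emeasure_X_coordinate[OF that, of "{x. vabs x \<le> 1}" i] X.open_U by simp
  qed (auto simp: matrix_vector_right_distrib matrix_vector_mul_assoc)
  then show ?thesis by simp
qed

end

locale haar_matrix = local_field_haar absv \<mu>F
  for absv :: "'a::{field,metric_space} \<Rightarrow> real" and \<mu>F :: "'a measure" +
  fixes \<mu>M :: "('a^'n::finite^'n) measure"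
  assumes haar_M: "haar_mat absv \<mu>M"
begin

sublocale M: haar_space \<mu>M "{z. mabs z \<le> 1}"
proof
  show "continuous_on UNIV (\<lambda>p::('a^'n^'n) \<times> ('a^'n^'n). fst p - snd p)"
    by (intro continuous_on_diff_M continuous_on_fst continuous_on_snd continuous_on_id)
  show "open {x::'a^'n^'n. mabs x \<le> 1}" using open_mbox[of 1 0] by simp
  show "haar_normalized \<mu>M {z. mabs z \<le> 1}"
    using haar_M unfolding haar_mat_def by (simp add: mabs_le_iff)
qed (auto simp: compact_mbox_0 separable_M)

lemma emeasure_M_coordinate:
  assumes a: "a \<noteq> 0" and A: "A \<in> sets borel"
  shows "emeasure \<mu>M ((\<lambda>v. v + axis i (axis j ((a - 1) * v $ i $ j))) -` A) = ennreal (1 / absv a) * emeasure \<mu>M A"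
proof (rule coordinate_scaling[OF M.haar_space_axioms _ _ _ _ _ _ a A])
  show "axis i (axis j (a + b)) = axis i (axis j a) + (axis i (axis j b) :: 'a^'n^'n)" for a b
    by (auto simp: axis_def vec_eq_iff)
  show "v \<in> {x. mabs x \<le> 1} \<longleftrightarrow> absv (v $ i $ j) \<le> 1 \<and> v - axis i (axis j (v $ i $ j)) \<in> {x. mabs x \<le> 1}"
    for v :: "'a^'n^'n"
  proof -
    have e: "(v - axis i (axis j (v $ i $ j))) $ k $ l = (if k = i \<and> l = j then 0 else v $ k $ l)" for k l
      by (auto simp: axis_def)
    show ?thesis unfolding mem_Collect_eq mabs_le_iff e by (auto split: if_splits)
  qed
qed (auto intro!: continuous_on_axis continuous_on_component continuous_on_id)

text \<open>Multiplying by a diagonal matrix with one nontrivial entry scales a full row, or from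
  the other side a full column. Taking \<open>J\<close> to be that line produces the exponent
  \<open>CARD('n)\<close>.\<close>

lemma emeasure_M_coordinates:
  fixes J :: "('n \<times> 'n) set"
  assumes a: "a \<noteq> 0" and A: "A \<in> sets borel"
  shows "emeasure \<mu>M ((\<lambda>z. \<chi> i j. if (i, j) \<in> J then a * z $ i $ j else z $ i $ j) -` A)
     = ennreal ((1 / absv a) ^ card J) * emeasure \<mu>M A"
proof -
  have "finite J" by simp
  then show ?thesis using A
  proof (induction J arbitrary: A)
    case empty
    then show ?case by (simp add: vimage_def vec_lambda_eta)
  next
    case (insert x J)
    obtain i j where x: "x = (i, j)" by (cases x)
    let ?c = "\<lambda>v::'a^'n^'n. v + axis i (axis j ((a - 1) * v $ i $ j))"
    let ?S = "\<lambda>J (z::'a^'n^'n). \<chi> i j. if (i, j) \<in> J then a * z $ i $ j else z $ i $ j"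
    have "?S (insert x J) z = ?c (?S J z)" for z
      using insert(2) x by (auto simp: vec_eq_iff axis_def algebra_simps)
    then have "?S (insert x J) -` A = ?S J -` (?c -` A)" by auto
    moreover have "?c -` A \<in> sets borel"
    proof -
      have "continuous_on UNIV ?c"
        by (intro M.continuous_on_add_b continuous_on_axis continuous_on_mult_F continuous_on_component
            continuous_on_const continuous_on_id)
      from measurable_sets[OF borel_measurable_continuous_onI[OF this] insert.prems] show ?thesis by simp
    qed
    moreover have "ennreal ((1 / absv a) ^ card (insert x J)) = ennreal ((1 / absv a) ^ card J) * ennreal (1 / absv a)"
      using insert(1,2) by (subst ennreal_mult[symmetric]) (auto simp: mult.commute)
    ultimately show ?case
      using insert.IH by (simp only: emeasure_M_coordinate[OF a insert.prems] mult.assoc)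
  qed
qed

lemma emeasure_M_left:
  assumes g: "invertible g" and A: "A \<in> sets borel"
  shows "emeasure \<mu>M ((\<lambda>z. g ** z) -` A) = ennreal ((1 / absv (det g)) ^ CARD('n)) * emeasure \<mu>M A"
proof (rule modulus_det[OF M.haar_space_axioms _ _ _ _ _ g A])
  show "continuous_on UNIV (\<lambda>z::'a^'n^'n. g ** z)" for g :: "'a^'n^'n"
    by (rule continuous_on_matrix_mult[OF continuous_on_const continuous_on_id])
  show "emeasure \<mu>M ((**) (diag_mat (\<lambda>j. if j = i then a else 1)) -` {x. mabs x \<le> 1}) = ennreal ((1 / absv a) ^ CARD('n))"
    if "a \<noteq> 0" for i :: 'n and a
  proof -
    have "(**) (diag_mat (\<lambda>j. if j = i then a else 1)) =
        (\<lambda>z::'a^'n^'n. \<chi> k j. if (k, j) \<in> {i} \<times> UNIV then a * z $ k $ j else z $ k $ j)"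
      by (auto simp: fun_eq_iff vec_eq_iff diag_mat_mult_entry)
    then show ?thesis
      using emeasure_M_coordinates[OF that, of "{x. mabs x \<le> 1}" "{i} \<times> UNIV"] M.open_U
      by (simp add: card_cartesian_product)
  qed
qed (auto simp: matrix_add_ldistrib matrix_mul_assoc)

lemma matrix_add_mult: "(A + B) ** C = A ** C + B ** (C :: 'b::semiring_1^'k^'k)"
  by (simp add: vec_eq_iff matrix_mult_entry distrib_right sum.distrib)

lemma emeasure_M_right:
  assumes g: "invertible g" and A: "A \<in> sets borel"
  shows "emeasure \<mu>M ((\<lambda>z. z ** g) -` A) = ennreal ((1 / absv (det g)) ^ CARD('n)) * emeasure \<mu>M A"
proof (rule modulus_det[OF M.haar_space_axioms _ _ _ _ _ g A, where \<Phi> = "\<lambda>g z. z ** g"])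
  show "continuous_on UNIV (\<lambda>z::'a^'n^'n. z ** g)" for g :: "'a^'n^'n"
    by (intro continuous_on_matrix_mult continuous_on_const continuous_on_id)
  show "emeasure \<mu>M ((\<lambda>z. z ** diag_mat (\<lambda>j. if j = i then a else 1)) -` {x. mabs x \<le> 1}) = ennreal ((1 / absv a) ^ CARD('n))"
    if "a \<noteq> 0" for i :: 'n and a
  proof -
    have "(\<lambda>z. z ** diag_mat (\<lambda>j. if j = i then a else 1)) =
        (\<lambda>z::'a^'n^'n. \<chi> k j. if (k, j) \<in> UNIV \<times> {i} then a * z $ k $ j else z $ k $ j)"
      by (auto simp: fun_eq_iff vec_eq_iff mult_diag_mat_entry)
    then show ?thesis
      using emeasure_M_coordinates[OF that, of "{x. mabs x \<le> 1}" "UNIV \<times> {i}"] M.open_U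
      by (simp add: card_cartesian_product)
  qed
qed (auto simp: matrix_add_mult matrix_mul_assoc)

end

section \<open>The measure on rank one matrices\<close>

definition outer :: "'a::field^'n \<Rightarrow> 'a^'n \<Rightarrow> 'a^'n^'n" where
  "outer x y = (\<chi> i j. x $ i * y $ j)"

lemma outer_mult: "g ** outer x y ** h = outer (g *v x) (transpose h *v y)"
  unfolding vec_eq_iff matrix_mult_entry outer_def matrix_vector_mult_def transpose_def vec_lambda_beta
  by (simp add: sum_distrib_right sum_distrib_left mult_ac)

lemma outer_scale: "outer x (a *s y) = outer (a *s x) y"
  by (simp add: outer_def vec_eq_iff mult_ac)

lemma mat_scale_mult: "mat a *v x = a *s x" for x :: "'a::field^'n"
  by (simp add: matrix_vector_mult_def mat_def vec_eq_iff if_distrib[of "\<lambda>x. x * _"] cong: if_cong)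

lemma det_mat: "det (mat a :: 'a::field^'n^'n) = a ^ CARD('n)"
  by (subst det_diagonal) (auto simp: mat_def)

lemma rank_outer:
  fixes x y :: "'a::field^'n"
  assumes "x \<noteq> 0" "y \<noteq> 0" shows "rank (outer x y) = 1"
proof -
  obtain i where i: "x $ i \<noteq> 0" using assms by (auto simp: vec_eq_iff)
  have r: "row k (outer x y) = x $ k *s y" for k
    by (simp add: row_def outer_def vec_eq_iff)
  have "vec.span (rows (outer x y)) = vec.span {y}"
  proof (rule antisym)
    show "vec.span (rows (outer x y)) \<subseteq> vec.span {y}"
      using vec.span_scale[OF vec.span_base, of y "{y}"] by (intro vec.span_minimal) (auto simp: rows_def r)
    have "y = inverse (x $ i) *s row i (outer x y)" using i by (simp add: r)
    then have "y \<in> vec.span (rows (outer x y))"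
      using vec.span_scale[OF vec.span_base, of "row i (outer x y)" "rows (outer x y)" "inverse (x $ i)"]
      by (auto simp: rows_def)
    then show "vec.span {y} \<subseteq> vec.span (rows (outer x y))"
      by (intro vec.span_minimal) auto
  qed
  then have "rank (outer x y) = vec.dim {y}"
    unfolding row_rank_def_gen using vec.dim_span by metis
  also have "\<dots> = 1"
    using assms(2) vec.dim_eq_card_independent[of "{y}"] by simp
  finally show ?thesis .
qed

section \<open>Volumes of spheres in the field under the multiplicative measure\<close>

context local_field_haar
begin

lemma measurable_abs [measurable]: "absv \<in> borel_measurable borel"
  by (intro borel_measurable_continuous_onI continuous_on_abs continuous_on_id)

lemma measurable_vabs [measurable]: "(vabs :: 'a^'n \<Rightarrow> real) \<in> borel_measurable borel"
  unfolding borel_measurable_iff_le using borel_closed[OF closed_vbox[of "0::'a^'n"]] by simp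

lemma vabs_0 [simp]: "vabs 0 = 0" by simp

text \<open>The mass of every sphere around 0 for the multiplicative measure
  \<open>da / |a|\<close>. It measures how much of a torus orbit survives the normalization to norm
  1, and so relates \<open>rank1_measure\<close> to the quotient measure.\<close>

definition unit_vol :: real where "unit_vol = measure \<mu>F {a. absv a = 1}"

lemma units_measurable [measurable]: "{a. absv a = r} \<in> sets borel"
  by (intro borel_closed closed_Collect_eq continuous_on_abs continuous_on_id continuous_on_const)

lemma emeasure_units: "emeasure \<mu>F {a. absv a = 1} = ennreal unit_vol" and unit_vol_pos: "unit_vol > 0"
proof -
  have le: "emeasure \<mu>F {a. absv a = 1} \<le> emeasure \<mu>F {a. absv a \<le> 1}"
    by (rule emeasure_mono) (use F.open_U in auto)
  then have fin: "emeasure \<mu>F {a. absv a = 1} \<noteq> \<infinity>" by (auto simp: top_unique)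
  then show eq: "emeasure \<mu>F {a. absv a = 1} = ennreal unit_vol"
    unfolding unit_vol_def by (simp add: emeasure_eq_ennreal_measure)
  \<comment> \<open>By the isosceles principle a ball of radius \<open>absv c < 1\<close> around 1
    consists of units, which gives the unit group positive volume.\<close>
  obtain c where c: "c \<noteq> 0" "absv c < 1" using ex_abs_less[of 1] by auto
  have "(\<lambda>x. x + 1) ` {x. absv x \<le> absv c} \<subseteq> {a. absv a = 1}"
  proof safe
    fix x assume "absv x \<le> absv c"
    then show "absv (x + 1) = 1" using abs_diff_less_imp_eq[of "x + 1" 1] c by simp
  qed
  then have "emeasure \<mu>F ((\<lambda>x. x + 1) ` {x. absv x \<le> absv c}) \<le> emeasure \<mu>F {a. absv a = 1}"
    by (rule emeasure_mono) simp
  moreover have "emeasure \<mu>F ((\<lambda>x. x + 1) ` {x. absv x \<le> absv c}) = ennreal (absv c)"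
    using F.emeasure_translate[of "{x. absv x \<le> absv c}"] closed_abs_ball[of 0] emeasure_F_ball[OF c(1)] by simp
  ultimately have "ennreal (absv c) \<le> ennreal unit_vol" using eq by simp
  show "unit_vol > 0"
  proof (rule ccontr)
    assume "\<not> unit_vol > 0"
    then have "ennreal unit_vol = 0" by (simp add: ennreal_eq_0_iff)
    with \<open>ennreal (absv c) \<le> ennreal unit_vol\<close> have "ennreal (absv c) = 0" by simp
    then have "absv c \<le> 0" unfolding ennreal_eq_0_iff .
    then show False using c(1) abs_pos_iff[of c] by linarith
  qed
qed

lemma emeasure_sphere:
  assumes "b \<noteq> 0" shows "emeasure \<mu>F {a. absv a = absv b} = ennreal (absv b * unit_vol)"
proof -
  have "{a. absv a = absv b} = (\<lambda>x. b * x) ` {a. absv a = 1}"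
  proof (intro equalityI subsetI)
    fix x assume "x \<in> {a. absv a = absv b}"
    then have "absv (x / b) = 1" using assms by (simp add: abs_divide)
    then show "x \<in> (\<lambda>x. b * x) ` {a. absv a = 1}" using assms by (intro image_eqI[of _ _ "x / b"]) auto
  qed (auto simp: abs_mult)
  then show ?thesis
    using emeasure_F_scale[OF assms, of "{a. absv a = 1}"] emeasure_units unit_vol_pos by (simp add: ennreal_mult')
qed

lemma nn_integral_sphere:
  assumes "b \<noteq> 0"
  shows "(\<integral>\<^sup>+ a. indicator (-{0}) a * indicator {a. absv a = absv b} a * ennreal (1 / absv a) \<partial>\<mu>F) = ennreal unit_vol"
proof -
  have "(\<integral>\<^sup>+ a. indicator (-{0}) a * indicator {a. absv a = absv b} a * ennreal (1 / absv a) \<partial>\<mu>F)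
     = (\<integral>\<^sup>+ a. ennreal (1 / absv b) * indicator {a. absv a = absv b} a \<partial>\<mu>F)"
    using assms by (intro nn_integral_cong) (auto simp: indicator_def)
  also have "\<dots> = ennreal (1 / absv b) * ennreal (absv b * unit_vol)"
    by (subst nn_integral_cmult_indicator) (auto simp: emeasure_sphere[OF assms])
  also have "\<dots> = ennreal unit_vol"
    using assms unit_vol_pos by (subst ennreal_mult[symmetric]) auto
  finally show ?thesis .
qed

text \<open>The scalars \<open>a\<close> bringing \<open>a *s y\<close>, respectively
  \<open>inverse a *s y\<close>, to norm 1 form a single sphere, whose multiplicative volume does
  not depend on its radius.\<close>

lemma nn_integral_torus:
  fixes y :: "'a^'n"
  assumes "y \<noteq> 0"
  shows "(\<integral>\<^sup>+ a. indicator (-{0}) a * of_bool (absv a * vabs y = 1) * ennreal (1 / absv a) \<partial>\<mu>F) = ennreal unit_vol"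
    and "(\<integral>\<^sup>+ a. indicator (-{0}) a * of_bool (vabs y = absv a) * ennreal (1 / absv a) \<partial>\<mu>F) = ennreal unit_vol"
proof -
  obtain i where i: "vabs y = absv (y $ i)" using vabs_attained by blast
  define b where "b = y $ i"
  have b: "b \<noteq> 0" "vabs y = absv b" using assms i vabs_eq_0_iff[of y] by (auto simp: b_def)
  have "absv a * vabs y = 1 \<longleftrightarrow> absv a = absv (inverse b)" for a
    unfolding abs_inverse b(2) inverse_eq_divide[of "absv b"] using b(1) by (simp add: eq_divide_eq)
  then have "of_bool (absv a * vabs y = 1) = (indicator {a. absv a = absv (inverse b)} a :: ennreal)" for a
    by (simp add: indicator_def)
  then show "(\<integral>\<^sup>+ a. indicator (-{0}) a * of_bool (absv a * vabs y = 1) * ennreal (1 / absv a) \<partial>\<mu>F) = ennreal unit_vol"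
    using nn_integral_sphere[of "inverse b"] b by simp
  have "of_bool (vabs y = absv a) = (indicator {a. absv a = absv b} a :: ennreal)" for a
    using b by (auto simp: indicator_def)
  then show "(\<integral>\<^sup>+ a. indicator (-{0}) a * of_bool (vabs y = absv a) * ennreal (1 / absv a) \<partial>\<mu>F) = ennreal unit_vol"
    using nn_integral_sphere[of b] b by simp
qed

end

context haar_vector
begin

lemma measurable_mv [measurable]: "(\<lambda>x. g *v x) \<in> borel \<rightarrow>\<^sub>M (borel :: ('a^'n) measure)" for g :: "'a^'n^'n"
  by (intro borel_measurable_continuous_onI continuous_on_mv continuous_on_const continuous_on_id)

lemma nn_integral_X_linear:
  assumes g: "invertible g" and f: "f \<in> borel_measurable borel"
  shows "(\<integral>\<^sup>+ x. f (g *v x) \<partial>\<mu>X) = ennreal (1 / absv (det g)) * (\<integral>\<^sup>+ x. f x \<partial>\<mu>X)"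
  by (rule nn_integral_scaled_action) (use f emeasure_X_linear[OF g] in \<open>auto simp: measurable_cong_sets[OF X.sets_haar X.sets_haar]
      measurable_cong_sets[OF X.sets_haar refl]\<close>)

lemma invertible_mat: "a \<noteq> 0 \<Longrightarrow> invertible (mat a :: 'a^'n^'n)"
  by (simp add: invertible_det_nz det_mat)

lemma nn_integral_X_scale:
  assumes a: "a \<noteq> 0" and f: "f \<in> borel_measurable borel"
  shows "(\<integral>\<^sup>+ x. f (a *s x) \<partial>\<mu>X) = ennreal (1 / absv a ^ CARD('n)) * (\<integral>\<^sup>+ x. f x \<partial>\<mu>X)"
  using nn_integral_X_linear[OF invertible_mat[OF a] f] by (simp add: mat_scale_mult det_mat abs_power)

lemma X_prod_sets [simp, measurable_cong]: "sets (\<mu>X \<Otimes>\<^sub>M \<mu>X) = sets borel"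
  using borel_prod_separable[OF separable_V separable_V] by (simp cong: sets_pair_measure_cong)

sublocale XX: pair_sigma_finite \<mu>X \<mu>X ..
sublocale XF: pair_sigma_finite \<mu>X \<mu>F ..

lemma continuous_on_outer:
  fixes f g :: "'b::topological_space \<Rightarrow> 'a^'n"
  shows "continuous_on S f \<Longrightarrow> continuous_on S g \<Longrightarrow> continuous_on S (\<lambda>x. outer (f x) (g x))"
  unfolding continuous_on_vec_iff outer_def by (auto intro!: continuous_on_mult_F)

lemma measurable_outer [measurable]: "(\<lambda>(x, y). outer x y) \<in> borel \<rightarrow>\<^sub>M (borel :: ('a^'n^'n) measure)"
  unfolding case_prod_beta'
  by (intro borel_measurable_continuous_onI continuous_on_outer continuous_on_fst continuous_on_snd continuous_on_id)

text \<open>The rank one orbit is fibred over the projective space of rows; its points are represented by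
  vectors of norm 1.\<close>

definition rank1_measure :: "('a^'n^'n) measure" where
  "rank1_measure = distr (density (\<mu>X \<Otimes>\<^sub>M \<mu>X) (\<lambda>(x, y). of_bool (vabs y = 1))) borel (\<lambda>(x, y). outer x y)"

lemma sets_rank1_measure [simp, measurable_cong]: "sets rank1_measure = sets borel"
  by (simp add: rank1_measure_def)

lemma measurable_prim: "(\<lambda>(x, y::'a^'n). of_bool (vabs y = 1) :: ennreal) \<in> borel_measurable (\<mu>X \<Otimes>\<^sub>M \<mu>X)"
proof -
  have "(\<lambda>y::'a^'n. of_bool (vabs y = 1) :: ennreal) \<in> borel_measurable \<mu>X"
    by (simp add: measurable_cong_sets[OF X.sets_haar refl])
  from measurable_compose[OF measurable_snd this] show ?thesis by (simp add: case_prod_beta')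
qed

lemma nn_integral_rank1:
  assumes f: "f \<in> borel_measurable borel"
  shows "(\<integral>\<^sup>+ p. f p \<partial>rank1_measure) = (\<integral>\<^sup>+ y. of_bool (vabs y = 1) * (\<integral>\<^sup>+ x. f (outer x y) \<partial>\<mu>X) \<partial>\<mu>X)"
proof -
  have fo: "(\<lambda>(x, y). f (outer x y)) \<in> borel_measurable (\<mu>X \<Otimes>\<^sub>M \<mu>X)"
    using measurable_compose[OF measurable_outer f] by (simp add: case_prod_beta' measurable_cong_sets[OF X_prod_sets refl])
  have mo: "(\<lambda>(x, y). outer x y) \<in> \<mu>X \<Otimes>\<^sub>M \<mu>X \<rightarrow>\<^sub>M borel"
    using measurable_outer by (simp add: measurable_cong_sets[OF X_prod_sets refl])
  have "(\<integral>\<^sup>+ p. f p \<partial>rank1_measure)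
     = (\<integral>\<^sup>+ w. (case w of (x, y) \<Rightarrow> of_bool (vabs y = 1)) * (case w of (x, y) \<Rightarrow> f (outer x y)) \<partial>(\<mu>X \<Otimes>\<^sub>M \<mu>X))"
    unfolding rank1_measure_def using f fo mo measurable_prim
    by (simp add: nn_integral_distr nn_integral_density case_prod_beta')
  also have "\<dots> = (\<integral>\<^sup>+ y. \<integral>\<^sup>+ x. of_bool (vabs y = 1) * f (outer x y) \<partial>\<mu>X \<partial>\<mu>X)"
    using borel_measurable_times_ennreal[OF measurable_prim fo] by (subst XX.nn_integral_snd[symmetric]) (auto simp: case_prod_beta')
  also have "\<dots> = (\<integral>\<^sup>+ y. of_bool (vabs y = 1) * (\<integral>\<^sup>+ x. f (outer x y) \<partial>\<mu>X) \<partial>\<mu>X)"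
    by (intro nn_integral_cong) (auto simp: of_bool_def)
  finally show ?thesis .
qed

text \<open>Integrals over unit vectors of functions that are homogeneous of degree \<open>- n\<close> are integrals
  over projective space: averaging over the torus shows independence of the fundamental domain.\<close>

lemma nn_integral_prim_linear:
  assumes h: "invertible h" and H[measurable]: "H \<in> borel_measurable borel"
    and hom: "\<And>a y. a \<noteq> 0 \<Longrightarrow> H (a *s y) = ennreal (1 / absv a ^ CARD('n)) * H y"
  shows "(\<integral>\<^sup>+ y. of_bool (vabs y = 1) * H (h *v y) \<partial>\<mu>X)
       = ennreal (1 / absv (det h)) * (\<integral>\<^sup>+ y. of_bool (vabs y = 1) * H y \<partial>\<mu>X)"
proof -
  define h' where "h' = matrix_inv h"
  have h'h: "h' *v (h *v y) = y" for y
    using matrix_inv_mult[OF h] by (simp add: h'_def matrix_vector_mul_assoc)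
  have h'nz: "h' *v y \<noteq> 0" if "y \<noteq> 0" for y
    using that matrix_inv_mult[OF h] matrix_vector_mul_assoc[of h h' y] by (auto simp: h'_def)
  have of_m[measurable]: "(\<lambda>y. of_bool (vabs (h' *v y) = 1) :: ennreal) \<in> borel_measurable borel"
    "(\<lambda>y::'a^'n. of_bool (vabs y = 1) :: ennreal) \<in> borel_measurable borel" by measurable
  have "(\<integral>\<^sup>+ y. of_bool (vabs y = 1) * H (h *v y) \<partial>\<mu>X) = (\<integral>\<^sup>+ y. (\<lambda>y. of_bool (vabs (h' *v y) = 1) * H y) (h *v y) \<partial>\<mu>X)"
    by (simp add: h'h)
  also have "\<dots> = ennreal (1 / absv (det h)) * (\<integral>\<^sup>+ y. of_bool (vabs (h' *v y) = 1) * H y \<partial>\<mu>X)"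
    by (rule nn_integral_X_linear[OF h]) measurable
  finally have 1: "(\<integral>\<^sup>+ y. of_bool (vabs y = 1) * H (h *v y) \<partial>\<mu>X)
     = ennreal (1 / absv (det h)) * (\<integral>\<^sup>+ y. of_bool (vabs (h' *v y) = 1) * H y \<partial>\<mu>X)" .
  let ?t = "\<lambda>a. indicator (-{0}) a * ennreal (1 / absv a)"
  have t[measurable]: "?t \<in> borel_measurable borel" by measurable
  have tF: "?t \<in> borel_measurable \<mu>F" using t by (simp add: measurable_cong_sets[OF F.sets_haar refl])
  have mB: "(\<lambda>p. f (fst p)) \<in> borel_measurable (\<mu>X \<Otimes>\<^sub>M \<mu>F)" if "f \<in> borel_measurable borel" for f :: "'a^'n \<Rightarrow> ennreal"
    using that by (intro measurable_compose[OF measurable_fst]) (simp add: measurable_cong_sets[OF X.sets_haar refl])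
  have mB': "(\<lambda>p. f (fst p)) \<in> borel_measurable (\<mu>X \<Otimes>\<^sub>M \<mu>F)" if "f \<in> borel_measurable borel" for f :: "'a^'n \<Rightarrow> real"
    using that by (intro measurable_compose[OF measurable_fst]) (simp add: measurable_cong_sets[OF X.sets_haar refl])
  have mF: "(\<lambda>p. f (snd p)) \<in> borel_measurable (\<mu>X \<Otimes>\<^sub>M \<mu>F)" if "f \<in> borel_measurable borel" for f :: "'a \<Rightarrow> ennreal"
    using that by (intro measurable_compose[OF measurable_snd]) (simp add: measurable_cong_sets[OF F.sets_haar refl])
  have mF': "(\<lambda>p. f (snd p)) \<in> borel_measurable (\<mu>X \<Otimes>\<^sub>M \<mu>F)" if "f \<in> borel_measurable borel" for f :: "'a \<Rightarrow> real"
    using that by (intro measurable_compose[OF measurable_snd]) (simp add: measurable_cong_sets[OF F.sets_haar refl])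
  have vh: "(\<lambda>y. vabs (h' *v y)) \<in> borel_measurable borel" by measurable
  have K1: "(\<lambda>(y, a). of_bool (vabs (h' *v y) = 1) * H y * (?t a * of_bool (absv a * vabs y = 1))) \<in> borel_measurable (\<mu>X \<Otimes>\<^sub>M \<mu>F)"
  proof -
    have "{p \<in> space (\<mu>X \<Otimes>\<^sub>M \<mu>F). absv (snd p) * vabs (fst p) = 1} \<in> sets (\<mu>X \<Otimes>\<^sub>M \<mu>F)"
      using mB'[OF measurable_vabs] mF'[OF measurable_abs] by measurable
    then have "(\<lambda>p. of_bool (absv (snd p) * vabs (fst p) = 1) :: ennreal) \<in> borel_measurable (\<mu>X \<Otimes>\<^sub>M \<mu>F)"
      by measurable
    from borel_measurable_times_ennreal[OF borel_measurable_times_ennreal[OF mB[OF of_m(1)] mB[OF H]]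
       borel_measurable_times_ennreal[OF mF[OF t] this]]
    show ?thesis by (simp add: case_prod_beta')
  qed
  have K2: "(\<lambda>(y, a). of_bool (vabs y = 1) * H y * (?t a * of_bool (vabs (h' *v y) = absv a))) \<in> borel_measurable (\<mu>X \<Otimes>\<^sub>M \<mu>F)"
  proof -
    have "{p \<in> space (\<mu>X \<Otimes>\<^sub>M \<mu>F). vabs (h' *v fst p) = absv (snd p)} \<in> sets (\<mu>X \<Otimes>\<^sub>M \<mu>F)"
      using mB'[OF vh] mF'[OF measurable_abs] by measurable
    then have "(\<lambda>p. of_bool (vabs (h' *v fst p) = absv (snd p)) :: ennreal) \<in> borel_measurable (\<mu>X \<Otimes>\<^sub>M \<mu>F)"
      by measurable
    from borel_measurable_times_ennreal[OF borel_measurable_times_ennreal[OF mB[OF of_m(2)] mB[OF H]]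
       borel_measurable_times_ennreal[OF mF[OF t] this]]
    show ?thesis by (simp add: case_prod_beta')
  qed
  have ob: "(\<lambda>a. of_bool (absv a * r = 1) :: ennreal) \<in> borel_measurable \<mu>F"
    "(\<lambda>a. of_bool (r = absv a) :: ennreal) \<in> borel_measurable \<mu>F" for r
    by (simp_all add: measurable_cong_sets[OF F.sets_haar refl])
  \<comment> \<open>After the substitution by \<open>h\<close> the domain is cut out by
    \<open>vabs (h' *v y) = 1\<close>. Inserting the volume of all \<open>a\<close> with
    \<open>absv a * vabs y = 1\<close> introduces the other domain as well, so that the two can be
    exchanged.\<close>
  have "ennreal unit_vol * (\<integral>\<^sup>+ y. of_bool (vabs (h' *v y) = 1) * H y \<partial>\<mu>X)
     = (\<integral>\<^sup>+ y. of_bool (vabs (h' *v y) = 1) * H y * ennreal unit_vol \<partial>\<mu>X)"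
    by (subst nn_integral_multc) (auto simp: mult.commute measurable_cong_sets[OF X.sets_haar refl])
  also have "\<dots> = (\<integral>\<^sup>+ y. \<integral>\<^sup>+ a. of_bool (vabs (h' *v y) = 1) * H y * (?t a * of_bool (absv a * vabs y = 1)) \<partial>\<mu>F \<partial>\<mu>X)"
  proof (rule nn_integral_cong)
    fix y
    show "of_bool (vabs (h' *v y) = 1) * H y * ennreal unit_vol
      = (\<integral>\<^sup>+ a. of_bool (vabs (h' *v y) = 1) * H y * (?t a * of_bool (absv a * vabs y = 1)) \<partial>\<mu>F)"
    proof (cases "y = 0")
      case True
      then have "vabs (h' *v y) = 0" by simp
      then show ?thesis by simp
    next
      case False
      have "(\<integral>\<^sup>+ a. of_bool (vabs (h' *v y) = 1) * H y * (?t a * of_bool (absv a * vabs y = 1)) \<partial>\<mu>F)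
        = of_bool (vabs (h' *v y) = 1) * H y * (\<integral>\<^sup>+ a. ?t a * of_bool (absv a * vabs y = 1) \<partial>\<mu>F)"
        using tF ob by (intro nn_integral_cmult borel_measurable_times_ennreal) auto
      also have "(\<integral>\<^sup>+ a. ?t a * of_bool (absv a * vabs y = 1) \<partial>\<mu>F) = ennreal unit_vol"
        using nn_integral_torus(1)[OF False] by (simp add: mult_ac)
      finally show ?thesis by simp
    qed
  qed
  also have "\<dots> = (\<integral>\<^sup>+ a. \<integral>\<^sup>+ y. of_bool (vabs (h' *v y) = 1) * H y * (?t a * of_bool (absv a * vabs y = 1)) \<partial>\<mu>X \<partial>\<mu>F)"
    using XF.Fubini[OF K1] by simp
  \<comment> \<open>Replacing \<open>y\<close> by \<open>a *s y\<close> interchanges the roles of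
    the two conditions. The Jacobian of this dilation is cancelled exactly by the homogeneity of
    \<open>H\<close>.\<close>
  also have "\<dots> = (\<integral>\<^sup>+ a. \<integral>\<^sup>+ y. of_bool (vabs y = 1) * H y * (?t a * of_bool (vabs (h' *v y) = absv a)) \<partial>\<mu>X \<partial>\<mu>F)"
  proof (rule nn_integral_cong)
    fix a
    show "(\<integral>\<^sup>+ y. of_bool (vabs (h' *v y) = 1) * H y * (?t a * of_bool (absv a * vabs y = 1)) \<partial>\<mu>X)
       = (\<integral>\<^sup>+ y. of_bool (vabs y = 1) * H y * (?t a * of_bool (vabs (h' *v y) = absv a)) \<partial>\<mu>X)"
    proof (cases "a = 0")
      case False
      let ?G = "\<lambda>y. of_bool (vabs y = 1) * H y * (?t a * of_bool (vabs (h' *v y) = absv a))"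
      have G: "?G \<in> borel_measurable borel"
        using vh by measurable
      have sc: "h' *v (a *s y) = a *s (h' *v y)" for y by (simp add: vector_scalar_commute)
      have Ga: "?G (a *s y) = ennreal (1 / absv a ^ CARD('n)) *
          (of_bool (vabs (h' *v y) = 1) * H y * (?t a * of_bool (absv a * vabs y = 1)))" for y
        unfolding hom[OF False] sc vabs_scale using False by (simp add: mult_ac)
      have m: "(\<lambda>y. of_bool (vabs (h' *v y) = 1) * H y * (?t a * of_bool (absv a * vabs y = 1))) \<in> borel_measurable \<mu>X"
        using vh by (simp add: measurable_cong_sets[OF X.sets_haar refl])
      have "ennreal (1 / absv a ^ CARD('n)) * (\<integral>\<^sup>+ y. of_bool (vabs (h' *v y) = 1) * H y * (?t a * of_bool (absv a * vabs y = 1)) \<partial>\<mu>X)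
         = (\<integral>\<^sup>+ y. ?G (a *s y) \<partial>\<mu>X)"
        unfolding Ga by (rule nn_integral_cmult[OF m, symmetric])
      also have "\<dots> = ennreal (1 / absv a ^ CARD('n)) * (\<integral>\<^sup>+ y. ?G y \<partial>\<mu>X)"
        by (rule nn_integral_X_scale[OF False G])
      finally show ?thesis
        by (rule ennreal_mult_cancel_left[THEN iffD1, THEN disjE]) (use False in auto)
    qed simp
  qed
  also have "\<dots> = (\<integral>\<^sup>+ y. \<integral>\<^sup>+ a. of_bool (vabs y = 1) * H y * (?t a * of_bool (vabs (h' *v y) = absv a)) \<partial>\<mu>F \<partial>\<mu>X)"
    using XF.Fubini[OF K2] by simp
  also have "\<dots> = (\<integral>\<^sup>+ y. of_bool (vabs y = 1) * H y * ennreal unit_vol \<partial>\<mu>X)"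
  proof (rule nn_integral_cong)
    fix y
    show "(\<integral>\<^sup>+ a. of_bool (vabs y = 1) * H y * (?t a * of_bool (vabs (h' *v y) = absv a)) \<partial>\<mu>F)
      = of_bool (vabs y = 1) * H y * ennreal unit_vol"
    proof (cases "vabs y = 1")
      case True
      then have "y \<noteq> 0" by auto
      have "(\<integral>\<^sup>+ a. of_bool (vabs y = 1) * H y * (?t a * of_bool (vabs (h' *v y) = absv a)) \<partial>\<mu>F)
        = of_bool (vabs y = 1) * H y * (\<integral>\<^sup>+ a. ?t a * of_bool (vabs (h' *v y) = absv a) \<partial>\<mu>F)"
        using tF ob by (intro nn_integral_cmult borel_measurable_times_ennreal) auto
      also have "(\<integral>\<^sup>+ a. ?t a * of_bool (vabs (h' *v y) = absv a) \<partial>\<mu>F) = ennreal unit_vol"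
        using nn_integral_torus(2)[OF h'nz[OF \<open>y \<noteq> 0\<close>]] by (simp add: mult_ac)
      finally show ?thesis .
    qed simp
  qed
  also have "\<dots> = ennreal unit_vol * (\<integral>\<^sup>+ y. of_bool (vabs y = 1) * H y \<partial>\<mu>X)"
    by (subst nn_integral_multc) (auto simp: mult.commute measurable_cong_sets[OF X.sets_haar refl])
  finally have "ennreal unit_vol * (\<integral>\<^sup>+ y. of_bool (vabs (h' *v y) = 1) * H y \<partial>\<mu>X)
     = ennreal unit_vol * (\<integral>\<^sup>+ y. of_bool (vabs y = 1) * H y \<partial>\<mu>X)" .
  then have "(\<integral>\<^sup>+ y. of_bool (vabs (h' *v y) = 1) * H y \<partial>\<mu>X) = (\<integral>\<^sup>+ y. of_bool (vabs y = 1) * H y \<partial>\<mu>X)"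
    by (rule ennreal_mult_cancel_left[THEN iffD1, THEN disjE]) (use unit_vol_pos in auto)
  then show ?thesis using 1 by simp
qed

text \<open>The factor \<open>g\<close> acts on the column and contributes its Jacobian. For the
  row, integration over columns leaves a function homogeneous of degree \<open>- n\<close>, because
  a scalar can be moved from \<open>y\<close> to \<open>x\<close> inside \<open>outer x y\<close>;
  for such functions the change of fundamental domain costs only
  \<open>1 / absv (det h)\<close>.\<close>

lemma nn_integral_rank1_transform:
  assumes f: "f \<in> borel_measurable borel" and g: "invertible g" and h: "invertible h"
  shows "(\<integral>\<^sup>+ p. f (g ** p ** h) \<partial>rank1_measure)
     = ennreal (1 / absv (det g) * (1 / absv (det h))) * (\<integral>\<^sup>+ p. f p \<partial>rank1_measure)"
proof -
  define H where "H y = (\<integral>\<^sup>+ x. f (outer x y) \<partial>\<mu>X)" for y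
  have fo: "(\<lambda>(x, y). f (outer x y)) \<in> borel_measurable (\<mu>X \<Otimes>\<^sub>M \<mu>X)"
    using measurable_compose[OF measurable_outer f] by (simp add: case_prod_beta' measurable_cong_sets[OF X_prod_sets refl])
  have "(\<lambda>y. \<integral>\<^sup>+ x. f (outer x y) \<partial>\<mu>X) \<in> borel_measurable \<mu>X"
    using measurable_compose[OF measurable_pair_swap' fo]
    by (intro X.borel_measurable_nn_integral) (simp add: case_prod_beta')
  then have Hm: "H \<in> borel_measurable borel" unfolding H_def by (simp add: measurable_cong_sets[OF X.sets_haar refl])
  have fo1: "(\<lambda>x. f (outer x y)) \<in> borel_measurable borel" for y
    using f by (intro measurable_compose[OF _ f] borel_measurable_continuous_onI continuous_on_outer continuous_on_const continuous_on_id)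
  have hom: "H (a *s y) = ennreal (1 / absv a ^ CARD('n)) * H y" if "a \<noteq> 0" for a y
    unfolding H_def outer_scale by (rule nn_integral_X_scale[OF that fo1])
  have ht: "invertible (transpose h)" "det (transpose h) = det h"
    using h by (simp_all add: invertible_det_nz det_transpose)
  have Hg: "(\<integral>\<^sup>+ x. f (outer (g *v x) y) \<partial>\<mu>X) = ennreal (1 / absv (det g)) * H y" for y
    unfolding H_def by (rule nn_integral_X_linear[OF g fo1])
  have mf: "(\<lambda>p. f (g ** p ** h)) \<in> borel_measurable borel"
    by (intro measurable_compose[OF _ f] borel_measurable_continuous_onI continuous_on_matrix_mult continuous_on_const continuous_on_id)
  have Hh: "(\<lambda>y. of_bool (vabs y = 1) * H (transpose h *v y)) \<in> borel_measurable \<mu>X"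
  proof -
    have "(\<lambda>y. of_bool (vabs y = 1) :: ennreal) \<in> borel_measurable (borel :: ('a^'n) measure)" by measurable
    from borel_measurable_times_ennreal[OF this measurable_compose[OF measurable_mv Hm]]
    show ?thesis unfolding measurable_cong_sets[OF X.sets_haar refl] .
  qed
  have "(\<integral>\<^sup>+ p. f (g ** p ** h) \<partial>rank1_measure)
      = (\<integral>\<^sup>+ y. of_bool (vabs y = 1) * (ennreal (1 / absv (det g)) * H (transpose h *v y)) \<partial>\<mu>X)"
    unfolding nn_integral_rank1[OF mf] outer_mult Hg ..
  also have "\<dots> = ennreal (1 / absv (det g)) * (\<integral>\<^sup>+ y. of_bool (vabs y = 1) * H (transpose h *v y) \<partial>\<mu>X)"
    by (subst nn_integral_cmult[OF Hh, symmetric]) (simp add: mult_ac)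
  also have "\<dots> = ennreal (1 / absv (det g)) * (ennreal (1 / absv (det h)) * (\<integral>\<^sup>+ y. of_bool (vabs y = 1) * H y \<partial>\<mu>X))"
    unfolding ht(2)[symmetric] by (subst nn_integral_prim_linear[OF ht(1) Hm]) (erule hom, rule refl)
  also have "\<dots> = ennreal (1 / absv (det g) * (1 / absv (det h))) * (\<integral>\<^sup>+ p. f p \<partial>rank1_measure)"
    unfolding nn_integral_rank1[OF f] H_def by (subst ennreal_mult) (auto simp: mult.assoc)
  finally show ?thesis .
qed

end

section \<open>Orbit measures\<close>

lemma integral_indicator_complex:
  assumes "A \<in> sets M"
  shows "integral\<^sup>L M (indicator A :: 'b \<Rightarrow> complex) = complex_of_real (measure M A)"
proof -
  have "(indicator A :: 'b \<Rightarrow> complex) = (\<lambda>x. complex_of_real (indicator A x))"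
    by (auto simp: indicator_def)
  then have "integral\<^sup>L M (indicator A :: 'b \<Rightarrow> complex) = complex_of_real (integral\<^sup>L M (indicator A))"
    by simp
  then show ?thesis using sets.sets_into_space[OF assms] by (simp add: Int_absorb2)
qed

context local_field
begin

text \<open>Centres run through a countable dense set and radii through \<open>1 / Suc n\<close>. A
  box around an arbitrary point is already in the family, since any dense point inside it is also a
  centre.\<close>

lemma mbox_basis:
  obtains B :: "('a^'n^'m) set set" where "countable B" "topological_basis B" "\<And>b. b \<in> B \<Longrightarrow> \<exists>c r. r > 0 \<and> b = {x. mabs (x - c) \<le> r}"
proof -
  obtain D :: "('a^'n^'m) set" where D: "countable D" "\<And>x e. e > 0 \<Longrightarrow> \<exists>d\<in>D. dist d x < e"
    using separable_M unfolding separable_metric_def by blast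
  let ?B = "(\<lambda>(d, n). {x. mabs (x - d) \<le> 1 / real (Suc n)}) ` (D \<times> UNIV)"
  have "topological_basis ?B"
  proof (rule topological_basisI)
    fix b assume "b \<in> ?B"
    then obtain d n where "b = {x. mabs (x - d) \<le> 1 / real (Suc n)}" by auto
    then show "open b" using open_mbox[of "1 / real (Suc n)" d] by simp
  next
    fix S :: "('a^'n^'m) set" and p assume S: "open S" "p \<in> S"
    obtain r where r: "r > 0" "{x. mabs (x - p) \<le> r} \<subseteq> S" using mbox_subset_open[OF S] .
    obtain n where n: "1 / real (Suc n) < r" using nat_approx_posE r(1) by blast
    have "open {x. mabs (x - p) \<le> 1 / real (Suc n)}" by (rule open_mbox) simp
    moreover have "p \<in> {x. mabs (x - p) \<le> 1 / real (Suc n)}" by simp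
    ultimately obtain e where e: "e > 0" "ball p e \<subseteq> {x. mabs (x - p) \<le> 1 / real (Suc n)}"
      by (meson open_contains_ball)
    obtain d where d: "d \<in> D" "dist d p < e" using D(2)[OF e(1)] by blast
    then have "d \<in> ball p e" by (simp add: dist_commute)
    then have "mabs (d - p) \<le> 1 / real (Suc n)" using e(2) by blast
    then have eq: "{x. mabs (x - d) \<le> 1 / real (Suc n)} = {x. mabs (x - p) \<le> 1 / real (Suc n)}"
      by (rule mbox_eq_of_mem)
    have "{x. mabs (x - p) \<le> 1 / real (Suc n)} \<subseteq> S" using r(2) n by (auto intro: order_trans)
    then have 1: "p \<in> {x. mabs (x - d) \<le> 1 / real (Suc n)} \<and> {x. mabs (x - d) \<le> 1 / real (Suc n)} \<subseteq> S"
      unfolding eq by simp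
    have 2: "{x. mabs (x - d) \<le> 1 / real (Suc n)} \<in> ?B" using d(1) by blast
    show "\<exists>B'\<in>?B. p \<in> B' \<and> B' \<subseteq> S" using 2 by (rule rev_bexI) (rule 1)
  qed
  moreover have "countable ?B" using D(1) by auto
  moreover have "\<exists>c r. r > 0 \<and> b = {x. mabs (x - c) \<le> r}" if b: "b \<in> ?B" for b
  proof -
    obtain d n where "b = {x. mabs (x - d) \<le> 1 / real (Suc n)}" using b by auto
    then show ?thesis by (intro exI[of _ d] exI[of _ "1 / real (Suc n)"]) auto
  qed
  ultimately show ?thesis using that by blast
qed

text \<open>The Lindelof property for boxes whose radius varies with the centre: each basis set
  lying in some box selects one such box.\<close>

lemma countable_box_cover:
  fixes Orb :: "('a^'n^'m) set"
  assumes "\<forall>p\<in>Orb. e p > 0"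
  shows "\<exists>C. countable C \<and> C \<subseteq> Orb \<and> Orb \<subseteq> (\<Union>p\<in>C. {x. mabs (x - p) \<le> e p})"
proof -
  obtain B :: "('a^'n^'m) set set" where B: "countable B" "topological_basis B" using mbox_basis by metis
  let ?B = "{b \<in> B. \<exists>p\<in>Orb. b \<subseteq> {x. mabs (x - p) \<le> e p}}"
  have "\<exists>f. \<forall>b\<in>?B. f b \<in> Orb \<and> b \<subseteq> {x. mabs (x - f b) \<le> e (f b)}"
    by (intro bchoice) blast
  then obtain f where f: "\<And>b. b \<in> ?B \<Longrightarrow> f b \<in> Orb \<and> b \<subseteq> {x. mabs (x - f b) \<le> e (f b)}" by blast
  have "Orb \<subseteq> (\<Union>p\<in>f ` ?B. {x. mabs (x - p) \<le> e p})"
  proof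
    fix p assume p: "p \<in> Orb"
    have ep: "e p > 0" using assms p by blast
    then have "p \<in> {x. mabs (x - p) \<le> e p}" by simp
    then obtain b where b: "b \<in> B" "p \<in> b" "b \<subseteq> {x. mabs (x - p) \<le> e p}"
      by (rule topological_basisE[OF B(2) open_mbox[OF ep]])
    then have bB: "b \<in> ?B" using p by blast
    have "p \<in> {x. mabs (x - f b) \<le> e (f b)}" using f[OF bB] b(2) by blast
    then show "p \<in> (\<Union>p\<in>f ` ?B. {x. mabs (x - p) \<le> e p})" using bB by blast
  qed
  moreover have "countable (f ` ?B)" by (intro countable_image countable_subset[OF _ B(1)]) auto
  moreover have "f ` ?B \<subseteq> Orb" using f by blast
  ultimately show ?thesis by blast
qed

text \<open>Orbit measures are compared on small boxes only, with a radius \<open>e p\<close>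
  depending on the point, because finiteness is known only locally on the orbit. Inside one box
  equality follows from intersection stability; the boxes are then glued along a countable
  disjointed cover.\<close>

lemma measure_eq_on_boxes:
  fixes m1 m2 :: "('a^'n^'m) measure"
  assumes s1: "sets m1 = sets borel" and s2: "sets m2 = sets borel" and Orb: "Orb \<in> sets borel"
    and n1: "emeasure m1 (- Orb) = 0" and n2: "emeasure m2 (- Orb) = 0"
    and e: "\<And>p. p \<in> Orb \<Longrightarrow> e p > 0"
    and eq: "\<And>p c r. p \<in> Orb \<Longrightarrow> r > 0 \<Longrightarrow> {x. mabs (x - c) \<le> r} \<subseteq> {x. mabs (x - p) \<le> e p} \<Longrightarrow>
        emeasure m1 {x. mabs (x - c) \<le> r} = emeasure m2 {x. mabs (x - c) \<le> r}
        \<and> emeasure m1 {x. mabs (x - c) \<le> r} \<noteq> \<infinity>"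
  shows "m1 = m2"
proof -
  have sp: "space m1 = UNIV" "space m2 = UNIV"
    using sets_eq_imp_space_eq[OF s1] sets_eq_imp_space_eq[OF s2] by auto
  have box: "{x. mabs (x - p) \<le> r} \<in> sets borel" for p :: "'a^'n^'m" and r
    by (intro borel_closed closed_mbox)
  obtain B :: "('a^'n^'m) set set" where B: "countable B" "topological_basis B"
    "\<And>b. b \<in> B \<Longrightarrow> \<exists>c r. r > 0 \<and> b = {x. mabs (x - c) \<le> r}" using mbox_basis by metis
  \<comment> \<open>The empty set is added since it occurs as the intersection of disjoint
    boxes.\<close>
  let ?E = "insert {} {{x. mabs (x - c) \<le> r} | c r. r > (0::real)} :: ('a^'n^'m) set set"
  have Eopen: "open b" if "b \<in> ?E" for b using that open_mbox by auto
  have BE: "B \<subseteq> ?E" using B(3) by auto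
  have gen: "sigma_sets UNIV ?E = sets borel"
  proof (rule antisym)
    show "sigma_sets UNIV ?E \<subseteq> sets borel"
    proof -
      have "?E \<subseteq> sets borel" using Eopen borel_open by blast
      from sets.sigma_sets_subset[OF this] show ?thesis unfolding space_borel .
    qed
    have "sets borel = sigma_sets UNIV B"
      using borel_eq_countable_basis[OF B(1,2)] by (metis sets_measure_of subset_UNIV Pow_UNIV)
    then show "sets borel \<subseteq> sigma_sets UNIV ?E" using sigma_sets_mono'[OF BE] by simp
  qed
  have int: "Int_stable ?E"
  proof (rule Int_stableI)
    fix a b assume ab: "a \<in> ?E" "b \<in> ?E"
    show "a \<inter> b \<in> ?E"
    proof (cases "a = {} \<or> b = {}")
      case False
      then obtain c r d s where rs: "r > 0" "s > 0" "a = {x. mabs (x - c) \<le> r}" "b = {x. mabs (x - d) \<le> s}"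
        using ab by blast
      show ?thesis
      proof (cases "r \<le> s")
        case True
        then show ?thesis using mbox_Int[OF True, of c d] rs by auto
      next
        case False
        then have "s \<le> r" by simp
        then show ?thesis using mbox_Int[of s r d c] rs by (auto simp: Int_commute)
      qed
    qed auto
  qed
  have local: "emeasure m1 (A \<inter> {x. mabs (x - p) \<le> e p}) = emeasure m2 (A \<inter> {x. mabs (x - p) \<le> e p})"
    if p: "p \<in> Orb" and A: "A \<in> sets borel" for p A
  proof -
    let ?C = "{x. mabs (x - p) \<le> e p}"
    let ?d = "\<lambda>m. density m (indicator ?C)"
    have d: "emeasure (?d m) A = emeasure m (A \<inter> ?C)" if m: "sets m = sets borel" and A: "A \<in> sets borel" for m A
    proof -
      have "A \<in> sets m" "?C \<in> sets m" using m A box by auto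
      then show ?thesis by (simp add: emeasure_density indicator_inter_arith[symmetric] Int_commute)
    qed
    have Ceq: "emeasure m1 ?C = emeasure m2 ?C" "emeasure m1 ?C \<noteq> \<infinity>"
      using eq[OF p e[OF p], of p] by auto
    have "?d m1 = ?d m2"
    proof (rule measure_eqI_generator_eq_countable[OF int, of UNIV _ _ B])
      show "emeasure (?d m1) X = emeasure (?d m2) X" if X: "X \<in> ?E" for X
      proof (cases "X = {}")
        case False
        then obtain c r where r: "r > 0" "X = {x. mabs (x - c) \<le> r}" using X by blast
        have XB: "X \<in> sets borel" using r box by simp
        have "X \<inter> ?C = {} \<or> X \<inter> ?C = X \<or> X \<inter> ?C = ?C"
        proof (cases "r \<le> e p")
          case True
          then show ?thesis using mbox_Int[OF True, of c p] r by auto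
        next
          case False
          then have "e p \<le> r" by simp
          then show ?thesis using mbox_Int[of "e p" r p c] r by (auto simp: Int_commute)
        qed
        then have "emeasure m1 (X \<inter> ?C) = emeasure m2 (X \<inter> ?C)"
        proof (elim disjE)
          assume X: "X \<inter> ?C = X"
          then have "X \<subseteq> ?C" by blast
          then have "emeasure m1 X = emeasure m2 X" using eq[OF p r(1), of c] unfolding r(2) by blast
          then show ?thesis unfolding X .
        next
          assume "X \<inter> ?C = ?C"
          then show ?thesis using Ceq(1) by metis
        qed simp
        then show ?thesis using d[OF s1 XB] d[OF s2 XB] by simp
      qed simp
      show "emeasure (?d m1) b \<noteq> \<infinity>" if "b \<in> B" for b
      proof -
        have bB: "b \<in> sets borel" by (rule borel_open[OF topological_basis_open[OF B(2) that]])
        have "emeasure (?d m1) b \<le> emeasure m1 ?C"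
          unfolding d[OF s1 bB] using s1 box by (intro emeasure_mono) auto
        then show ?thesis using Ceq(2) by (auto simp: top_unique)
      qed
      show "\<Union> B = UNIV"
      proof -
        have "\<exists>B'\<subseteq>B. \<Union>B' = UNIV" using B(2) unfolding topological_basis_def by auto
        then show ?thesis by blast
      qed
    qed (use s1 s2 gen BE B(1) in auto)
    then show ?thesis using d[OF s1 A] d[OF s2 A] by simp
  qed
  obtain C where C: "countable C" "C \<subseteq> Orb" "Orb \<subseteq> (\<Union>p\<in>C. {x. mabs (x - p) \<le> e p})"
    using countable_box_cover[of Orb e] e by blast
  define f where "f n = (if C = {} then {} else {x. mabs (x - from_nat_into C n) \<le> e (from_nat_into C n)})" for n
  have fC: "(\<Union>n. f n) = (\<Union>p\<in>C. {x. mabs (x - p) \<le> e p})"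
  proof (cases "C = {}")
    case False
    then have "(\<Union>n. f n) = (\<Union>p\<in>range (from_nat_into C). {x. mabs (x - p) \<le> e p})" by (auto simp: f_def)
    then show ?thesis using range_from_nat_into[OF False C(1)] by simp
  qed (simp add: f_def)
  have fb: "f n \<in> sets borel" for n using box by (simp add: f_def)
  have fl: "emeasure m1 (A \<inter> f n) = emeasure m2 (A \<inter> f n)" if "A \<in> sets borel" for A n
    using local[OF _ that, of "from_nat_into C n"] C(2) from_nat_into[of C n] by (auto simp: f_def)
  have dis: "emeasure m A = (\<Sum>n. emeasure m ((A \<inter> disjointed f n) \<inter> f n))"
    if m: "sets m = sets borel" and n: "emeasure m (- Orb) = 0" and A: "A \<in> sets borel" for m A
  proof -
    have db: "disjointed f n \<in> sets borel" for n using fb by (metis UNIV_I image_subset_iff sets.range_disjointed_sets)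
    have "emeasure m A = emeasure m (A \<inter> (\<Union>n. f n))"
    proof (rule emeasure_eq_AE)
      have "AE x in m. x \<in> Orb"
        by (rule AE_I[of _ _ "- Orb"]) (use m n Orb in auto)
      then show "AE x in m. x \<in> A \<longleftrightarrow> x \<in> A \<inter> (\<Union>n. f n)"
        using fC C(3) by (auto elim!: eventually_mono)
    qed (use m A fb in auto)
    also have "A \<inter> (\<Union>n. f n) = (\<Union>n. A \<inter> disjointed f n)"
      by (simp add: UN_disjointed_eq[symmetric, of f])
    also have "emeasure m \<dots> = (\<Sum>n. emeasure m (A \<inter> disjointed f n))"
      using disjoint_family_disjointed[of f] db A m
      by (intro suminf_emeasure[symmetric]) (auto simp: disjoint_family_on_def)
    also have "\<dots> = (\<Sum>n. emeasure m ((A \<inter> disjointed f n) \<inter> f n))"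
      using disjointed_subset[of f] by (intro suminf_cong arg_cong[of _ _ "emeasure m"]) auto
    finally show ?thesis .
  qed
  show "m1 = m2"
  proof (rule measure_eqI)
    show "sets m1 = sets m2" using s1 s2 by simp
    fix A assume "A \<in> sets m1"
    then have A: "A \<in> sets borel" using s1 by simp
    have db: "A \<inter> disjointed f n \<in> sets borel" for n
      using A fb by (metis UNIV_I image_subset_iff sets.range_disjointed_sets sets.Int)
    show "emeasure m1 A = emeasure m2 A"
      unfolding dis[OF s1 n1 A] dis[OF s2 n2 A] using fl[OF db] by simp
  qed
qed

lemma schwartz_indicator_mbox:
  assumes r: "r > 0"
  shows "schwartz (indicator {x. mabs (x - c) \<le> r} :: 'a^'n^'m \<Rightarrow> complex)"
proof (rule schwartzI[OF r])
  fix x t :: "'a^'n^'m" assume t: "mabs t \<le> r"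
  have "mabs (x + t - c) \<le> r \<longleftrightarrow> mabs (x - c) \<le> r"
    using mabs_add_le[OF _ t, of "x - c"] mabs_diff_le[OF _ t, of "x + t - c"]
    by (auto simp: algebra_simps)
  then show "indicator {x. mabs (x - c) \<le> r} (x + t) = (indicator {x. mabs (x - c) \<le> r} x :: complex)"
    by (simp add: indicator_def)
next
  fix x :: "'a^'n^'m" assume "indicator {x. mabs (x - c) \<le> r} x \<noteq> (0 :: complex)"
  then have "mabs (x - c) \<le> r" by (auto simp: indicator_def split: if_splits)
  then show "mabs x \<le> max r (mabs c)"
    using mabs_add_le[of "x - c" "max r (mabs c)" c] by auto
qed

text \<open>Adding a diagonal matrix of complementary rank to the diagonal form of \<open>A\<close>
  makes it invertible. Invertibility persists for nearby \<open>z\<close>, and subadditivity of the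
  rank turns it back into a lower bound for \<open>rank z\<close>.\<close>

lemma open_rank_ge: "open {z :: 'a^'n^'n. k \<le> rank z}"
proof (rule Topological_Spaces.openI)
  fix A :: "'a^'n^'n" assume A: "A \<in> {z. k \<le> rank z}"
  obtain P Q d where PQ: "transvec_prod P" "transvec_prod Q" "P ** A ** Q = diag_mat d"
    using diagonalize_by_transvec .
  have inv: "invertible P" "invertible Q" using PQ transvec_prod_invertible by auto
  define E :: "'a^'n^'n" where "E = diag_mat (\<lambda>i. of_bool (d i = 0))"
  have rE: "rank E + rank A = CARD('n)"
  proof -
    have "rank A = card {i. d i \<noteq> 0}" using rank_mult_invertible[OF inv, of A] PQ(3) rank_diag_mat by metis
    moreover have "rank E = card {i. d i = 0}"
      unfolding E_def rank_diag_mat by (rule arg_cong[of _ _ card]) auto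
    moreover have "card {i. d i = 0} + card {i. d i \<noteq> 0} = card ({i. d i = 0} \<union> {i. d i \<noteq> 0})"
      by (rule card_Un_disjoint[symmetric]) auto
    moreover have "{i. d i = 0} \<union> {i. d i \<noteq> 0} = UNIV" by auto
    ultimately show ?thesis by simp
  qed
  let ?U = "{z. det (P ** z ** Q - (- E)) \<noteq> 0}"
  have "open ?U"
    by (intro open_Collect_neq continuous_on_det continuous_on_diff_M continuous_on_matrix_mult
        continuous_on_const continuous_on_id)
  moreover have "A \<in> ?U"
  proof -
    have "P ** A ** Q - (- E) = diag_mat (\<lambda>i. if d i = 0 then 1 else d i)"
      unfolding PQ(3) E_def by (auto simp: diag_mat_def vec_eq_iff)
    then show ?thesis by (simp add: diag_mat_def det_diagonal)
  qed
  moreover have "?U \<subseteq> {z. k \<le> rank z}"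
  proof
    fix z assume "z \<in> ?U"
    then have "rank (P ** z ** Q + E) = CARD('n)" by (simp add: rank_invertible_iff invertible_det_nz)
    then have "CARD('n) \<le> rank z + rank E"
      using rank_add_le[of "P ** z ** Q" E] rank_mult_invertible[OF inv, of z] by simp
    then show "z \<in> {z. k \<le> rank z}" using rE A by simp
  qed
  ultimately show "\<exists>T. open T \<and> A \<in> T \<and> T \<subseteq> {z. k \<le> rank z}" by blast
qed

lemma rank_orbit_borel: "rank_orbit k \<in> sets (borel :: ('a^'n^'n) measure)"
proof -
  have "rank_orbit k = {z :: 'a^'n^'n. k \<le> rank z} - {z. Suc k \<le> rank z}"
    by (auto simp: rank_orbit_def)
  also have "\<dots> \<in> sets borel" by (intro sets.Diff borel_open open_rank_ge)
  finally show ?thesis .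
qed

text \<open>The orbit is locally closed: it is the open set of rank at least \<open>k\<close>
  without the open set of rank at least \<open>k + 1\<close>. A small box around a point of the
  orbit stays in the former, so its trace on the orbit is closed in the box.\<close>

lemma rank_orbit_locally_compact:
  assumes "p \<in> rank_orbit k"
  obtains e where "e > 0" "compact ({x. mabs (x - p) \<le> e} \<inter> (rank_orbit k :: ('a^'n^'n) set))"
proof -
  have "p \<in> {z. k \<le> rank z}" using assms by (simp add: rank_orbit_def)
  then obtain e where e: "e > 0" "{x. mabs (x - p) \<le> e} \<subseteq> {z. k \<le> rank z}"
    using mbox_subset_open[OF open_rank_ge] by metis
  have "{x. mabs (x - p) \<le> e} \<inter> rank_orbit k = {x. mabs (x - p) \<le> e} \<inter> (- {z. Suc k \<le> rank z})"
    using e(2) by (auto simp: rank_orbit_def)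
  moreover have "compact ({x. mabs (x - p) \<le> e} \<inter> (- {z. Suc k \<le> rank z}))"
    using compact_Int_closed[OF compact_mbox] open_rank_ge[of "Suc k"] by (metis closed_Compl)
  ultimately show ?thesis using that e(1) by metis
qed

text \<open>The defining property of \<open>orbit_measure\<close>, moved from test functions on the orbit to Borel sets.\<close>

definition orbit_scaling :: "nat \<Rightarrow> ('a^'n^'n) measure \<Rightarrow> bool" where
  "orbit_scaling k \<mu> \<longleftrightarrow> sets \<mu> = sets borel \<and> sigma_finite_measure \<mu> \<and>
     emeasure \<mu> (- rank_orbit k) = 0 \<and> emeasure \<mu> UNIV \<noteq> 0 \<and>
     (\<forall>g h A. invertible g \<longrightarrow> invertible h \<longrightarrow> A \<in> sets borel \<longrightarrow>
        emeasure \<mu> ((\<lambda>p. g ** p ** h) -` A) =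
        ennreal ((1 / absv (det g)) ^ k * (1 / absv (det h)) ^ k) * emeasure \<mu> A)"

lemma measurable_gph: "(\<lambda>p. g ** p ** h) \<in> (borel :: ('a^'n^'n) measure) \<rightarrow>\<^sub>M (borel :: ('a^'n^'n) measure)"
  by (intro borel_measurable_continuous_onI continuous_on_matrix_mult continuous_on_const continuous_on_id)

lemma vimage_gph:
  fixes A :: "('a^'n^'n) set"
  shows "A \<in> sets borel \<Longrightarrow> (\<lambda>p. g ** p ** h) -` A \<in> sets (borel :: ('a^'n^'n) measure)"
  using measurable_sets[OF measurable_gph[of g h], of A] by simp

text \<open>The trace of a small box on the orbit is compact and relatively open, so its indicator
  is an admissible test function. This gives the scaling of small boxes, and
  \<open>measure_eq_on_boxes\<close> extends it to all Borel sets.\<close>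

lemma orbit_measure_imp_scaling:
  fixes \<mu> :: "('a^'n^'n) measure"
  assumes om: "orbit_measure absv k \<mu>"
  shows "orbit_scaling k \<mu>"
proof -
  let ?O = "rank_orbit k :: ('a^'n^'n) set"
  have sets: "sets \<mu> = sets borel" and n: "emeasure \<mu> (- ?O) = 0" and nz: "emeasure \<mu> ?O \<noteq> 0"
    and K: "\<And>K. compact K \<Longrightarrow> K \<subseteq> ?O \<Longrightarrow> emeasure \<mu> K < \<infinity>"
    and T: "\<And>\<psi> g h. Cc_on ?O \<psi> \<Longrightarrow> invertible g \<Longrightarrow> invertible h \<Longrightarrow>
        integral\<^sup>L \<mu> (LR g h \<psi>) = complex_of_real (absv (det g) ^ k / absv (det h) ^ k) * integral\<^sup>L \<mu> \<psi>"
    using om unfolding orbit_measure_def by auto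
  have sp: "space \<mu> = UNIV" using sets_eq_imp_space_eq[OF sets] by simp
  have Ob': "?O \<in> sets borel" by (rule rank_orbit_borel)
  then have Ob: "?O \<in> sets \<mu>" using sets by simp
  have aeO: "AE x in \<mu>. x \<in> ?O"
    by (rule AE_I[of _ _ "- ?O"]) (use sets n Ob' in auto)
  have meas_O: "emeasure \<mu> A = emeasure \<mu> (A \<inter> ?O)" if "A \<in> sets borel" for A
    using aeO that Ob sets by (intro emeasure_eq_AE) auto
  have "\<forall>p\<in>?O. \<exists>e>0. compact ({x. mabs (x - p) \<le> e} \<inter> ?O)"
    using rank_orbit_locally_compact by metis
  then have "\<exists>e. \<forall>p\<in>?O. e p > 0 \<and> compact ({x. mabs (x - p) \<le> e p} \<inter> ?O)" by (intro bchoice) blast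
  then obtain e where e: "\<And>p. p \<in> ?O \<Longrightarrow> e p > 0" "\<And>p. p \<in> ?O \<Longrightarrow> compact ({x. mabs (x - p) \<le> e p} \<inter> ?O)"
    by blast
  have nzU: "emeasure \<mu> UNIV \<noteq> 0"
    using nz emeasure_mono[of ?O UNIV \<mu>] sets by auto
  obtain C where C: "countable C" "C \<subseteq> ?O" "?O \<subseteq> (\<Union>p\<in>C. {x. mabs (x - p) \<le> e p})"
    using countable_box_cover[of ?O e] e(1) by blast
  have sf: "sigma_finite_measure \<mu>"
  proof
    \<comment> \<open>Sigma-finiteness: countably many compact traces of boxes exhaust the orbit,
      and its complement is added as a set of measure 0.\<close>
    let ?A = "insert (- ?O) ((\<lambda>p. {x. mabs (x - p) \<le> e p} \<inter> ?O) ` C)"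
    have c1: "countable ?A" using C by simp
    have c2: "?A \<subseteq> sets \<mu>" unfolding sets
      using sets.Int[OF borel_closed[OF closed_mbox] Ob'] borel_comp[OF Ob'] by blast
    have c3: "\<Union> ?A = space \<mu>" using C(3) sp by auto
    have c4: "emeasure \<mu> a \<noteq> \<infinity>" if a: "a \<in> ?A" for a
    proof (cases "a = - ?O")
      case False
      then obtain p where p: "p \<in> C" "a = {x. mabs (x - p) \<le> e p} \<inter> ?O" using a by auto
      then have "emeasure \<mu> a < \<infinity>" using C(2) e(2) by (intro K) auto
      then show ?thesis by simp
    qed (simp add: n)
    show "\<exists>A. countable A \<and> A \<subseteq> sets \<mu> \<and> \<Union> A = space \<mu> \<and> (\<forall>a\<in>A. emeasure \<mu> a \<noteq> \<infinity>)"
      by (intro exI[of _ ?A] conjI ballI c1 c2 c3) (rule c4)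
  qed
  have tr: "emeasure \<mu> ((\<lambda>p. g ** p ** h) -` A) =
        ennreal ((1 / absv (det g)) ^ k * (1 / absv (det h)) ^ k) * emeasure \<mu> A"
    if g: "invertible g" and h: "invertible h" and A: "A \<in> sets borel" for g h A
  proof -
    let ?c = "(1 / absv (det g)) ^ k * (1 / absv (det h)) ^ k"
    let ?T = "\<lambda>p. g ** p ** h"
    let ?S = "\<lambda>p. matrix_inv g ** p ** matrix_inv h"
    have TS: "?T (?S p) = p" "?S (?T p) = p" for p
      using matrix_inv_mult[OF g] matrix_inv_mult[OF h]
      by (simp_all add: matrix_mul_assoc matrix_inv_cancel[OF g] matrix_inv_cancel[OF h])
    have TO: "?T p \<in> ?O \<longleftrightarrow> p \<in> ?O" for p
      using rank_mult_invertible[OF g h] by (simp add: rank_orbit_def)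
    have m: "?T \<in> \<mu> \<rightarrow>\<^sub>M borel" using measurable_gph by (simp add: measurable_cong_sets[OF sets refl])
    have vb: "?T -` A \<in> sets borel" if "A \<in> sets borel" for A by (rule vimage_gph[OF that])
    have d: "emeasure (distr \<mu> borel ?T) A = emeasure \<mu> (?T -` A)" if "A \<in> sets borel" for A
      using that m sp by (simp add: emeasure_distr)
    have "distr \<mu> borel ?T = scale_measure (ennreal ?c) \<mu>"
    proof (rule measure_eq_on_boxes[where Orb = ?O and e = e])
      have "?T -` (- ?O) = - ?O" using TO by auto
      then show "emeasure (distr \<mu> borel ?T) (- ?O) = 0" using d[of "- ?O"] Ob' n by auto
      fix p c r assume p: "p \<in> ?O" and r: "r > 0" and sub: "{x. mabs (x - c) \<le> r} \<subseteq> {x. mabs (x - p) \<le> e p}"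
      let ?B = "{x. mabs (x - c) \<le> r}"
      have Bb: "?B \<in> sets borel" by (intro borel_closed closed_mbox)
      have "?B \<inter> ?O = ?B \<inter> ({x. mabs (x - p) \<le> e p} \<inter> ?O)" using sub by blast
      moreover have "compact (?B \<inter> ({x. mabs (x - p) \<le> e p} \<inter> ?O))"
        by (intro closed_Int_compact closed_mbox e(2) p)
      ultimately have cB: "compact (?B \<inter> ?O)" by simp
      have "?T -` (?B \<inter> ?O) = ?S ` (?B \<inter> ?O)"
      proof (intro equalityI subsetI)
        fix x assume "x \<in> ?T -` (?B \<inter> ?O)"
        then have "?T x \<in> ?B \<inter> ?O" by (rule vimageD)
        then have "?S (?T x) \<in> ?S ` (?B \<inter> ?O)" by (rule imageI)
        then show "x \<in> ?S ` (?B \<inter> ?O)" unfolding TS .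
      next
        fix x assume "x \<in> ?S ` (?B \<inter> ?O)"
        then obtain q where "q \<in> ?B \<inter> ?O" "x = ?S q" by (rule imageE)
        then have "?T x \<in> ?B \<inter> ?O" by (simp only: TS)
        then show "x \<in> ?T -` (?B \<inter> ?O)" by (rule vimageI2)
      qed
      moreover have "compact (?S ` (?B \<inter> ?O))"
        by (intro compact_continuous_image cB continuous_on_matrix_mult continuous_on_const continuous_on_id)
      ultimately have cT: "compact (?T -` (?B \<inter> ?O))" by simp
      have TO': "?T -` (?B \<inter> ?O) \<subseteq> ?O" using TO by auto
      have f1: "emeasure \<mu> (?B \<inter> ?O) \<noteq> \<infinity>" using K[OF cB] by auto
      have f2: "emeasure \<mu> (?T -` (?B \<inter> ?O)) \<noteq> \<infinity>" using K[OF cT TO'] by auto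
      define \<psi> :: "'a^'n^'n \<Rightarrow> complex" where "\<psi> = indicator (?B \<inter> ?O)"
      have "continuous_on ?O \<psi>"
      proof -
        have "continuous_on UNIV (indicator ?B :: 'a^'n^'n \<Rightarrow> complex)"
          by (intro schwartz_continuous schwartz_indicator_mbox r)
        then have "continuous_on ?O (indicator ?B :: 'a^'n^'n \<Rightarrow> complex)" by (rule continuous_on_subset) auto
        then show ?thesis by (rule continuous_on_eq) (auto simp: \<psi>_def indicator_def)
      qed
      then have "Cc_on ?O \<psi>"
        unfolding Cc_on_def using cB by (intro conjI exI[of _ "?B \<inter> ?O"]) (auto simp: \<psi>_def indicator_def)
      \<comment> \<open>\<open>LR\<close> inverts its left argument, so the test is made with
        \<open>matrix_inv g\<close>. This turns the indicator into that of the preimage and the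
        factor \<open>absv (det g) ^ k\<close> into its reciprocal.\<close>
      from T[OF this matrix_inv_mult(3)[OF g] h]
      have "integral\<^sup>L \<mu> (LR (matrix_inv g) h \<psi>) = complex_of_real (absv (det (matrix_inv g)) ^ k / absv (det h) ^ k) * integral\<^sup>L \<mu> \<psi>" .
      moreover have "matrix_inv (matrix_inv g) = g"
      proof -
        have "matrix_inv (matrix_inv g) = matrix_inv (matrix_inv g) ** (matrix_inv g ** g)"
          using matrix_inv_mult[OF g] by simp
        also have "\<dots> = g" by (rule matrix_inv_cancel(2)[OF matrix_inv_mult(3)[OF g]])
        finally show ?thesis .
      qed
      then have "LR (matrix_inv g) h \<psi> = indicator (?T -` (?B \<inter> ?O))"
        by (auto simp: LR_def \<psi>_def indicator_def fun_eq_iff)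
      moreover have "integral\<^sup>L \<mu> (indicator (?T -` (?B \<inter> ?O)) :: _ \<Rightarrow> complex) = complex_of_real (measure \<mu> (?T -` (?B \<inter> ?O)))"
        by (rule integral_indicator_complex) (use vb[OF sets.Int[OF Bb Ob']] sets in blast)
      moreover have "integral\<^sup>L \<mu> \<psi> = complex_of_real (measure \<mu> (?B \<inter> ?O))"
        unfolding \<psi>_def by (rule integral_indicator_complex) (use sets.Int[OF Bb Ob'] sets in blast)
      moreover have "det (matrix_inv g) = inverse (det g)"
      proof -
        have "det (matrix_inv g) * det g = 1" using matrix_inv_mult(2)[OF g] by (metis det_mul det_I)
        then show ?thesis using g by (simp add: invertible_det_nz field_simps)
      qed
      ultimately have "complex_of_real (measure \<mu> (?T -` (?B \<inter> ?O))) = complex_of_real (?c * measure \<mu> (?B \<inter> ?O))"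
        by (simp add: abs_inverse power_inverse power_one_over divide_inverse)
      then have me: "measure \<mu> (?T -` (?B \<inter> ?O)) = ?c * measure \<mu> (?B \<inter> ?O)"
        using of_real_eq_iff by blast
      have "emeasure \<mu> (?T -` ?B) = emeasure \<mu> (?T -` (?B \<inter> ?O))"
      proof -
        have "?T -` ?B \<inter> ?O = ?T -` (?B \<inter> ?O)" using TO by auto
        then show ?thesis using meas_O[OF vb[OF Bb]] by simp
      qed
      also have "\<dots> = ennreal (measure \<mu> (?T -` (?B \<inter> ?O)))" using f2 by (simp add: emeasure_eq_ennreal_measure)
      also have "\<dots> = ennreal ?c * ennreal (measure \<mu> (?B \<inter> ?O))"
        unfolding me by (rule ennreal_mult) auto
      also have "\<dots> = ennreal ?c * emeasure \<mu> ?B"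
        using f1 meas_O[OF Bb] by (simp add: emeasure_eq_ennreal_measure)
      finally have "emeasure \<mu> (?T -` ?B) = ennreal ?c * emeasure \<mu> ?B" .
      moreover have "emeasure \<mu> ?B \<noteq> \<infinity>" using f1 meas_O[OF Bb] by simp
      ultimately show "emeasure (distr \<mu> borel ?T) ?B = emeasure (scale_measure (ennreal ?c) \<mu>) ?B \<and>
          emeasure (distr \<mu> borel ?T) ?B \<noteq> \<infinity>"
        using d[OF Bb] by (simp add: ennreal_mult_eq_top_iff)
    qed (use sets Ob' n e(1) in auto)
    then show ?thesis using d[OF A] by (metis emeasure_scale_measure)
  qed
  show ?thesis unfolding orbit_scaling_def using sets sf n nzU tr by blast
qed

end

lemma integral_scaled_action:
  fixes h :: "'b \<Rightarrow> complex"
  assumes f: "T \<in> M \<rightarrow>\<^sub>M M" and c: "c \<ge> 0"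
    and inv: "\<And>A. A \<in> sets M \<Longrightarrow> emeasure M (T -` A \<inter> space M) = ennreal c * emeasure M A"
    and h: "h \<in> borel_measurable M"
  shows "(\<integral> p. h (T p) \<partial>M) = complex_of_real c * (\<integral> p. h p \<partial>M)"
proof -
  have "distr M M T = density M (\<lambda>_. ennreal c)"
    by (rule measure_eqI) (auto simp: emeasure_distr[OF f] inv emeasure_density_const)
  then have "(\<integral> p. h p \<partial>distr M M T) = (\<integral> p. c *\<^sub>R h p \<partial>M)"
    using h c by (simp add: integral_density)
  then show ?thesis using f h by (simp add: integral_distr scaleR_conv_of_real)
qed

lemma integral_scale_measure:
  fixes h :: "'b \<Rightarrow> complex"
  assumes c: "c > 0" and h: "h \<in> borel_measurable M"
  shows "(\<integral> p. h p \<partial>scale_measure (ennreal c) M) = complex_of_real c * (\<integral> p. h p \<partial>M)"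
    and "integrable M h \<Longrightarrow> integrable (scale_measure (ennreal c) M) h"
proof -
  have eq: "scale_measure (ennreal c) M = density M (\<lambda>_. ennreal c)"
    by (rule measure_eqI) (auto simp: emeasure_density_const)
  show "(\<integral> p. h p \<partial>scale_measure (ennreal c) M) = complex_of_real c * (\<integral> p. h p \<partial>M)"
    unfolding eq using h c by (simp add: integral_density scaleR_conv_of_real)
  show "integrable M h \<Longrightarrow> integrable (scale_measure (ennreal c) M) h"
    unfolding eq using h c by (subst integrable_density) auto
qed

lemma poly_det: "poly (det A) t = det (\<chi> i j. poly (A $ i $ j) t)" for A :: "'a::field poly^'n^'n"
  by (simp add: det_def poly_sum poly_prod)

context local_field
begin

lemma orbit_scalingD:
  assumes "orbit_scaling k (\<mu> :: ('a^'n^'n) measure)"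
  shows "sets \<mu> = sets borel" "sigma_finite_measure \<mu>" "emeasure \<mu> (- rank_orbit k) = 0" "emeasure \<mu> UNIV \<noteq> 0"
    "\<And>g h A. invertible g \<Longrightarrow> invertible h \<Longrightarrow> A \<in> sets borel \<Longrightarrow>
        emeasure \<mu> ((\<lambda>p. g ** p ** h) -` A) =
        ennreal ((1 / absv (det g)) ^ k * (1 / absv (det h)) ^ k) * emeasure \<mu> A"
    "space \<mu> = UNIV"
proof -
  show 1: "sets \<mu> = sets borel" using assms unfolding orbit_scaling_def by blast
  show "space \<mu> = UNIV" using sets_eq_imp_space_eq[OF 1] by simp
qed (use assms in \<open>unfold orbit_scaling_def, blast+\<close>)

lemma open_invertible: "open {g :: 'a^'n^'n. det g \<noteq> 0}"
  by (intro open_Collect_neq continuous_on_det continuous_on_const continuous_on_id)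

end

section \<open>Uniqueness of measures on the rank orbits, and nullity of the singular
  matrices\<close>

context haar_matrix
begin

lemma measurable_M_left: "(\<lambda>z. g ** z) \<in> \<mu>M \<rightarrow>\<^sub>M \<mu>M"
  using measurable_gph[of g "mat 1"] by (simp add: measurable_cong_sets[OF M.sets_haar M.sets_haar])

lemma measurable_M_right: "(\<lambda>z. z ** g) \<in> \<mu>M \<rightarrow>\<^sub>M \<mu>M"
  using measurable_gph[of "mat 1" g] by (simp add: measurable_cong_sets[OF M.sets_haar M.sets_haar])

lemma nn_integral_M_left:
  assumes "invertible g" "f \<in> borel_measurable borel"
  shows "(\<integral>\<^sup>+ z. f (g ** z) \<partial>\<mu>M) = ennreal ((1 / absv (det g)) ^ CARD('n)) * (\<integral>\<^sup>+ z. f z \<partial>\<mu>M)"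
  by (rule nn_integral_scaled_action[OF measurable_M_left])
     (use assms in \<open>auto simp: emeasure_M_left measurable_cong_sets[OF M.sets_haar refl]\<close>)

lemma nn_integral_M_right:
  assumes "invertible g" "f \<in> borel_measurable borel"
  shows "(\<integral>\<^sup>+ z. f (z ** g) \<partial>\<mu>M) = ennreal ((1 / absv (det g)) ^ CARD('n)) * (\<integral>\<^sup>+ z. f z \<partial>\<mu>M)"
  by (rule nn_integral_scaled_action[OF measurable_M_right])
     (use assms in \<open>auto simp: emeasure_M_right measurable_cong_sets[OF M.sets_haar refl]\<close>)

lemma sets_MM [simp]: "sets (\<mu>M \<Otimes>\<^sub>M \<mu>M) = sets borel"
  using borel_prod_separable[OF separable_M separable_M] by (simp cong: sets_pair_measure_cong)

sublocale MM: pair_sigma_finite \<mu>M \<mu>M ..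

lemma emeasure_GL_pos: "emeasure \<mu>M {g. det g \<noteq> 0} \<noteq> 0"
proof -
  let ?V = "(\<lambda>x. mat 1 + x) -` {g :: 'a^'n^'n. det g \<noteq> 0}"
  have "open ?V"
    by (rule open_vimage[OF open_invertible]) (intro M.continuous_on_add_b continuous_on_const continuous_on_id)
  then have "emeasure \<mu>M ?V \<noteq> 0" by (rule M.emeasure_open_pos) simp
  then show ?thesis using M.emeasure_vimage_translate[OF borel_open[OF open_invertible]] by simp
qed

text \<open>Passing from \<open>p\<close> to \<open>p' = g0 ** p ** h0\<close> amounts to replacing
  \<open>(g, h)\<close> by \<open>(g ** g0, h0 ** h)\<close>. This multiplies additive Haar measure
  on pairs by a finite constant, so null sets are preserved.\<close>

lemma orbit_null_transfer:
  assumes p: "p \<in> rank_orbit k" "p' \<in> rank_orbit k" and A: "A \<in> sets borel"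
    and z: "emeasure (\<mu>M \<Otimes>\<^sub>M \<mu>M) {w. det (fst w) \<noteq> 0 \<and> det (snd w) \<noteq> 0 \<and> fst w ** p ** snd w \<in> A} = 0"
  shows "emeasure (\<mu>M \<Otimes>\<^sub>M \<mu>M) {w. det (fst w) \<noteq> 0 \<and> det (snd w) \<noteq> 0 \<and> fst w ** p' ** snd w \<in> A} = 0"
proof -
  let ?N = "\<lambda>p. {w :: ('a^'n^'n) \<times> ('a^'n^'n). det (fst w) \<noteq> 0 \<and> det (snd w) \<noteq> 0 \<and> fst w ** p ** snd w \<in> A}"
  obtain g0 h0 where gh: "invertible g0" "invertible h0" "p' = g0 ** p ** h0"
    using p rank_eq_imp_equiv[of p p'] unfolding rank_orbit_def by auto
  have N: "?N p \<in> sets borel" for p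
  proof -
    have "(\<lambda>w. fst w ** p ** snd w) \<in> borel \<rightarrow>\<^sub>M (borel :: ('a^'n^'n) measure)"
      by (intro borel_measurable_continuous_onI continuous_on_matrix_mult continuous_on_const continuous_on_fst continuous_on_snd continuous_on_id)
    from measurable_sets[OF this A] have "(\<lambda>w. fst w ** p ** snd w) -` A \<in> sets borel" by simp
    moreover have "open {w :: ('a^'n^'n) \<times> ('a^'n^'n). det (fst w) \<noteq> 0}" "open {w :: ('a^'n^'n) \<times> ('a^'n^'n). det (snd w) \<noteq> 0}"
      by (intro open_Collect_neq continuous_on_det continuous_on_const continuous_on_fst continuous_on_snd continuous_on_id)+
    ultimately have "{w. det (fst w) \<noteq> 0} \<inter> {w. det (snd w) \<noteq> 0} \<inter> (\<lambda>w. fst w ** p ** snd w) -` A \<in> sets borel"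
      using sets.Int[OF sets.Int[OF borel_open borel_open]] by blast
    moreover have "?N p = {w. det (fst w) \<noteq> 0} \<inter> {w. det (snd w) \<noteq> 0} \<inter> (\<lambda>w. fst w ** p ** snd w) -` A" by auto
    ultimately show ?thesis by simp
  qed
  have N': "?N p \<in> sets (\<mu>M \<Otimes>\<^sub>M \<mu>M)" for p using N[of p] unfolding sets_MM .
  define F :: "('a^'n^'n) \<times> ('a^'n^'n) \<Rightarrow> ennreal" where "F = indicator (?N p)"
  have F: "F \<in> borel_measurable (\<mu>M \<Otimes>\<^sub>M \<mu>M)" unfolding F_def by (rule borel_measurable_indicator[OF N'])
  have F2: "(\<lambda>h. F (g, h)) \<in> borel_measurable borel" for g
    using measurable_compose[OF measurable_Pair1' F, of g] by (simp add: measurable_cong_sets[OF M.sets_haar refl])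
  define \<phi> where "\<phi> g = (\<integral>\<^sup>+ h. F (g, h) \<partial>\<mu>M)" for g
  have "(\<lambda>g. \<integral>\<^sup>+ h. F (g, h) \<partial>\<mu>M) \<in> borel_measurable \<mu>M"
    using F by (intro M.borel_measurable_nn_integral) simp
  then have \<phi>: "\<phi> \<in> borel_measurable borel" unfolding \<phi>_def by (simp add: measurable_cong_sets[OF M.sets_haar refl])
  have "emeasure (\<mu>M \<Otimes>\<^sub>M \<mu>M) (?N p') = (\<integral>\<^sup>+ w. indicator (?N p') w \<partial>(\<mu>M \<Otimes>\<^sub>M \<mu>M))"
    by (rule nn_integral_indicator[OF N', symmetric])
  also have "\<dots> = (\<integral>\<^sup>+ g. \<integral>\<^sup>+ h. indicator (?N p') (g, h) \<partial>\<mu>M \<partial>\<mu>M)"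
    by (rule M.nn_integral_fst[OF borel_measurable_indicator[OF N'], symmetric])
  also have "\<dots> = (\<integral>\<^sup>+ g. \<integral>\<^sup>+ h. F (g ** g0, h0 ** h) \<partial>\<mu>M \<partial>\<mu>M)"
  proof (intro nn_integral_cong)
    fix g h
    show "indicator (?N p') (g, h) = F (g ** g0, h0 ** h)"
      using gh(1,2) unfolding F_def gh(3) indicator_def by (simp add: det_mul invertible_det_nz matrix_mul_assoc)
  qed
  also have "\<dots> = (\<integral>\<^sup>+ g. ennreal ((1 / absv (det h0)) ^ CARD('n)) * \<phi> (g ** g0) \<partial>\<mu>M)"
    unfolding \<phi>_def nn_integral_M_left[OF gh(2) F2] ..
  also have "\<dots> = ennreal ((1 / absv (det h0)) ^ CARD('n)) * (\<integral>\<^sup>+ g. \<phi> (g ** g0) \<partial>\<mu>M)"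
    using measurable_compose[OF measurable_M_right] \<phi>
    by (intro nn_integral_cmult) (simp add: measurable_cong_sets[OF M.sets_haar refl])
  also have "(\<integral>\<^sup>+ g. \<phi> (g ** g0) \<partial>\<mu>M) = ennreal ((1 / absv (det g0)) ^ CARD('n)) * (\<integral>\<^sup>+ g. \<phi> g \<partial>\<mu>M)"
    by (rule nn_integral_M_right[OF gh(1) \<phi>])
  also have "(\<integral>\<^sup>+ g. \<phi> g \<partial>\<mu>M) = (\<integral>\<^sup>+ w. F w \<partial>(\<mu>M \<Otimes>\<^sub>M \<mu>M))"
    unfolding \<phi>_def by (rule M.nn_integral_fst[OF F])
  also have "\<dots> = 0" unfolding F_def nn_integral_indicator[OF N'] by (rule z)
  finally show ?thesis by simp
qed

theorem orbit_scaling_unique: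
  assumes m: "orbit_scaling k \<mu>" and l: "orbit_scaling k (\<nu> :: ('a^'n^'n) measure)"
  shows "\<exists>c::real. c > 0 \<and> \<nu> = scale_measure (ennreal c) \<mu>"
proof -
  note m = orbit_scalingD[OF m] and l = orbit_scalingD[OF l]
  let ?GL = "{g :: 'a^'n^'n. det g \<noteq> 0}"
  let ?G2 = "{w :: ('a^'n^'n) \<times> ('a^'n^'n). det (fst w) \<noteq> 0 \<and> det (snd w) \<noteq> 0}"
  \<comment> \<open>Additive Haar measure on the invertible pairs. It is not invariant under the
    group, but its null sets are, as recorded in \<open>orbit_null_transfer\<close>.\<close>
  define G where "G = restrict_space (\<mu>M \<Otimes>\<^sub>M \<mu>M) ?G2"
  have G2e: "?G2 = ?GL \<times> ?GL" by auto
  have GL: "?GL \<in> sets \<mu>M" using borel_open[OF open_invertible] M.sets_haar by blast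
  have G2: "?G2 \<in> sets (\<mu>M \<Otimes>\<^sub>M \<mu>M)" unfolding G2e by (intro pair_measureI GL)
  have spG: "space G = ?G2" by (simp add: G_def space_restrict_space space_pair_measure)
  have eG: "emeasure G A = emeasure (\<mu>M \<Otimes>\<^sub>M \<mu>M) A" if "A \<subseteq> ?G2" for A
    unfolding G_def using G2 that by (intro emeasure_restrict_space) (auto simp: space_pair_measure)
  let ?act = "\<lambda>w p. fst w ** p ** snd w :: 'a^'n^'n"
  let ?\<delta> = "\<lambda>w. (1 / absv (det (fst w))) ^ k * (1 / absv (det (snd w))) ^ k"
  interpret R: relatively_invariant G \<mu> \<nu> ?act ?\<delta> "rank_orbit k"
  proof (rule relatively_invariant.intro)
    show "sigma_finite_measure G"
      unfolding G_def by (intro sigma_finite_measure_restrict_space G2) (rule MM.sigma_finite_measure_axioms)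
    show "emeasure G (space G) \<noteq> 0"
      unfolding spG eG[OF subset_refl] unfolding G2e
      using GL emeasure_GL_pos by (simp add: M.emeasure_pair_measure_Times)
    show "(\<lambda>(g, p). ?act g p) \<in> G \<Otimes>\<^sub>M \<mu> \<rightarrow>\<^sub>M \<mu>"
    proof -
      have "(\<lambda>q. fst (fst q) ** snd q ** snd (fst q)) \<in>
          (borel :: ((('a^'n^'n) \<times> ('a^'n^'n)) \<times> ('a^'n^'n)) measure) \<rightarrow>\<^sub>M (borel :: ('a^'n^'n) measure)"
        by (intro borel_measurable_continuous_onI continuous_on_matrix_mult continuous_on_const continuous_on_fst continuous_on_snd continuous_on_id)
      moreover have "sets ((\<mu>M \<Otimes>\<^sub>M \<mu>M) \<Otimes>\<^sub>M \<mu>) = sets (borel :: ((('a^'n^'n) \<times> ('a^'n^'n)) \<times> ('a^'n^'n)) measure)"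
        using sets_pair_measure_cong[OF sets_MM m(1)]
          borel_prod_separable[OF separable_metric_prod[OF separable_M separable_M] separable_M] by (rule trans)
      ultimately have "(\<lambda>q. fst (fst q) ** snd q ** snd (fst q)) \<in> (\<mu>M \<Otimes>\<^sub>M \<mu>M) \<Otimes>\<^sub>M \<mu> \<rightarrow>\<^sub>M \<mu>"
        by (subst measurable_cong_sets[OF _ m(1)])
      moreover have "(\<lambda>q. (fst q, snd q)) \<in> G \<Otimes>\<^sub>M \<mu> \<rightarrow>\<^sub>M (\<mu>M \<Otimes>\<^sub>M \<mu>M) \<Otimes>\<^sub>M \<mu>"
        unfolding G_def
        by (intro measurable_Pair measurable_snd measurable_compose[OF measurable_fst] measurable_restrict_space1 measurable_ident)
           (simp add: measurable_restrict_space1)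
      ultimately have "(\<lambda>q. fst (fst (fst q, snd q)) ** snd (fst q, snd q) ** snd (fst (fst q, snd q))) \<in> G \<Otimes>\<^sub>M \<mu> \<rightarrow>\<^sub>M \<mu>"
        by (rule measurable_compose[rotated])
      then show ?thesis by (simp add: case_prod_beta')
    qed
    show "\<exists>g'\<in>space G. \<forall>p\<in>space \<mu>. ?act g' (?act g p) = p" if "g \<in> space G" for g
    proof -
      have i: "invertible (fst g)" "invertible (snd g)" using that spG by (auto simp: invertible_det_nz)
      then have "(matrix_inv (fst g), matrix_inv (snd g)) \<in> space G"
        unfolding spG using matrix_inv_mult(3) by (auto simp: invertible_det_nz)
      moreover have "?act (matrix_inv (fst g), matrix_inv (snd g)) (?act g p) = p" for p
        using matrix_inv_mult[OF i(1)] matrix_inv_mult[OF i(2)]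
        by (simp add: matrix_mul_assoc matrix_inv_cancel[OF i(2)])
      ultimately show ?thesis by blast
    qed
    show "?\<delta> g > 0" if "g \<in> space G" for g using that spG by auto
    show "?\<delta> \<in> borel_measurable G"
    proof -
      have "(\<lambda>g::'a^'n^'n. absv (det g)) \<in> borel_measurable \<mu>M"
        unfolding measurable_cong_sets[OF M.sets_haar refl]
        by (intro borel_measurable_continuous_onI continuous_on_abs continuous_on_det continuous_on_id)
      from measurable_compose[OF measurable_fst this] measurable_compose[OF measurable_snd this]
      have "?\<delta> \<in> borel_measurable (\<mu>M \<Otimes>\<^sub>M \<mu>M)" by measurable
      then show ?thesis unfolding G_def by (rule measurable_restrict_space1)
    qed
    show "emeasure \<mu> (?act g -` A \<inter> space \<mu>) = ennreal (?\<delta> g) * emeasure \<mu> A" if "g \<in> space G" "A \<in> sets \<mu>" for g A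
      using that m(1,6) spG m(5)[of "fst g" "snd g" A] by (simp add: invertible_det_nz)
    show "emeasure \<nu> (?act g -` A \<inter> space \<mu>) = ennreal (?\<delta> g) * emeasure \<nu> A" if "g \<in> space G" "A \<in> sets \<mu>" for g A
      using that m(1,6) l(1,6) spG l(5)[of "fst g" "snd g" A] by (simp add: invertible_det_nz)
    have O: "- rank_orbit k \<in> sets (borel :: ('a^'n^'n) measure)" using rank_orbit_borel by (rule borel_comp)
    show "AE p in \<mu>. p \<in> rank_orbit k" by (rule AE_I[of _ _ "- rank_orbit k"]) (use m(1,3) O in auto)
    show "AE p in \<nu>. p \<in> rank_orbit k" by (rule AE_I[of _ _ "- rank_orbit k"]) (use l(1,3) O in auto)
    show "emeasure G {g \<in> space G. ?act g p' \<in> A} = 0"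
      if p: "p \<in> rank_orbit k" "p' \<in> rank_orbit k" "A \<in> sets \<mu>" "emeasure G {g \<in> space G. ?act g p \<in> A} = 0" for p p' A
    proof -
      have e: "{g \<in> space G. ?act g q \<in> A} = {w. det (fst w) \<noteq> 0 \<and> det (snd w) \<noteq> 0 \<and> fst w ** q ** snd w \<in> A}" for q
        unfolding spG by auto
      have e2: "emeasure G {w. det (fst w) \<noteq> 0 \<and> det (snd w) \<noteq> 0 \<and> fst w ** q ** snd w \<in> A}
         = emeasure (\<mu>M \<Otimes>\<^sub>M \<mu>M) {w. det (fst w) \<noteq> 0 \<and> det (snd w) \<noteq> 0 \<and> fst w ** q ** snd w \<in> A}" for q
        by (rule eG) auto
      show ?thesis using p(4) unfolding e e2 using orbit_null_transfer[OF p(1,2)] p(3) m(1) by simp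
    qed
  qed (use m l in auto)
  show ?thesis by (rule R.proportional)
qed

text \<open>The point 0 lies in balls of arbitrarily small volume, and translation carries this to
  every point.\<close>

lemma emeasure_F_finite_set:
  assumes "finite S" shows "emeasure \<mu>F S = 0"
proof -
  have z: "emeasure \<mu>F {0} = 0"
  proof (rule ccontr)
    assume "emeasure \<mu>F {0} \<noteq> 0"
    moreover have "emeasure \<mu>F {0} \<le> emeasure \<mu>F {x. absv x \<le> 1}"
      by (rule emeasure_mono) (use F.open_U in auto)
    ultimately obtain e where e: "e > 0" "emeasure \<mu>F {0} = ennreal e"
      by (cases "emeasure \<mu>F {0}") (auto simp: less_le top_unique)
    obtain c where c: "c \<noteq> 0" "absv c < e" using ex_abs_less[OF e(1)] .
    have "emeasure \<mu>F {0} \<le> emeasure \<mu>F {x. absv x \<le> absv c}"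
      by (rule emeasure_mono) (use closed_abs_ball[of 0] in auto)
    then have "ennreal e \<le> ennreal (absv c)" using e(2) emeasure_F_ball[OF c(1)] by simp
    then show False using c(2) by (simp add: ennreal_le_iff)
  qed
  have "emeasure \<mu>F {x} = 0" for x
    using F.emeasure_translate[of "{0}" x] z by simp
  then have "(\<Union>x\<in>S. {x}) \<in> null_sets \<mu>F"
    using assms by (intro null_sets_UN' countable_finite) (auto simp: null_sets_def)
  then show ?thesis by (simp add: null_sets_def)
qed

text \<open>The determinant along the line is a polynomial in \<open>t\<close>. It is not the zero
  polynomial: for \<open>absv t\<close> large compared with \<open>mabs z\<close>, the matrix
  \<open>z + mat t\<close> is \<open>t\<close> times a matrix close to the identity, hence
  invertible.\<close>

lemma finite_singular_translates: "finite {t. det ((z :: 'a^'n^'n) + mat t) = 0}"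
proof -
  define P :: "'a poly^'n^'n" where "P = (\<chi> i j. if i = j then [:z $ i $ j, 1:] else [:z $ i $ j:])"
  have P: "poly (det P) t = det (z + mat t)" for t
    unfolding poly_det by (rule arg_cong[of _ _ det]) (auto simp: P_def vec_eq_iff mat_def)
  obtain r where r: "r > 0" "{x. mabs (x - mat 1) \<le> r} \<subseteq> {g :: 'a^'n^'n. det g \<noteq> 0}"
    using mbox_subset_open[OF open_invertible, of "mat 1"] by auto
  obtain t where t: "absv t > mabs z / r" "absv t > 1" using ex_abs_gt .
  then have t0: "t \<noteq> 0" by auto
  define y :: "'a^'n^'n" where "y = mat 1 + mat (inverse t) ** z"
  have "mabs (y - mat 1) \<le> r"
    unfolding mabs_le_iff
  proof safe
    fix i j
    have "(mat (inverse t) ** z) $ i $ j = inverse t * z $ i $ j"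
      using diag_mat_mult_entry[of "\<lambda>_. inverse t" z i j] by (simp add: mat_def diag_mat_def)
    then have "absv ((y - mat 1) $ i $ j) = absv (z $ i $ j) / absv t"
      by (simp add: y_def abs_mult abs_inverse divide_inverse mult.commute)
    also have "\<dots> \<le> mabs z / absv t" using t by (intro divide_right_mono abs_le_mabs) auto
    also have "\<dots> \<le> r" using t r(1) t0 by (simp add: divide_less_eq divide_le_eq mult.commute less_imp_le)
    finally show "absv ((y - mat 1) $ i $ j) \<le> r" .
  qed
  then have "det y \<noteq> 0" using r(2) by blast
  moreover have "z + mat t = mat t ** y"
  proof -
    have "mat t ** (mat (inverse t) ** z) = z"
      using diag_mat_mult_entry[of "\<lambda>_. t" "mat (inverse t) ** z"] diag_mat_mult_entry[of "\<lambda>_. inverse t" z] t0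
      by (simp add: vec_eq_iff mat_def diag_mat_def)
    then show ?thesis unfolding y_def matrix_add_ldistrib by (simp add: add.commute)
  qed
  ultimately have "det (z + mat t) \<noteq> 0" using t0 by (simp add: det_mul det_mat)
  then have "det P \<noteq> 0" using P[of t] by auto
  then have "finite {t. poly (det P) t = 0}" by (rule poly_roots_finite)
  then show ?thesis unfolding P .
qed

text \<open>Each line through \<open>z\<close> in the direction of the identity meets the singular matrices in finitely
  many points, so translation invariance and Fubini show that they form a null set.\<close>

lemma emeasure_singular: "emeasure \<mu>M {z. det z = 0} = 0"
proof -
  interpret FM: pair_sigma_finite \<mu>F \<mu>M ..
  let ?N = "{z :: 'a^'n^'n. det z = 0}"
  have N: "?N \<in> sets borel"
    by (intro borel_closed closed_Collect_eq continuous_on_det continuous_on_const continuous_on_id)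
  have sFM: "sets (\<mu>F \<Otimes>\<^sub>M \<mu>M) = sets (borel :: ('a \<times> ('a^'n^'n)) measure)"
    using borel_prod_separable[OF separable_F separable_M] by (simp cong: sets_pair_measure_cong)
  have cm: "continuous_on UNIV (\<lambda>t. mat t :: 'a^'n^'n)"
  proof (unfold continuous_on_vec_iff, intro allI)
    show "continuous_on UNIV (\<lambda>t::'a. (mat t :: 'a^'n^'n) $ i $ j)" for i j
      by (cases "i = j") (auto simp: mat_def intro: continuous_on_id)
  qed
  have "(\<lambda>p. mat (fst p) + snd p :: 'a^'n^'n) \<in> borel_measurable borel"
    by (intro borel_measurable_continuous_onI M.continuous_on_add_b continuous_on_compose2[OF cm] continuous_on_fst continuous_on_snd continuous_on_id) auto
  from measurable_sets[OF this N] have S: "(\<lambda>p. mat (fst p) + snd p) -` ?N \<in> sets (\<mu>F \<Otimes>\<^sub>M \<mu>M)" using sFM by simp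
  have T: "fst -` {t. absv t \<le> 1} \<inter> space (\<mu>F \<Otimes>\<^sub>M \<mu>M) \<in> sets (\<mu>F \<Otimes>\<^sub>M \<mu>M)"
    by (rule measurable_sets[OF measurable_fst]) (use F.open_U in simp)
  define B :: "('a \<times> ('a^'n^'n)) set" where "B = {p. absv (fst p) \<le> 1 \<and> det (mat (fst p) + snd p) = 0}"
  have "B = (fst -` {t. absv t \<le> 1} \<inter> space (\<mu>F \<Otimes>\<^sub>M \<mu>M)) \<inter> ((\<lambda>p. mat (fst p) + snd p) -` ?N)"
    by (auto simp: B_def space_pair_measure)
  then have B: "B \<in> sets (\<mu>F \<Otimes>\<^sub>M \<mu>M)" using S T by simp
  have Bm: "(\<lambda>(t, z). indicator B (t, z) :: ennreal) \<in> borel_measurable (\<mu>F \<Otimes>\<^sub>M \<mu>M)"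
    using B by (simp add: case_prod_beta')
  \<comment> \<open>The ball \<open>absv t \<le> 1\<close> has volume 1, so averaging the equal
    volumes of the translates of \<open>?N\<close> over it returns the volume of
    \<open>?N\<close>.\<close>
  have "emeasure \<mu>M ?N = (\<integral>\<^sup>+ t. indicator {t. absv t \<le> 1} t * emeasure \<mu>M ?N \<partial>\<mu>F)"
    using F.open_U by (subst nn_integral_multc) auto
  also have "\<dots> = (\<integral>\<^sup>+ t. \<integral>\<^sup>+ z. indicator B (t, z) \<partial>\<mu>M \<partial>\<mu>F)"
  proof (rule nn_integral_cong)
    fix t
    have v: "(\<lambda>z. mat t + z) -` ?N \<in> sets borel"
    proof -
      have "(\<lambda>z. mat t + z :: 'a^'n^'n) \<in> borel_measurable borel"
        by (intro borel_measurable_continuous_onI M.continuous_on_add_b continuous_on_const continuous_on_id)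
      from measurable_sets[OF this N] show ?thesis by simp
    qed
    have "(\<integral>\<^sup>+ z. indicator B (t, z) \<partial>\<mu>M) = (\<integral>\<^sup>+ z. indicator {t. absv t \<le> 1} t * indicator ((\<lambda>z. mat t + z) -` ?N) z \<partial>\<mu>M)"
      by (intro nn_integral_cong) (auto simp: B_def indicator_def)
    also have "\<dots> = indicator {t. absv t \<le> 1} t * emeasure \<mu>M ((\<lambda>z. mat t + z) -` ?N)"
      using v by (simp add: nn_integral_cmult)
    also have "emeasure \<mu>M ((\<lambda>z. mat t + z) -` ?N) = emeasure \<mu>M ?N"
      by (rule M.emeasure_vimage_translate[OF N])
    finally show "indicator {t. absv t \<le> 1} t * emeasure \<mu>M ?N = (\<integral>\<^sup>+ z. indicator B (t, z) \<partial>\<mu>M)" by simp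
  qed
  also have "\<dots> = (\<integral>\<^sup>+ z. \<integral>\<^sup>+ t. indicator B (t, z) \<partial>\<mu>F \<partial>\<mu>M)"
    using FM.Fubini[OF Bm] by simp
  also have "\<dots> = (\<integral>\<^sup>+ z. 0 \<partial>\<mu>M)"
  proof (rule nn_integral_cong)
    fix z :: "'a^'n^'n"
    let ?S = "{t. absv t \<le> 1 \<and> det (z + mat t) = 0}"
    have fin: "finite ?S" by (rule finite_subset[OF _ finite_singular_translates[of z]]) auto
    then have "?S \<in> sets borel" by (intro borel_closed finite_imp_closed)
    moreover have "(\<integral>\<^sup>+ t. indicator B (t, z) \<partial>\<mu>F) = (\<integral>\<^sup>+ t. indicator ?S t \<partial>\<mu>F)"
      by (intro nn_integral_cong) (auto simp: B_def indicator_def add.commute)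
    ultimately show "(\<integral>\<^sup>+ t. indicator B (t, z) \<partial>\<mu>F) = 0"
      using emeasure_F_finite_set[OF fin] by simp
  qed
  finally show ?thesis by simp
qed

end

lemma integral_distr_density_bool:
  fixes f :: "'c \<Rightarrow> complex"
  assumes P: "{w \<in> space M. P w} \<in> sets M" and T: "T \<in> M \<rightarrow>\<^sub>M N" and f: "f \<in> borel_measurable N"
  shows "(\<integral> p. f p \<partial>distr (density M (\<lambda>w. of_bool (P w))) N T) = (\<integral> w. of_bool (P w) * f (T w) \<partial>M)"
    and "integrable (distr (density M (\<lambda>w. of_bool (P w))) N T) f \<longleftrightarrow> integrable M (\<lambda>w. of_bool (P w) * f (T w))"
proof -
  have eq: "(\<lambda>w. of_bool (P w) :: ennreal) = (\<lambda>w. ennreal (of_bool (P w)))" by auto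
  have m: "(\<lambda>w. of_bool (P w) :: real) \<in> borel_measurable M" using P by measurable
  have fT: "(\<lambda>w. f (T w)) \<in> borel_measurable M" using T f by measurable
  have sc: "(\<lambda>w. of_bool (P w) *\<^sub>R f (T w)) = (\<lambda>w. of_bool (P w) * f (T w))"
    by (auto simp: fun_eq_iff)
  show "(\<integral> p. f p \<partial>distr (density M (\<lambda>w. of_bool (P w))) N T) = (\<integral> w. of_bool (P w) * f (T w) \<partial>M)"
    unfolding eq using T f m fT by (simp add: integral_distr integral_density sc)
  show "integrable (distr (density M (\<lambda>w. of_bool (P w))) N T) f \<longleftrightarrow> integrable M (\<lambda>w. of_bool (P w) * f (T w))"
    unfolding eq using T f m fT by (simp add: integrable_distr_eq integrable_density sc)
qed

lemma nn_integral_distr_density_bool: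
  assumes P: "{w \<in> space M. P w} \<in> sets M" and T: "T \<in> M \<rightarrow>\<^sub>M N" and f: "f \<in> borel_measurable N"
  shows "(\<integral>\<^sup>+ p. f p \<partial>distr (density M (\<lambda>w. of_bool (P w))) N T) = (\<integral>\<^sup>+ w. of_bool (P w) * f (T w) \<partial>M)"
proof -
  have m: "(\<lambda>w. of_bool (P w) :: ennreal) \<in> borel_measurable M" using P by measurable
  have fT: "(\<lambda>w. f (T w)) \<in> borel_measurable M" using T f by measurable
  show ?thesis using T f m fT by (simp add: nn_integral_distr nn_integral_density)
qed

lemma vm_mult: "y v* (A ** B) = (y v* A) v* (B :: 'a::field^'n^'n)"
  by (metis matrix_transpose_mul matrix_vector_mul_assoc transpose_matrix_vector)

lemma vm_outer: "y v* outer u w = rowcol y u *s w"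
  by (simp add: vec_eq_iff vector_matrix_mult_def outer_def rowcol_def sum_distrib_left mult_ac)

lemma outer_mult_right: "outer u y ** z = outer u (y v* z)"
  by (simp add: vec_eq_iff matrix_mult_entry outer_def vector_matrix_mult_def sum_distrib_left mult_ac)

lemma trace_outer_mult: "trace (outer x y ** z) = rowcol (y v* z) x"
  unfolding outer_mult_right by (simp add: trace_def outer_def rowcol_def mult.commute)

lemma vm_diff: "y v* (A - B) = y v* A - y v* (B :: 'a::field^'n^'n)"
  by (simp add: vec_eq_iff vector_matrix_mult_def sum_subtractf algebra_simps)

lemma vm_add: "y v* (A + B) = y v* A + y v* (B :: 'a::field^'n^'n)"
  by (simp add: vec_eq_iff vector_matrix_mult_def sum.distrib algebra_simps)

lemma matrix_diff_mult: "(A - B) ** C = A ** C - B ** (C :: 'a::field^'n^'n)"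
  by (simp add: vec_eq_iff matrix_mult_entry sum_subtractf algebra_simps)

lemma rowcol_scale: "rowcol y (a *s u) = a * rowcol y u"
  by (simp add: rowcol_def sum_distrib_left mult_ac)

lemma trace_mult_add: "trace ((w + s) ** y) = trace (w ** y) + trace (s ** (y :: 'a::field^'n^'n))"
  by (simp add: trace_def matrix_mult_entry distrib_right sum.distrib)

context local_field
begin

lemma mabs_outer_le: "mabs (outer x y) \<le> vabs x * vabs y"
  unfolding mabs_le_iff by (auto simp: outer_def abs_mult intro!: mult_mono abs_le_vabs)

lemma mabs_outer: "mabs (outer x y) = vabs x * vabs y"
proof (rule antisym[OF mabs_outer_le])
  obtain i j where "vabs x = absv (x $ i)" "vabs y = absv (y $ j)" using vabs_attained by metis
  then have "vabs x * vabs y = absv (outer x y $ i $ j)" by (simp add: outer_def abs_mult)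
  then show "vabs x * vabs y \<le> mabs (outer x y)" using abs_le_mabs by metis
qed

lemma abs_trace_mult_le: "absv (trace (w ** y)) \<le> mabs w * mabs (y :: 'a^'n^'n)"
  unfolding trace_def matrix_mult_entry
  by (intro abs_sum_le) (auto intro!: abs_sum_le mult_mono abs_le_mabs simp: abs_mult)

lemma continuous_on_trace:
  fixes f :: "'b::topological_space \<Rightarrow> 'a^'n^'n"
  shows "continuous_on S f \<Longrightarrow> continuous_on S (\<lambda>x. trace (f x))"
  unfolding trace_def continuous_on_vec_iff by (auto intro!: continuous_on_sum_F)

lemma continuous_on_vm:
  fixes f :: "'b::topological_space \<Rightarrow> 'a^'n" and g :: "'b \<Rightarrow> 'a^'n^'n"
  shows "continuous_on S f \<Longrightarrow> continuous_on S g \<Longrightarrow> continuous_on S (\<lambda>x. f x v* g x)"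
  unfolding continuous_on_vec_iff vector_matrix_mult_def
  by (auto intro!: continuous_on_sum_F continuous_on_mult_F)

text \<open>Finiteness on boxes of the full matrix space, including points outside the orbit, is
  what allows an orbit measure to be extended by zero to a distribution.\<close>

lemma schwartz_integrable:
  fixes \<psi> :: "'a^'n^'n \<Rightarrow> complex"
  assumes \<psi>: "schwartz \<psi>" and sets: "sets \<mu> = sets borel" and fin: "\<And>R. emeasure \<mu> {z. mabs z \<le> R} < \<infinity>"
  shows "integrable \<mu> \<psi>"
proof -
  obtain B R where BR: "B > 0" "R > 0" "\<And>x. cmod (\<psi> x) \<le> B" "\<And>x. \<psi> x \<noteq> 0 \<Longrightarrow> mabs x \<le> R"
    using schwartz_bounds[OF \<psi>] by blast
  have "\<psi> \<in> borel_measurable \<mu>"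
    unfolding measurable_cong_sets[OF sets refl]
    by (rule borel_measurable_continuous_onI[OF schwartz_continuous[OF \<psi>]])
  moreover have "{z. mabs z \<le> R} \<in> sets \<mu>" unfolding sets using closed_mbox[of "0 :: 'a^'n^'n" R] by simp
  ultimately show ?thesis
    using BR fin by (intro integrableI_bounded_set[of "{z. mabs z \<le> R}" _ _ B]) (auto intro!: AE_I2)
qed

lemma schwartz_gph:
  fixes \<psi> :: "'a^'n^'n \<Rightarrow> complex" and g h :: "'a^'n^'n"
  assumes \<psi>: "schwartz \<psi>" and g: "invertible g" and h: "invertible h"
  shows "schwartz (\<lambda>p. \<psi> (g ** p ** h))"
proof -
  obtain r where r: "r > 0" "\<And>x t. mabs t \<le> r \<Longrightarrow> \<psi> (x + t) = \<psi> x" using schwartz_uniform[OF \<psi>] by blast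
  obtain B R where "B > 0" and BR: "R > 0" "\<And>x. cmod (\<psi> x) \<le> B" "\<And>x. \<psi> x \<noteq> 0 \<Longrightarrow> mabs x \<le> R"
    using schwartz_bounds[OF \<psi>] by blast
  let ?c = "mabs g * mabs h + 1"
  have c: "?c > 0" by (intro add_nonneg_pos mult_nonneg_nonneg) auto
  show ?thesis
  proof (rule schwartzI[of "r / ?c"])
    fix x t :: "'a^'n^'n" assume t: "mabs t \<le> r / ?c"
    have "mabs (g ** t ** h) \<le> mabs (g ** t) * mabs h" by (rule mabs_mult_le)
    also have "\<dots> \<le> (mabs g * mabs t) * mabs h" by (intro mult_right_mono mabs_mult_le) auto
    also have "\<dots> \<le> mabs t * ?c" by (simp add: algebra_simps)
    also have "\<dots> \<le> r" using t c by (simp add: pos_le_divide_eq)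
    finally have "\<psi> (g ** x ** h + g ** t ** h) = \<psi> (g ** x ** h)" by (rule r(2))
    moreover have "g ** (x + t) ** h = g ** x ** h + g ** t ** h"
      by (simp add: matrix_add_ldistrib vec_eq_iff matrix_mult_entry distrib_right distrib_left sum.distrib)
    ultimately show "\<psi> (g ** (x + t) ** h) = \<psi> (g ** x ** h)" by simp
  next
    fix x assume "\<psi> (g ** x ** h) \<noteq> 0"
    then have b: "mabs (g ** x ** h) \<le> R" by (rule BR(3))
    have "x = matrix_inv g ** (g ** x ** h) ** matrix_inv h"
      using matrix_inv_mult[OF g] by (simp add: matrix_mul_assoc matrix_inv_cancel[OF h])
    then have "mabs x \<le> mabs (matrix_inv g ** (g ** x ** h)) * mabs (matrix_inv h)"
      using mabs_mult_le by metis
    also have "\<dots> \<le> (mabs (matrix_inv g) * mabs (g ** x ** h)) * mabs (matrix_inv h)"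
      by (intro mult_right_mono mabs_mult_le) auto
    also have "\<dots> \<le> (mabs (matrix_inv g) * R) * mabs (matrix_inv h)"
      by (intro mult_right_mono mult_left_mono b) auto
    finally show "mabs x \<le> (mabs (matrix_inv g) * R) * mabs (matrix_inv h)" .
  qed (use r c in auto)
qed

text \<open>Continuity of \<open>inverse\<close> is available away from 0; the remaining point
  contributes only a finite, hence closed, set to each preimage.\<close>

lemma measurable_inverse_F: "(inverse :: 'a \<Rightarrow> 'a) \<in> borel_measurable borel"
proof (rule borel_measurableI)
  fix S :: "'a set" assume S: "open S"
  have o: "open (-{0::'a})" by (rule open_Compl) simp
  have "open (inverse -` S \<inter> -{0})"
    using continuous_on_open_vimage[OF o, of inverse] continuous_on_inverse_F S by blast
  then have "(inverse -` S \<inter> -{0}) \<union> (inverse -` S \<inter> {0}) \<in> sets borel"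
    by (intro sets.Un borel_open borel_closed finite_imp_closed) auto
  moreover have "inverse -` S = (inverse -` S \<inter> -{0}) \<union> (inverse -` S \<inter> {0})" by blast
  ultimately show "inverse -` S \<inter> space borel \<in> sets borel" by simp
qed

end

context haar_vector
begin

text \<open>A ball of radius less than 1 around the vector with all entries 1 consists of vectors of
  norm 1, again by the isosceles principle, and it has positive volume.\<close>

lemma prim_nonnull: "emeasure \<mu>X {y. vabs y = 1} \<noteq> 0"
proof
  assume 0: "emeasure \<mu>X {y. vabs y = 1} = 0"
  obtain c where c: "c \<noteq> 0" "absv c < 1" using ex_abs_less[of 1] by auto
  let ?V = "{x :: 'a^'n. vabs x \<le> absv c}"
  have V: "open ?V" using open_vbox[of "absv c" 0] c by simp
  have "(\<lambda>x. x + (\<chi> i. 1)) ` ?V \<subseteq> {y. vabs y = 1}"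
  proof safe
    fix x :: "'a^'n" assume x: "vabs x \<le> absv c"
    have "absv ((x + (\<chi> i. 1)) $ i) = 1" for i
      using abs_diff_less_imp_eq[of "x $ i + 1" 1] abs_le_vabs[of x i] x c by simp
    then show "vabs (x + (\<chi> i. 1)) = 1" using vabs_attained by metis
  qed
  then have "emeasure \<mu>X ((\<lambda>x. x + (\<chi> i. 1)) ` ?V) \<le> emeasure \<mu>X {y. vabs y = 1}"
    by (rule emeasure_mono) simp
  then have "emeasure \<mu>X ?V = 0" using 0 X.emeasure_translate[OF borel_open[OF V]] by simp
  then show False using X.emeasure_open_pos[OF V] by simp
qed

text \<open>A dilation by \<open>a\<close> with \<open>absv a > 1\<close> fixes the origin while
  changing volumes by a factor other than 1, and the mass of a point is finite.\<close>

lemma emeasure_X_zero: "emeasure \<mu>X {0} = 0"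
proof (rule ccontr)
  assume nz: "emeasure \<mu>X {0} \<noteq> 0"
  obtain a where a: "absv a > 1" using ex_abs_gt by blast
  then have a0: "a \<noteq> 0" by auto
  have "(\<lambda>x. mat a *v x) -` {0 :: 'a^'n} = {0}" using a0 by (auto simp: mat_scale_mult)
  then have "emeasure \<mu>X {0} = ennreal (1 / absv a ^ CARD('n)) * emeasure \<mu>X {0}"
    using emeasure_X_linear[OF invertible_mat[OF a0], of "{0}"] by (simp add: det_mat abs_power)
  moreover have "emeasure \<mu>X {0} \<noteq> \<infinity>" using X.emeasure_compact_finite[of "{0}"] by auto
  ultimately obtain m where m: "m > 0" "ennreal m = ennreal (1 / absv a ^ CARD('n)) * ennreal m"
    using nz by (cases "emeasure \<mu>X {0}") (auto simp: less_le)
  then have "m = 1 / absv a ^ CARD('n) * m"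
    by (subst (asm) ennreal_mult[symmetric]) (auto simp: ennreal_inj)
  then have "1 / absv a ^ CARD('n) = 1" using m(1) unfolding mult_cancel_right1 by simp
  moreover have "absv a ^ CARD('n) > 1" using a by (intro one_less_power) auto
  ultimately show False by simp
qed

lemma emeasure_X_ball:
  assumes "a \<noteq> 0" shows "emeasure \<mu>X {x. vabs x \<le> absv a} = ennreal (absv a ^ CARD('n))"
proof -
  have "(\<lambda>x. mat (inverse a) *v x) -` {x :: 'a^'n. vabs x \<le> 1} = {x. vabs x \<le> absv a}"
    using assms by (auto simp: mat_scale_mult vabs_scale abs_divide inverse_eq_divide pos_divide_le_eq)
  then show ?thesis
    using emeasure_X_linear[of "mat (inverse a)" "{x. vabs x \<le> 1}"] assms invertible_mat[of "inverse a"] X.open_U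
    by (simp add: det_mat abs_power abs_inverse power_inverse divide_inverse)
qed

lemma X_box_finite: "emeasure \<mu>X {x. vabs x \<le> R} < \<infinity>"
  by (rule X.emeasure_compact_finite[OF compact_vbox])

text \<open>For \<open>vabs y = 1\<close> the norm of \<open>outer x y\<close> is
  \<open>vabs x\<close>. The box is therefore fibred over a bounded set of rows by bounded sets of
  columns, even near the zero matrix.\<close>

lemma rank1_box_finite: "emeasure rank1_measure {z. mabs z \<le> R} < \<infinity>"
proof -
  have b: "{z :: 'a^'n^'n. mabs z \<le> R} \<in> sets borel" using closed_mbox[of "0 :: 'a^'n^'n" R] by simp
  have m: "{x :: 'a^'n. vabs x \<le> R} \<in> sets \<mu>X" for R using closed_vbox[of "0 :: 'a^'n" R] by simp
  have "emeasure rank1_measure {z. mabs z \<le> R} = (\<integral>\<^sup>+ z. indicator {z. mabs z \<le> R} z \<partial>rank1_measure)"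
    using b by simp
  also have "\<dots> = (\<integral>\<^sup>+ y. of_bool (vabs y = 1) * (\<integral>\<^sup>+ x. indicator {z. mabs z \<le> R} (outer x y) \<partial>\<mu>X) \<partial>\<mu>X)"
    by (rule nn_integral_rank1) (use b in simp)
  also have "\<dots> \<le> (\<integral>\<^sup>+ y. emeasure \<mu>X {x. vabs x \<le> R} * indicator {y. vabs y \<le> 1} y \<partial>\<mu>X)"
  proof (rule nn_integral_mono)
    fix y :: "'a^'n"
    show "of_bool (vabs y = 1) * (\<integral>\<^sup>+ x. indicator {z. mabs z \<le> R} (outer x y) \<partial>\<mu>X)
        \<le> emeasure \<mu>X {x. vabs x \<le> R} * indicator {y. vabs y \<le> 1} y"
    proof (cases "vabs y = 1")
      case True
      then have "(\<integral>\<^sup>+ x. indicator {z. mabs z \<le> R} (outer x y) \<partial>\<mu>X) = (\<integral>\<^sup>+ x. indicator {x. vabs x \<le> R} x \<partial>\<mu>X)"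
        by (intro nn_integral_cong) (auto simp: indicator_def mabs_outer)
      also have "\<dots> = emeasure \<mu>X {x. vabs x \<le> R}" using m by simp
      finally show ?thesis using True by simp
    qed simp
  qed
  also have "\<dots> = emeasure \<mu>X {x. vabs x \<le> R} * emeasure \<mu>X {y. vabs y \<le> 1}"
    using m by (simp add: nn_integral_cmult_indicator)
  also have "\<dots> < \<infinity>" using X_box_finite[of R] by (simp add: ennreal_mult_less_top)
  finally show ?thesis .
qed

lemma mabs_finite_imp_sigma_finite:
  fixes \<mu> :: "('a^'n^'n) measure"
  assumes sets: "sets \<mu> = sets borel" and fin: "\<And>R. emeasure \<mu> {z. mabs z \<le> R} < \<infinity>"
  shows "sigma_finite_measure \<mu>"
proof
  let ?A = "range (\<lambda>n::nat. {z :: 'a^'n^'n. mabs z \<le> real n})"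
  have c1: "countable ?A" by simp
  have c2: "?A \<subseteq> sets \<mu>" unfolding sets using borel_closed[OF closed_mbox[of "0 :: 'a^'n^'n"]] by auto
  have "\<exists>n::nat. mabs z \<le> real n" for z :: "'a^'n^'n" by (rule real_arch_simple)
  then have c3: "\<Union> ?A = space \<mu>" using sets_eq_imp_space_eq[OF sets] by auto
  have c4: "emeasure \<mu> a \<noteq> \<infinity>" if a: "a \<in> ?A" for a
  proof -
    obtain n :: nat where "a = {z. mabs z \<le> real n}" using a by auto
    then show ?thesis using fin[of "real n"] by simp
  qed
  show "\<exists>A. countable A \<and> A \<subseteq> sets \<mu> \<and> \<Union> A = space \<mu> \<and> (\<forall>a\<in>A. emeasure \<mu> a \<noteq> \<infinity>)"
    by (intro exI[of _ ?A] conjI ballI c1 c2 c3) (rule c4)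
qed

text \<open>With a row of norm 1 the matrix \<open>outer x y\<close> has rank 1 unless
  \<open>x = 0\<close>, and the origin is null. So the measure lives on the orbit although its
  definition admits zero columns.\<close>

lemma rank1_scaling: "orbit_scaling 1 rank1_measure"
  unfolding orbit_scaling_def
proof (intro conjI allI impI)
  show "sigma_finite_measure rank1_measure"
    by (rule mabs_finite_imp_sigma_finite[OF _ rank1_box_finite]) simp
  have O: "- rank_orbit 1 \<in> sets (borel :: ('a^'n^'n) measure)" using rank_orbit_borel by (rule borel_comp)
  have "emeasure rank1_measure (- rank_orbit 1) = (\<integral>\<^sup>+ z. indicator (- rank_orbit 1) z \<partial>rank1_measure)"
    using O by simp
  also have "\<dots> = (\<integral>\<^sup>+ y. of_bool (vabs y = 1) * (\<integral>\<^sup>+ x. indicator (- rank_orbit 1) (outer x y) \<partial>\<mu>X) \<partial>\<mu>X)"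
    by (rule nn_integral_rank1) (use O in simp)
  also have "\<dots> = (\<integral>\<^sup>+ y. 0 \<partial>\<mu>X)"
  proof (rule nn_integral_cong)
    fix y :: "'a^'n"
    show "of_bool (vabs y = 1) * (\<integral>\<^sup>+ x. indicator (- rank_orbit 1) (outer x y) \<partial>\<mu>X) = 0"
    proof (cases "vabs y = 1")
      case True
      then have y: "y \<noteq> 0" by auto
      have "(\<integral>\<^sup>+ x. indicator (- rank_orbit 1) (outer x y) \<partial>\<mu>X) \<le> (\<integral>\<^sup>+ x. indicator {0} x \<partial>\<mu>X)"
        using rank_outer[OF _ y] by (intro nn_integral_mono) (auto simp: indicator_def rank_orbit_def)
      also have "\<dots> = 0" using emeasure_X_zero by simp
      finally show ?thesis by simp
    qed simp
  qed
  finally show "emeasure rank1_measure (- rank_orbit 1) = 0" by simp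
  show "emeasure rank1_measure UNIV \<noteq> 0"
  proof -
    have m: "{y :: 'a^'n. vabs y = 1} \<in> sets \<mu>X"
      by measurable
    have "emeasure rank1_measure UNIV = (\<integral>\<^sup>+ z. indicator UNIV z \<partial>rank1_measure)"
      by (subst nn_integral_indicator) auto
    also have "\<dots> = (\<integral>\<^sup>+ y. of_bool (vabs y = 1) * (\<integral>\<^sup>+ x. indicator UNIV (outer x y) \<partial>\<mu>X) \<partial>\<mu>X)"
      by (rule nn_integral_rank1) simp
    also have "\<dots> = (\<integral>\<^sup>+ y. emeasure \<mu>X UNIV * indicator {y. vabs y = 1} y \<partial>\<mu>X)"
      by (intro nn_integral_cong) (auto simp: indicator_def)
    also have "\<dots> = emeasure \<mu>X UNIV * emeasure \<mu>X {y. vabs y = 1}"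
      by (rule nn_integral_cmult_indicator[OF m])
    finally show ?thesis using prim_nonnull X.emeasure_open_pos[of UNIV] by simp
  qed
  fix g h :: "'a^'n^'n" and A :: "('a^'n^'n) set"
  assume g: "invertible g" and h: "invertible h" and A: "A \<in> sets borel"
  have "emeasure rank1_measure ((\<lambda>p. g ** p ** h) -` A) = (\<integral>\<^sup>+ p. indicator ((\<lambda>p. g ** p ** h) -` A) p \<partial>rank1_measure)"
    using vimage_gph[OF A] by simp
  also have "\<dots> = (\<integral>\<^sup>+ p. indicator A (g ** p ** h) \<partial>rank1_measure)"
    by (intro nn_integral_cong) (auto simp: indicator_def)
  also have "\<dots> = ennreal (1 / absv (det g) * (1 / absv (det h))) * (\<integral>\<^sup>+ p. indicator A p \<partial>rank1_measure)"
    by (rule nn_integral_rank1_transform[OF _ g h]) (use A in simp)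
  finally show "emeasure rank1_measure ((\<lambda>p. g ** p ** h) -` A) =
      ennreal ((1 / absv (det g)) ^ 1 * (1 / absv (det h)) ^ 1) * emeasure rank1_measure A"
    using A by simp
qed simp

lemma integral_rank1:
  fixes f :: "'a^'n^'n \<Rightarrow> complex"
  assumes f: "integrable rank1_measure f"
  shows "(\<integral> p. f p \<partial>rank1_measure) = (\<integral> y. of_bool (vabs y = 1) * (\<integral> x. f (outer x y) \<partial>\<mu>X) \<partial>\<mu>X)"
proof -
  let ?P = "\<lambda>w :: ('a^'n) \<times> ('a^'n). vabs (snd w) = 1"
  have P: "{w \<in> space (\<mu>X \<Otimes>\<^sub>M \<mu>X). ?P w} \<in> sets (\<mu>X \<Otimes>\<^sub>M \<mu>X)"
  proof -
    have "vabs \<in> borel_measurable \<mu>X" by (simp add: measurable_cong_sets[OF X.sets_haar refl])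
    from measurable_compose[OF measurable_snd this] show ?thesis by measurable
  qed
  have T: "(\<lambda>w. outer (fst w) (snd w)) \<in> \<mu>X \<Otimes>\<^sub>M \<mu>X \<rightarrow>\<^sub>M borel"
    using measurable_outer by (simp add: measurable_cong_sets[OF X_prod_sets refl] case_prod_beta')
  have r: "rank1_measure = distr (density (\<mu>X \<Otimes>\<^sub>M \<mu>X) (\<lambda>w. of_bool (?P w))) borel (\<lambda>w. outer (fst w) (snd w))"
    by (simp add: rank1_measure_def case_prod_beta')
  have fb: "f \<in> borel_measurable borel"
    using borel_measurable_integrable[OF f] by (simp add: measurable_cong_sets[OF sets_rank1_measure refl])
  have int: "integrable (\<mu>X \<Otimes>\<^sub>M \<mu>X) (\<lambda>(x, y). of_bool (vabs y = 1) * f (outer x y))"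
    using f integral_distr_density_bool(2)[OF P T fb] unfolding r[symmetric] by (simp add: case_prod_beta')
  have "(\<integral> p. f p \<partial>rank1_measure) = (\<integral> (x, y). of_bool (vabs y = 1) * f (outer x y) \<partial>(\<mu>X \<Otimes>\<^sub>M \<mu>X))"
    using integral_distr_density_bool(1)[OF P T fb] unfolding r[symmetric] by (simp add: case_prod_beta')
  also have "\<dots> = (\<integral> y. \<integral> x. of_bool (vabs y = 1) * f (outer x y) \<partial>\<mu>X \<partial>\<mu>X)"
    by (rule XX.integral_snd[OF int, symmetric])
  also have "\<dots> = (\<integral> y. of_bool (vabs y = 1) * (\<integral> x. f (outer x y) \<partial>\<mu>X) \<partial>\<mu>X)"
    by simp
  finally show ?thesis .
qed

end

section \<open>The Fourier transform and the measure on matrices of corank one\<close>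

locale haar_fourier = haar_vector absv \<mu>F \<mu>X + haar_matrix absv \<mu>F \<mu>M
  for absv :: "'a::{field,metric_space} \<Rightarrow> real" and \<mu>F :: "'a measure"
    and \<mu>X :: "('a^'n::finite) measure" and \<mu>M :: "('a^'n^'n) measure" +
  fixes chr :: "'a \<Rightarrow> complex"
  assumes additive_char: "additive_char absv chr"
begin

lemma chr_add: "chr (x + y) = chr x * chr y"
  and cmod_chr [simp]: "cmod (chr x) = 1"
  and chr_eq_1_iff: "chr x = 1 \<longleftrightarrow> absv x \<le> 1"
  using additive_char unfolding additive_char_def intring_def by auto

lemma continuous_on_chr: "continuous_on S chr"
proof (rule continuous_on_subset[of UNIV])
  show "continuous_on UNIV chr"
  proof (subst continuous_on_open_vimage[OF open_UNIV], safe)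
    fix B :: "complex set" assume "open B"
    show "open (chr -` B \<inter> UNIV)"
    proof (rule Topological_Spaces.openI)
      fix x assume x: "x \<in> chr -` B \<inter> UNIV"
      have "{y. absv (y - x) \<le> 1} \<subseteq> chr -` B \<inter> UNIV"
      proof
        fix y assume "y \<in> {y. absv (y - x) \<le> 1}"
        then have "chr (y - x) = 1" by (simp add: chr_eq_1_iff)
        then have "chr y = chr x" using chr_add[of "y - x" x] by simp
        then show "y \<in> chr -` B \<inter> UNIV" using x by simp
      qed
      moreover have "open {y. absv (y - x) \<le> 1}" by (rule open_abs_ball) simp
      moreover have "x \<in> {y. absv (y - x) \<le> 1}" by simp
      ultimately show "\<exists>T. open T \<and> x \<in> T \<and> T \<subseteq> chr -` B \<inter> UNIV" by blast
    qed
  qed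
qed simp

lemma continuous_on_chr_compose: "continuous_on S f \<Longrightarrow> continuous_on S (\<lambda>x. chr (f x))"
  by (rule continuous_on_compose2[OF continuous_on_chr[of UNIV]]) auto

lemma measurable_chr_trace: "(\<lambda>y. chr (- trace (w ** y))) \<in> borel_measurable \<mu>M"
  unfolding measurable_cong_sets[OF M.sets_haar refl]
  by (intro borel_measurable_continuous_onI continuous_on_chr_compose continuous_on_minus_F continuous_on_trace
      continuous_on_matrix_mult continuous_on_const continuous_on_id)

lemma M_box_finite: "emeasure \<mu>M {z. mabs z \<le> R} < \<infinity>"
  by (rule M.emeasure_compact_finite[OF compact_mbox_0])

lemma schwartz_integrable_M: "schwartz \<psi> \<Longrightarrow> integrable \<mu>M \<psi>"
  by (rule schwartz_integrable[OF _ M.sets_haar M_box_finite])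

lemma schwartz_measurable: "schwartz \<psi> \<Longrightarrow> \<psi> \<in> borel_measurable (borel :: ('a^'n^'n) measure)"
  by (rule borel_measurable_continuous_onI[OF schwartz_continuous])

lemma integrable_times_unitary:
  fixes \<psi> f :: "'b \<Rightarrow> complex"
  assumes "integrable N \<psi>" "f \<in> borel_measurable N" "\<And>x. cmod (f x) = 1"
  shows "integrable N (\<lambda>x. \<psi> x * f x)"
  by (rule Bochner_Integration.integrable_bound[OF assms(1)]) (use assms in \<open>auto simp: norm_mult\<close>)

lemma integrable_fourier: "schwartz \<psi> \<Longrightarrow> integrable \<mu>M (\<lambda>y. \<psi> y * chr (- trace (w ** y)))"
  by (rule integrable_times_unitary[OF schwartz_integrable_M measurable_chr_trace]) auto

lemma integral_M_translate:
  assumes "f \<in> borel_measurable borel"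
  shows "(\<integral> z. f (t + z) \<partial>\<mu>M) = (\<integral> z. (f z :: complex) \<partial>\<mu>M)"
proof -
  have "(\<lambda>z. t + z) \<in> \<mu>M \<rightarrow>\<^sub>M \<mu>M"
    unfolding measurable_cong_sets[OF M.sets_haar M.sets_haar]
    by (intro borel_measurable_continuous_onI M.continuous_on_add_b continuous_on_const continuous_on_id)
  from integral_scaled_action[OF this, of 1 f] show ?thesis
    using assms by (simp add: M.emeasure_vimage_translate measurable_cong_sets[OF M.sets_haar refl])
qed

lemma integral_X_translate:
  assumes "f \<in> borel_measurable borel"
  shows "(\<integral> z. f (t + z) \<partial>\<mu>X) = (\<integral> z. (f z :: complex) \<partial>\<mu>X)"
proof -
  have "(\<lambda>z. t + z) \<in> \<mu>X \<rightarrow>\<^sub>M \<mu>X"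
    unfolding measurable_cong_sets[OF X.sets_haar X.sets_haar]
    by (intro borel_measurable_continuous_onI X.continuous_on_add_b continuous_on_const continuous_on_id)
  from integral_scaled_action[OF this, of 1 f] show ?thesis
    using assms by (simp add: X.emeasure_vimage_translate measurable_cong_sets[OF X.sets_haar refl])
qed

text \<open>A shift by \<open>t\<close> leaves \<open>\<psi>\<close> unchanged but multiplies the
  transform at \<open>w\<close> by a character value. Since the kernel of \<open>chr\<close> is
  exactly the ring of integers, this value differs from 1 as soon as some entry of \<open>w\<close>
  times \<open>c\<close> leaves that ring.\<close>

lemma fourier_support:
  fixes \<psi> :: "'a^'n^'n \<Rightarrow> complex"
  assumes \<psi>: "schwartz \<psi>" and c: "c \<noteq> 0" "\<And>x t. mabs t \<le> absv c \<Longrightarrow> \<psi> (x + t) = \<psi> x"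
    and nz: "fourier \<mu>M chr \<psi> w \<noteq> 0"
  shows "mabs w \<le> 1 / absv c"
proof (rule ccontr)
  assume "\<not> mabs w \<le> 1 / absv c"
  then obtain i j where ij: "absv (w $ i $ j) > 1 / absv c" unfolding mabs_le_iff by (auto simp: not_le)
  \<comment> \<open>The indices are transposed because the trace of \<open>w ** t\<close> pairs
    entry \<open>(i, j)\<close> of \<open>w\<close> with entry \<open>(j, i)\<close> of
    \<open>t\<close>.\<close>
  define t :: "'a^'n^'n" where "t = axis j (axis i c)"
  have mt: "mabs t \<le> absv c" unfolding mabs_le_iff t_def by (auto simp: axis_def)
  have tt: "trace (w ** t) = w $ i $ j * c"
  proof -
    have "trace (w ** t) = (\<Sum>k\<in>UNIV. \<Sum>l\<in>UNIV. if l = j then (if k = i then w $ k $ l * c else 0) else 0)"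
      unfolding trace_def matrix_mult_entry t_def by (intro sum.cong refl) (auto simp: axis_def)
    then show ?thesis by simp
  qed
  have "absv (- trace (w ** t)) > 1"
    unfolding tt abs_minus abs_mult using ij c(1) by (simp add: pos_divide_less_eq)
  then have n1: "chr (- trace (w ** t)) \<noteq> 1" using chr_eq_1_iff not_less by blast
  have m: "(\<lambda>y. \<psi> y * chr (- trace (w ** y))) \<in> borel_measurable borel"
    using borel_measurable_times[OF schwartz_measurable[OF \<psi>] measurable_chr_trace[unfolded measurable_cong_sets[OF M.sets_haar refl]]] .
  have "fourier \<mu>M chr \<psi> w = (\<integral> y. \<psi> (t + y) * chr (- trace (w ** (t + y))) \<partial>\<mu>M)"
    unfolding fourier_def by (rule integral_M_translate[OF m, symmetric])
  also have "\<dots> = (\<integral> y. chr (- trace (w ** t)) * (\<psi> y * chr (- trace (w ** y))) \<partial>\<mu>M)"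
  proof (intro Bochner_Integration.integral_cong refl)
    fix y
    have "\<psi> (t + y) = \<psi> y" using c(2)[OF mt, of y] by (simp add: add.commute)
    moreover have "- trace (w ** (t + y)) = - trace (w ** t) + - trace (w ** y)"
      by (simp add: matrix_add_ldistrib trace_add)
    ultimately show "\<psi> (t + y) * chr (- trace (w ** (t + y))) = chr (- trace (w ** t)) * (\<psi> y * chr (- trace (w ** y)))"
      by (simp only: chr_add mult_ac)
  qed
  also have "\<dots> = chr (- trace (w ** t)) * fourier \<mu>M chr \<psi> w"
    unfolding fourier_def by simp
  finally have "(1 - chr (- trace (w ** t))) * fourier \<mu>M chr \<psi> w = 0" by (simp add: algebra_simps)
  then show False using n1 nz by simp
qed

lemma ex_invariance_scale:
  fixes \<psi> :: "'a^'n^'n \<Rightarrow> complex"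
  assumes "schwartz \<psi>"
  obtains c where "c \<noteq> 0" "\<And>x t. mabs t \<le> absv c \<Longrightarrow> \<psi> (x + t) = \<psi> x"
proof -
  obtain r where r: "r > 0" "\<And>x t. mabs t \<le> r \<Longrightarrow> \<psi> (x + t) = \<psi> x"
    using schwartz_uniform[OF assms] by blast
  obtain c where c: "c \<noteq> 0" "absv c < r" using ex_abs_less[OF r(1)] .
  have "\<psi> (x + t) = \<psi> x" if "mabs t \<le> absv c" for x t by (rule r(2)) (use that c in simp)
  then show ?thesis using that c(1) by blast
qed

text \<open>Support and smoothness trade places: support in radius \<open>R\<close> makes the
  transform invariant under shifts up to \<open>1 / R\<close>, and invariance under shifts up to
  \<open>absv c\<close> bounds its support by \<open>1 / absv c\<close>.\<close>

lemma fourier_schwartz: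
  fixes \<psi> :: "'a^'n^'n \<Rightarrow> complex"
  assumes \<psi>: "schwartz \<psi>" shows "schwartz (fourier \<mu>M chr \<psi>)"
proof -
  obtain B R where "B > 0" and BR: "R > 0" "\<And>x. cmod (\<psi> x) \<le> B" "\<And>x. \<psi> x \<noteq> 0 \<Longrightarrow> mabs x \<le> R"
    using schwartz_bounds[OF \<psi>] by blast
  obtain c where c: "c \<noteq> 0" "\<And>x t. mabs t \<le> absv c \<Longrightarrow> \<psi> (x + t) = \<psi> x" using ex_invariance_scale[OF \<psi>] by blast
  show ?thesis
  proof (rule schwartzI[of "1 / R"])
    fix w s :: "'a^'n^'n" assume s: "mabs s \<le> 1 / R"
    show "fourier \<mu>M chr \<psi> (w + s) = fourier \<mu>M chr \<psi> w"
      unfolding fourier_def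
    proof (intro Bochner_Integration.integral_cong refl)
      fix y
      show "\<psi> y * chr (- trace ((w + s) ** y)) = \<psi> y * chr (- trace (w ** y))"
      proof (cases "\<psi> y = 0")
        case False
        have "absv (- trace (s ** y)) \<le> mabs s * mabs y" unfolding abs_minus by (rule abs_trace_mult_le)
        also have "\<dots> \<le> (1 / R) * R" using s BR(1) BR(3)[OF False] by (intro mult_mono) auto
        finally have "chr (- trace (s ** y)) = 1" using BR(1) by (simp add: chr_eq_1_iff)
        moreover have "- trace ((w + s) ** y) = - trace (w ** y) + - trace (s ** y)"
          by (simp add: trace_mult_add)
        ultimately show ?thesis by (simp only: chr_add mult_1_right)
      qed simp
    qed
  next
    fix w assume nz: "fourier \<mu>M chr \<psi> w \<noteq> 0"
    show "mabs w \<le> 1 / absv c" by (rule fourier_support[OF \<psi> c(1) _ nz]) (erule c(2))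
  qed (use BR in simp)
qed

lemma emeasure_M_gph:
  assumes g: "invertible g" and h: "invertible h" and A: "A \<in> sets borel"
  shows "emeasure \<mu>M ((\<lambda>p. g ** p ** h) -` A)
     = ennreal ((1 / absv (det g)) ^ CARD('n) * (1 / absv (det h)) ^ CARD('n)) * emeasure \<mu>M A"
proof -
  have v: "(\<lambda>z. z ** h) -` A \<in> sets borel" using vimage_gph[OF A, of "mat 1" h] by simp
  have "(\<lambda>p. g ** p ** h) -` A = (\<lambda>z. g ** z) -` ((\<lambda>z. z ** h) -` A)" by auto
  then show ?thesis
    using emeasure_M_left[OF g v] emeasure_M_right[OF h A] by (simp add: ennreal_mult mult.assoc)
qed

text \<open>Cyclicity of the trace moves the substitution from the integration variable to
  \<open>w\<close>, where \<open>g\<close> and \<open>h\<close> change sides. The determinant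
  factors are the Jacobians of two-sided multiplication on all matrices.\<close>

lemma fourier_gph:
  fixes \<psi> :: "'a^'n^'n \<Rightarrow> complex"
  assumes \<psi>: "schwartz \<psi>" and g: "invertible g" and h: "invertible h"
  shows "fourier \<mu>M chr (\<lambda>p. \<psi> (g ** p ** h)) w
    = complex_of_real ((1 / absv (det g)) ^ CARD('n) * (1 / absv (det h)) ^ CARD('n))
       * fourier \<mu>M chr \<psi> (matrix_inv h ** w ** matrix_inv g)"
proof -
  let ?w = "matrix_inv h ** w ** matrix_inv g"
  let ?T = "\<lambda>y. g ** y ** h"
  have tr: "trace (?w ** ?T y) = trace (w ** y)" for y
  proof -
    have "?w ** ?T y = matrix_inv h ** (w ** y ** h)"
      by (simp add: matrix_mul_assoc matrix_inv_cancel[OF g])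
    then have "trace (?w ** ?T y) = trace ((w ** y ** h) ** matrix_inv h)"
      using trace_mul_sym[of "matrix_inv h" "w ** y ** h"] by simp
    then show ?thesis by (simp add: matrix_inv_cancel[OF h])
  qed
  have m: "(\<lambda>y. \<psi> y * chr (- trace (?w ** y))) \<in> borel_measurable \<mu>M"
    using borel_measurable_integrable[OF integrable_fourier[OF \<psi>]] .
  have T: "?T \<in> \<mu>M \<rightarrow>\<^sub>M \<mu>M"
    using measurable_gph unfolding measurable_cong_sets[OF M.sets_haar M.sets_haar] .
  have "fourier \<mu>M chr (\<lambda>p. \<psi> (?T p)) w = (\<integral> y. (\<lambda>y. \<psi> y * chr (- trace (?w ** y))) (?T y) \<partial>\<mu>M)"
    unfolding fourier_def tr ..
  also have "\<dots> = complex_of_real ((1 / absv (det g)) ^ CARD('n) * (1 / absv (det h)) ^ CARD('n)) *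
      (\<integral> y. \<psi> y * chr (- trace (?w ** y)) \<partial>\<mu>M)"
    by (rule integral_scaled_action[OF T _ _ m]) (use emeasure_M_gph[OF g h] in auto)
  finally show ?thesis unfolding fourier_def .
qed

text \<open>The ball is a compact subgroup. A character that is trivial on it integrates to its
  volume, any other to 0.\<close>

lemma character_integral_ball:
  assumes a: "a \<noteq> 0"
  shows "(\<integral> x. of_bool (vabs x \<le> absv a) * chr (- rowcol v x) \<partial>\<mu>X)
     = complex_of_real (absv a ^ CARD('n)) * of_bool (absv a * vabs v \<le> 1)"
proof -
  let ?V = "{x :: 'a^'n. vabs x \<le> absv a}"
  have V: "?V \<in> sets borel" using closed_vbox[of "0 :: 'a^'n"] by simp
  have ind: "of_bool (vabs x \<le> absv a) = (indicator ?V x :: complex)" for x by (simp add: indicator_def)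
  have "continuous_on UNIV (\<lambda>x. - rowcol v x)"
    unfolding rowcol_def
    by (intro continuous_on_minus_F continuous_on_sum_F continuous_on_mult_F continuous_on_component continuous_on_const continuous_on_id)
  then have c: "(\<lambda>x. chr (- rowcol v x)) \<in> borel_measurable borel"
    by (intro borel_measurable_continuous_onI continuous_on_chr_compose)
  show ?thesis
  proof (cases "absv a * vabs v \<le> 1")
    case True
    have "(\<integral> x. of_bool (vabs x \<le> absv a) * chr (- rowcol v x) \<partial>\<mu>X) = (\<integral> x. indicator ?V x \<partial>\<mu>X)"
    proof (intro Bochner_Integration.integral_cong refl)
      fix x
      show "of_bool (vabs x \<le> absv a) * chr (- rowcol v x) = indicator ?V x"
      proof (cases "vabs x \<le> absv a")
        case xa: True
        have "absv (- rowcol v x) \<le> vabs v * vabs x" unfolding abs_minus by (rule abs_rowcol_le)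
        also have "\<dots> \<le> vabs v * absv a" by (intro mult_left_mono xa) simp
        also have "\<dots> \<le> 1" using True by (simp add: mult.commute)
        finally have "chr (- rowcol v x) = 1" by (simp add: chr_eq_1_iff)
        then show ?thesis using xa by (simp add: indicator_def)
      qed (simp add: indicator_def)
    qed
    also have "\<dots> = complex_of_real (measure \<mu>X ?V)"
      by (rule integral_indicator_complex) (use V in simp)
    also have "measure \<mu>X ?V = absv a ^ CARD('n)"
      using emeasure_X_ball[OF a] by (simp add: measure_def)
    finally show ?thesis using True by simp
  next
    case False
    obtain i where i: "vabs v = absv (v $ i)" using vabs_attained by blast
    let ?I = "\<integral> x. of_bool (vabs x \<le> absv a) * chr (- rowcol v x) \<partial>\<mu>X"
    \<comment> \<open>A vector of the ball on which the character is nontrivial: length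
      \<open>a\<close> in the direction of a maximal entry of \<open>v\<close>.\<close>
    define t :: "'a^'n" where "t = axis i a"
    have vt: "vabs t \<le> absv a" unfolding vabs_le_iff t_def by (auto simp: axis_def)
    have rt: "rowcol v t = v $ i * a" unfolding rowcol_def t_def
      by (simp add: axis_def if_distrib cong: if_cong)
    have "absv (- rowcol v t) > 1" unfolding rt abs_minus abs_mult using False i by (simp add: mult.commute)
    then have n1: "chr (- rowcol v t) \<noteq> 1" using chr_eq_1_iff not_less by blast
    have m: "(\<lambda>x. of_bool (vabs x \<le> absv a) * chr (- rowcol v x)) \<in> borel_measurable borel"
      unfolding ind using c V by measurable
    have "?I = (\<integral> x. of_bool (vabs (t + x) \<le> absv a) * chr (- rowcol v (t + x)) \<partial>\<mu>X)"
      by (rule integral_X_translate[OF m, symmetric])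
    also have "\<dots> = (\<integral> x. chr (- rowcol v t) * (of_bool (vabs x \<le> absv a) * chr (- rowcol v x)) \<partial>\<mu>X)"
    proof (intro Bochner_Integration.integral_cong refl)
      fix x
      have "vabs (t + x) \<le> absv a \<longleftrightarrow> vabs x \<le> absv a"
        using vabs_add_le[OF vt, of x] vabs_diff_le[OF _ vt, of "t + x"] by auto
      moreover have "- rowcol v (t + x) = - rowcol v t + - rowcol v x"
        by (simp add: rowcol_def distrib_left sum.distrib)
      ultimately show "of_bool (vabs (t + x) \<le> absv a) * chr (- rowcol v (t + x))
          = chr (- rowcol v t) * (of_bool (vabs x \<le> absv a) * chr (- rowcol v x))"
        by (simp only: chr_add mult_ac)
    qed
    also have "\<dots> = chr (- rowcol v t) * ?I" by simp
    finally have "(1 - chr (- rowcol v t)) * ?I = 0" by (simp add: algebra_simps)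
    then have "?I = 0" using n1 by simp
    then show ?thesis using False by simp
  qed
qed

text \<open>The pivot depends on \<open>y\<close> only through a subset of the finite index set; this makes
  \<open>dual_vec\<close> measurable.\<close>

definition pivot :: "'n set \<Rightarrow> 'n" where "pivot S = (SOME i. i \<in> S)"

definition max_index :: "'a^'n \<Rightarrow> 'n set" where "max_index y = {i. absv (y $ i) = vabs y}"

definition dual_vec :: "'a^'n \<Rightarrow> 'a^'n" where
  "dual_vec y = axis (pivot (max_index y)) (inverse (y $ pivot (max_index y)))"

text \<open>For \<open>vabs y = 1\<close>, left multiplication by this matrix projects all matrices
  onto \<open>{z. y v* z = 0}\<close>, along the matrices \<open>outer (dual_vec y) r\<close>.
  Dividing by a maximal entry keeps \<open>dual_vec y\<close> within the unit box, so the component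
  removed is no larger than \<open>y v* z\<close>.\<close>

definition hyper_proj :: "'a^'n \<Rightarrow> 'a^'n^'n" where
  "hyper_proj y = mat 1 - outer (dual_vec y) y"

lemma pivot_max_index: "absv (y $ pivot (max_index y)) = vabs y"
proof -
  obtain i where "vabs y = absv (y $ i)" using vabs_attained by blast
  then have "i \<in> max_index y" by (simp add: max_index_def)
  then have "pivot (max_index y) \<in> max_index y" unfolding pivot_def by (rule someI)
  then show ?thesis by (simp add: max_index_def)
qed

context
  fixes y :: "'a^'n"
  assumes y: "vabs y = 1"
begin

lemma pivot_nz: "y $ pivot (max_index y) \<noteq> 0" "absv (y $ pivot (max_index y)) = 1"
  using pivot_max_index[of y] y by auto

lemma rowcol_dual: "rowcol y (dual_vec y) = 1"
  unfolding rowcol_def dual_vec_def using pivot_nz(1) by (simp add: axis_def if_distrib cong: if_cong)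

lemma vabs_dual: "vabs (dual_vec y) \<le> 1"
  unfolding vabs_le_iff dual_vec_def using pivot_nz by (auto simp: axis_def abs_inverse)

lemma vm_hyper_proj: "y v* hyper_proj y = 0"
  unfolding hyper_proj_def vm_diff vm_outer rowcol_dual by simp

lemma hyper_proj_mult: "hyper_proj y ** z = z - outer (dual_vec y) (y v* z)"
  unfolding hyper_proj_def matrix_diff_mult outer_mult_right by simp

text \<open>The identity is the projection plus a rank one matrix, which bounds the rank from below;
  the left kernel vector \<open>y\<close> excludes full rank.\<close>

lemma rank_hyper_proj: "rank (hyper_proj y) = CARD('n) - 1"
proof -
  have y0: "y \<noteq> 0" using y by auto
  have d0: "dual_vec y \<noteq> 0" using rowcol_dual by (auto simp: rowcol_def)
  have "hyper_proj y + outer (dual_vec y) y = mat 1" by (simp add: hyper_proj_def)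
  then have "CARD('n) \<le> rank (hyper_proj y) + 1"
    using rank_add_le[of "hyper_proj y" "outer (dual_vec y) y"] rank_outer[OF d0 y0] by (simp add: rank_mat_1)
  moreover have "rank (hyper_proj y) \<noteq> CARD('n)"
  proof
    assume "rank (hyper_proj y) = CARD('n)"
    then have i: "invertible (hyper_proj y)" by (simp add: rank_invertible_iff)
    have "y v* (hyper_proj y ** matrix_inv (hyper_proj y)) = 0" unfolding vm_mult vm_hyper_proj by simp
    then show False using y0 matrix_inv_mult(1)[OF i] by simp
  qed
  moreover have "rank (hyper_proj y) \<le> CARD('n)" by (rule rank_le_CARD)
  ultimately show ?thesis by linarith
qed

text \<open>The matrix \<open>D\<close> stretches only the direction complementary to the
  hyperplane: it multiplies \<open>y v* z\<close> by \<open>a\<close> and does not change the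
  projection. It is used to widen a slab around the hyperplane to width 1.\<close>

lemma stretch:
  assumes a: "a \<noteq> 0"
  obtains D :: "'a^'n^'n" where "det D = a" "\<And>z :: 'a^'n^'n. y v* (D ** z) = a *s (y v* z)"
    "\<And>z :: 'a^'n^'n. hyper_proj y ** (D ** z) = hyper_proj y ** z"
proof -
  let ?i = "pivot (max_index y)"
  define D where "D = mat 1 + outer ((a - 1) *s dual_vec y) y"
  define v where "v = ((a - 1) * inverse (y $ ?i) / a) *s y"
  \<comment> \<open>The factorization gives the determinant: a diagonal matrix with the single entry
    \<open>a\<close>, times a transvection of determinant 1.\<close>
  have D: "D = diag_mat (\<lambda>j. if j = ?i then a else 1) ** transvec_row ?i v"
    unfolding vec_eq_iff diag_mat_mult_entry using a pivot_nz(1)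
    by (auto simp: D_def v_def transvec_row_def outer_def dual_vec_def axis_def mat_def field_simps)
  have d1: "det (transvec_row ?i v) = 1"
    by (rule multiplicative_transvec[of det, OF det_mul _ two_nonzero transvec_prod_row])
       (simp add: invertible_det_nz)
  have d2: "det (diag_mat (\<lambda>j. if j = ?i then a else 1)) = a"
    by (simp add: diag_mat_def det_diagonal)
  have 1: "y v* D = a *s y"
    unfolding D_def vm_add vm_outer rowcol_scale rowcol_dual by (simp add: vec_eq_iff algebra_simps)
  have "y v* (D ** z) = a *s (y v* z)" for z :: "'a^'n^'n"
  proof -
    have "y v* (D ** z) = (a *s y) v* z" by (simp only: vm_mult 1)
    also have "\<dots> = a *s (y v* z)" by (simp add: vec_eq_iff vector_matrix_mult_def sum_distrib_left mult_ac)
    finally show ?thesis .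
  qed
  moreover have "hyper_proj y ** (D ** z) = hyper_proj y ** z" for z :: "'a^'n^'n"
  proof -
    have "hyper_proj y ** D = hyper_proj y"
      unfolding hyper_proj_mult 1 unfolding D_def hyper_proj_def
      by (simp add: vec_eq_iff outer_def algebra_simps)
    then show ?thesis by (simp add: matrix_mul_assoc)
  qed
  moreover have "det D = a" unfolding D det_mul d1 d2 by simp
  ultimately show ?thesis using that by blast
qed

lemma continuous_hyper_cut: "continuous_on S (\<lambda>z :: 'a^'n^'n. y v* z)"
  by (intro continuous_on_vm continuous_on_const continuous_on_id)

lemma hyper_cut_borel: "{z :: 'a^'n^'n. vabs (y v* z) \<le> r} \<in> sets borel"
proof -
  have "(\<lambda>z :: 'a^'n^'n. y v* z) -` {x. vabs x \<le> r} \<inter> space borel \<in> sets borel"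
    by (rule measurable_sets[OF borel_measurable_continuous_onI[OF continuous_hyper_cut]])
       (use closed_vbox[of "0 :: 'a^'n"] in simp)
  then show ?thesis by (simp add: vimage_def)
qed

text \<open>Partial Fourier inversion: the right-hand side is the integral of \<open>\<psi>\<close> over the annihilator
  \<open>{z. y v* z = 0}\<close>. Both sides agree with \<open>\<bar>a\<bar>^n\<close> times the integral of \<open>\<psi>\<close> over
  \<open>{z. vabs (y v* z) \<le> 1 / \<bar>a\<bar>}\<close> for large \<open>\<bar>a\<bar>\<close>.\<close>

lemma fourier_line_integral:
  fixes \<psi> :: "'a^'n^'n \<Rightarrow> complex"
  assumes \<psi>: "schwartz \<psi>"
  shows "(\<integral> x. fourier \<mu>M chr \<psi> (outer x y) \<partial>\<mu>X)
     = (\<integral> z. of_bool (vabs (y v* z) \<le> 1) * \<psi> (hyper_proj y ** z) \<partial>\<mu>M)"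
proof -
  interpret XM: pair_sigma_finite \<mu>X \<mu>M ..
  obtain c where c: "c \<noteq> 0" "\<And>x t. mabs t \<le> absv c \<Longrightarrow> \<psi> (x + t) = \<psi> x" using ex_invariance_scale[OF \<psi>] by blast
  \<comment> \<open>By \<open>fourier_support\<close> the transform vanishes at
    \<open>outer x y\<close> unless \<open>vabs x \<le> absv a\<close>, since
    \<open>vabs y = 1\<close>. The cut-off to this ball therefore changes nothing, and it makes the
    double integral absolutely convergent.\<close>
  define a where "a = inverse c"
  have a: "a \<noteq> 0" "absv a = 1 / absv c" using c(1) by (auto simp: a_def abs_divide inverse_eq_divide)
  let ?V = "{x :: 'a^'n. vabs x \<le> absv a}"
  have V: "?V \<in> sets \<mu>X" using closed_vbox[of "0 :: 'a^'n"] by simp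
  have ind: "of_bool (vabs x \<le> absv a) = (indicator ?V x :: complex)" for x by (simp add: indicator_def)
  have sXM: "sets (\<mu>X \<Otimes>\<^sub>M \<mu>M) = sets (borel :: (('a^'n) \<times> ('a^'n^'n)) measure)"
    using borel_prod_separable[OF separable_V separable_M] by (simp cong: sets_pair_measure_cong)
  have intV: "integrable \<mu>X (\<lambda>x. of_bool (vabs x \<le> absv a) :: complex)"
    unfolding ind using V X_box_finite[of "absv a"] by (intro integrable_real_indicator[THEN integrable_of_real, where 'a = complex, simplified of_real_indicator]) auto
  have mch: "(\<lambda>q. chr (- rowcol (y v* snd q) (fst q))) \<in> borel_measurable (\<mu>X \<Otimes>\<^sub>M \<mu>M)"
  proof -
    have "continuous_on UNIV (\<lambda>q :: ('a^'n) \<times> ('a^'n^'n). - trace (outer (fst q) y ** snd q))"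
      by (intro continuous_on_minus_F continuous_on_trace continuous_on_matrix_mult continuous_on_outer
          continuous_on_fst continuous_on_snd continuous_on_const continuous_on_id)
    then show ?thesis unfolding measurable_cong_sets[OF sXM refl] trace_outer_mult
      by (intro borel_measurable_continuous_onI continuous_on_chr_compose)
  qed
  have "integrable (\<mu>X \<Otimes>\<^sub>M \<mu>M) (\<lambda>q. of_bool (vabs (fst q) \<le> absv a) * \<psi> (snd q))"
  proof (rule XM.Fubini_integrable)
    show "(\<lambda>q. of_bool (vabs (fst q) \<le> absv a) * \<psi> (snd q)) \<in> borel_measurable (\<mu>X \<Otimes>\<^sub>M \<mu>M)"
      using measurable_compose[OF measurable_fst borel_measurable_integrable[OF intV]]
        measurable_compose[OF measurable_snd borel_measurable_integrable[OF schwartz_integrable_M[OF \<psi>]]]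
      by (intro borel_measurable_times)
    have "integrable \<mu>X (\<lambda>x. cmod (of_bool (vabs x \<le> absv a)) * (\<integral> z. cmod (\<psi> z) \<partial>\<mu>M))"
      using intV by (intro integrable_mult_left integrable_norm)
    then show "integrable \<mu>X (\<lambda>x. \<integral> z. cmod (of_bool (vabs (fst (x, z)) \<le> absv a) * \<psi> (snd (x, z))) \<partial>\<mu>M)"
      by (simp add: norm_mult)
    show "AE x in \<mu>X. integrable \<mu>M (\<lambda>z. of_bool (vabs (fst (x, z)) \<le> absv a) * \<psi> (snd (x, z)))"
      using schwartz_integrable_M[OF \<psi>] by (intro AE_I2) simp
  qed
  from integrable_times_unitary[OF this mch]
  have int: "integrable (\<mu>X \<Otimes>\<^sub>M \<mu>M) (\<lambda>(x, z). of_bool (vabs x \<le> absv a) * \<psi> z * chr (- rowcol (y v* z) x))"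
    by (simp add: case_prod_beta')
  have "(\<integral> x. fourier \<mu>M chr \<psi> (outer x y) \<partial>\<mu>X)
     = (\<integral> x. \<integral> z. of_bool (vabs x \<le> absv a) * \<psi> z * chr (- rowcol (y v* z) x) \<partial>\<mu>M \<partial>\<mu>X)"
  proof (intro Bochner_Integration.integral_cong refl)
    fix x
    show "fourier \<mu>M chr \<psi> (outer x y) = (\<integral> z. of_bool (vabs x \<le> absv a) * \<psi> z * chr (- rowcol (y v* z) x) \<partial>\<mu>M)"
    proof (cases "vabs x \<le> absv a")
      case True
      then show ?thesis by (simp add: fourier_def trace_outer_mult)
    next
      case False
      have "fourier \<mu>M chr \<psi> (outer x y) = 0"
      proof (rule ccontr)
        assume nz: "fourier \<mu>M chr \<psi> (outer x y) \<noteq> 0"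
        have "mabs (outer x y) \<le> 1 / absv c" by (rule fourier_support[OF \<psi> c(1) _ nz]) (erule c(2))
        then show False using False y a(2) by (simp add: mabs_outer)
      qed
      then show ?thesis using False by simp
    qed
  qed
  also have "\<dots> = (\<integral> z. \<integral> x. of_bool (vabs x \<le> absv a) * \<psi> z * chr (- rowcol (y v* z) x) \<partial>\<mu>X \<partial>\<mu>M)"
    by (rule XM.Fubini_integral[OF int, symmetric])
  also have "\<dots> = (\<integral> z. complex_of_real (absv a ^ CARD('n)) * (of_bool (vabs (y v* z) * absv a \<le> 1) * \<psi> (hyper_proj y ** z)) \<partial>\<mu>M)"
  proof (intro Bochner_Integration.integral_cong refl)
    fix z
    have "(\<integral> x. of_bool (vabs x \<le> absv a) * \<psi> z * chr (- rowcol (y v* z) x) \<partial>\<mu>X)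
       = (\<integral> x. \<psi> z * (of_bool (vabs x \<le> absv a) * chr (- rowcol (y v* z) x)) \<partial>\<mu>X)"
      by (simp only: mult_ac)
    also have "\<dots> = \<psi> z * (complex_of_real (absv a ^ CARD('n)) * of_bool (absv a * vabs (y v* z) \<le> 1))"
      by (simp add: character_integral_ball[OF a(1)])
    also have "\<dots> = complex_of_real (absv a ^ CARD('n)) * (of_bool (vabs (y v* z) * absv a \<le> 1) * \<psi> (hyper_proj y ** z))"
    proof (cases "vabs (y v* z) * absv a \<le> 1")
      case True
      \<comment> \<open>On the slab, \<open>z\<close> and its projection differ by a matrix of norm
        at most \<open>absv c\<close>, and \<open>\<psi>\<close> is invariant under such
        shifts.\<close>
      then have yz: "vabs (y v* z) \<le> absv c" using a c(1) by (simp add: pos_divide_le_eq)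
      let ?t = "outer (dual_vec y) (y v* z)"
      have "mabs ?t \<le> vabs (dual_vec y) * vabs (y v* z)" by (rule mabs_outer_le)
      also have "\<dots> \<le> 1 * absv c" by (intro mult_mono vabs_dual yz) auto
      finally have "\<psi> (hyper_proj y ** z + ?t) = \<psi> (hyper_proj y ** z)" by (intro c(2)) simp
      then have "\<psi> z = \<psi> (hyper_proj y ** z)" by (simp add: hyper_proj_mult)
      then show ?thesis using True by (simp add: mult_ac)
    qed (simp add: mult.commute)
    finally show "(\<integral> x. of_bool (vabs x \<le> absv a) * \<psi> z * chr (- rowcol (y v* z) x) \<partial>\<mu>X)
      = complex_of_real (absv a ^ CARD('n)) * (of_bool (vabs (y v* z) * absv a \<le> 1) * \<psi> (hyper_proj y ** z))" .
  qed
  also have "\<dots> = complex_of_real (absv a ^ CARD('n)) * (\<integral> z. of_bool (vabs (y v* z) * absv a \<le> 1) * \<psi> (hyper_proj y ** z) \<partial>\<mu>M)"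
    by simp
  also have "\<dots> = (\<integral> z. of_bool (vabs (y v* z) \<le> 1) * \<psi> (hyper_proj y ** z) \<partial>\<mu>M)"
  proof -
    \<comment> \<open>Stretching the slab of width \<open>1 / absv a\<close> to width 1 has Jacobian
      \<open>(1 / absv a) ^ CARD('n)\<close>, which cancels the volume of the ball of
      columns.\<close>
    obtain D :: "'a^'n^'n" where D: "det D = a" "\<And>z :: 'a^'n^'n. y v* (D ** z) = a *s (y v* z)"
      "\<And>z :: 'a^'n^'n. hyper_proj y ** (D ** z) = hyper_proj y ** z"
      using stretch[OF a(1)] by blast
    let ?f = "\<lambda>z. of_bool (vabs (y v* z) \<le> 1) * \<psi> (hyper_proj y ** z)"
    have i: "invertible D" using D(1) a(1) by (simp add: invertible_det_nz)
    have "(\<lambda>z. \<psi> (hyper_proj y ** z)) \<in> borel_measurable borel"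
      using measurable_compose[OF measurable_gph[of "hyper_proj y" "mat 1"] schwartz_measurable[OF \<psi>]] by simp
    moreover have "(\<lambda>z :: 'a^'n^'n. of_bool (vabs (y v* z) \<le> 1) :: complex) \<in> borel_measurable borel"
      using borel_measurable_indicator[OF hyper_cut_borel[of 1]] by (simp add: indicator_def[abs_def])
    ultimately have m: "?f \<in> borel_measurable \<mu>M"
      unfolding measurable_cong_sets[OF M.sets_haar refl] by (intro borel_measurable_times)
    have "(\<integral> z. of_bool (vabs (y v* z) * absv a \<le> 1) * \<psi> (hyper_proj y ** z) \<partial>\<mu>M) = (\<integral> z. ?f (D ** z) \<partial>\<mu>M)"
      unfolding D(2,3) vabs_scale by (simp add: mult.commute)
    also have "\<dots> = complex_of_real ((1 / absv (det D)) ^ CARD('n)) * (\<integral> z. ?f z \<partial>\<mu>M)"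
      by (rule integral_scaled_action[OF measurable_M_left _ _ m]) (use emeasure_M_left[OF i] in auto)
    finally show ?thesis using a(1) by (simp add: D(1) power_one_over)
  qed
  finally show ?thesis .
qed

end

end

context local_field
begin

lemma orbit_scaling_integral:
  fixes \<mu> :: "('a^'n^'n) measure" and \<psi> :: "'a^'n^'n \<Rightarrow> complex"
  assumes o: "orbit_scaling k \<mu>" and \<psi>: "\<psi> \<in> borel_measurable borel" and g: "invertible g" and h: "invertible h"
  shows "(\<integral> p. \<psi> (g ** p ** h) \<partial>\<mu>) = complex_of_real ((1 / absv (det g)) ^ k * (1 / absv (det h)) ^ k) * (\<integral> p. \<psi> p \<partial>\<mu>)"
proof (rule integral_scaled_action)
  note o = orbit_scalingD[OF o]
  show "(\<lambda>p. g ** p ** h) \<in> \<mu> \<rightarrow>\<^sub>M \<mu>" using measurable_gph unfolding measurable_cong_sets[OF o(1) o(1)] .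
  show "\<psi> \<in> borel_measurable \<mu>" using \<psi> unfolding measurable_cong_sets[OF o(1) refl] .
  show "emeasure \<mu> ((\<lambda>p. g ** p ** h) -` A \<inter> space \<mu>)
      = ennreal ((1 / absv (det g)) ^ k * (1 / absv (det h)) ^ k) * emeasure \<mu> A" if "A \<in> sets \<mu>" for A
    using o(5)[OF g h, of A] that o(1,6) by simp
qed auto

lemma det_matrix_inv: "invertible g \<Longrightarrow> det (matrix_inv g) = inverse (det g)" for g :: "'a^'n^'n"
proof -
  assume g: "invertible g"
  have "det (matrix_inv g) * det g = 1" using matrix_inv_mult(2)[OF g] by (metis det_mul det_I)
  then show ?thesis using g by (simp add: invertible_det_nz field_simps)
qed

lemma orbit_scaling_LR:
  fixes \<mu> :: "('a^'n^'n) measure" and \<psi> :: "'a^'n^'n \<Rightarrow> complex"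
  assumes o: "orbit_scaling k \<mu>" and \<psi>: "\<psi> \<in> borel_measurable borel" and g: "invertible g" and h: "invertible h"
  shows "integral\<^sup>L \<mu> (LR g h \<psi>) = complex_of_real (absv (det g) ^ k / absv (det h) ^ k) * integral\<^sup>L \<mu> \<psi>"
  using orbit_scaling_integral[OF o \<psi> matrix_inv_mult(3)[OF g] h]
  by (simp add: LR_def det_matrix_inv[OF g] abs_inverse power_one_over power_inverse divide_inverse)

end

section \<open>The corank one measure and its transformation law\<close>

context haar_fourier
begin

sublocale XM: pair_sigma_finite \<mu>X \<mu>M ..

lemma sets_XM: "sets (\<mu>X \<Otimes>\<^sub>M \<mu>M) = sets (borel :: (('a^'n) \<times> ('a^'n^'n)) measure)"
  using borel_prod_separable[OF separable_V separable_M] by (simp cong: sets_pair_measure_cong)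

lemma measurable_max_index: "max_index \<in> borel \<rightarrow>\<^sub>M count_space UNIV"
proof (subst measurable_count_space_eq2, simp, intro conjI ballI)
  fix S :: "'n set"
  have m: "(\<lambda>y :: 'a^'n. absv (y $ i)) \<in> borel_measurable borel" for i
    by (intro borel_measurable_continuous_onI continuous_on_abs continuous_on_component continuous_on_id)
  have e: "{y :: 'a^'n. absv (y $ i) = vabs y} \<in> sets borel" for i
  proof -
    have "{y \<in> space borel. absv (y $ i) = vabs y} \<in> sets (borel :: ('a^'n) measure)"
      using m[of i] measurable_vabs by measurable
    then show ?thesis by simp
  qed
  have e': "{y :: 'a^'n. (absv (y $ i) = vabs y) = (i \<in> S)} \<in> sets borel" for i
  proof (cases "i \<in> S")
    case False
    then have "{y :: 'a^'n. (absv (y $ i) = vabs y) = (i \<in> S)} = - {y. absv (y $ i) = vabs y}" by auto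
    then show ?thesis using borel_comp[OF e[of i]] by simp
  qed (use e[of i] in simp)
  have "max_index -` {S} \<inter> space borel = (\<Inter>i\<in>UNIV. {y. (absv (y $ i) = vabs y) = (i \<in> S)})"
    by (auto simp: max_index_def)
  moreover have "(\<Inter>i\<in>UNIV. {y :: 'a^'n. (absv (y $ i) = vabs y) = (i \<in> S)}) \<in> sets borel"
    using e' by (intro sets.finite_INT) auto
  ultimately show "max_index -` {S} \<inter> space borel \<in> sets borel" by simp
qed simp

text \<open>For a fixed index set the projection is a continuous expression in the vector, the
  matrix and one inverted entry. The index set takes finitely many values, each on a Borel set, so
  the cases can be glued.\<close>

lemma measurable_hyper: "(\<lambda>w. hyper_proj (fst w) ** snd w) \<in> \<mu>X \<Otimes>\<^sub>M \<mu>M \<rightarrow>\<^sub>M borel"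
proof -
  let ?f = "\<lambda>S (w :: ('a^'n) \<times> ('a^'n^'n)). (mat 1 - outer (axis (pivot S) (inverse (fst w $ pivot S))) (fst w)) ** snd w"
  have f: "?f S \<in> \<mu>X \<Otimes>\<^sub>M \<mu>M \<rightarrow>\<^sub>M borel" for S
  proof -
    let ?F = "\<lambda>q :: 'a \<times> (('a^'n) \<times> ('a^'n^'n)). (mat 1 - outer (axis (pivot S) (fst q)) (fst (snd q))) ** snd (snd q)"
    have "?F \<in> borel_measurable borel"
      by (intro borel_measurable_continuous_onI continuous_on_matrix_mult continuous_on_diff_M continuous_on_outer
        continuous_on_axis continuous_on_fst continuous_on_snd continuous_on_const continuous_on_id)
    moreover have "sets (borel \<Otimes>\<^sub>M (\<mu>X \<Otimes>\<^sub>M \<mu>M)) = sets (borel :: ('a \<times> (('a^'n) \<times> ('a^'n^'n))) measure)"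
      using sets_pair_measure_cong[OF refl sets_XM] borel_prod_separable[OF separable_F separable_metric_prod[OF separable_V separable_M]]
      by (rule trans)
    ultimately have F: "?F \<in> borel \<Otimes>\<^sub>M (\<mu>X \<Otimes>\<^sub>M \<mu>M) \<rightarrow>\<^sub>M borel" by (subst measurable_cong_sets[OF _ refl])
    have "(\<lambda>w :: ('a^'n) \<times> ('a^'n^'n). fst w $ pivot S) \<in> borel_measurable borel"
      by (intro borel_measurable_continuous_onI continuous_on_component continuous_on_fst continuous_on_id)
    from measurable_compose[OF this measurable_inverse_F]
    have "(\<lambda>w. inverse (fst w $ pivot S)) \<in> \<mu>X \<Otimes>\<^sub>M \<mu>M \<rightarrow>\<^sub>M borel"
      unfolding measurable_cong_sets[OF sets_XM refl] .
    then have "(\<lambda>w. (inverse (fst w $ pivot S), w)) \<in> \<mu>X \<Otimes>\<^sub>M \<mu>M \<rightarrow>\<^sub>M borel \<Otimes>\<^sub>M (\<mu>X \<Otimes>\<^sub>M \<mu>M)"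
      by (rule measurable_Pair) (rule measurable_ident_sets[OF refl])
    from measurable_compose[OF this F] show ?thesis by simp
  qed
  have "(\<lambda>w. max_index (fst w)) \<in> \<mu>X \<Otimes>\<^sub>M \<mu>M \<rightarrow>\<^sub>M count_space UNIV"
    using measurable_max_index by (intro measurable_compose[OF measurable_fst]) (simp add: measurable_cong_sets[OF X.sets_haar refl])
  from measurable_compose_countable[OF f this] show ?thesis
    by (simp add: hyper_proj_def dual_vec_def)
qed

text \<open>Matrices of rank \<open>n - 1\<close> are fibred over the hyperplanes \<open>{z. y v* z = 0}\<close>. The Haar measure of a
  hyperplane is the image of Haar measure on \<open>{z. vabs (y v* z) \<le> 1}\<close> under a projection.\<close>

definition hyper_measure :: "('a^'n^'n) measure" where
  "hyper_measure = distr (density (\<mu>X \<Otimes>\<^sub>M \<mu>M) (\<lambda>w. of_bool (vabs (fst w) = 1 \<and> vabs (fst w v* snd w) \<le> 1)))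
     borel (\<lambda>w. hyper_proj (fst w) ** snd w)"

lemma sets_hyper [simp]: "sets hyper_measure = sets borel"
  by (simp add: hyper_measure_def)

lemma hyper_domain: "{w \<in> space (\<mu>X \<Otimes>\<^sub>M \<mu>M). vabs (fst w) = 1 \<and> vabs (fst w v* snd w) \<le> 1} \<in> sets (\<mu>X \<Otimes>\<^sub>M \<mu>M)"
proof -
  have "(\<lambda>w :: ('a^'n) \<times> ('a^'n^'n). fst w v* snd w) \<in> borel_measurable borel"
    by (intro borel_measurable_continuous_onI continuous_on_vm continuous_on_fst continuous_on_snd continuous_on_id)
  from measurable_compose[OF this measurable_vabs]
  have 1: "(\<lambda>w. vabs (fst w v* snd w)) \<in> borel_measurable (\<mu>X \<Otimes>\<^sub>M \<mu>M)"
    unfolding measurable_cong_sets[OF sets_XM refl] .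
  have "vabs \<in> borel_measurable \<mu>X" using measurable_vabs unfolding measurable_cong_sets[OF X.sets_haar refl] .
  from measurable_compose[OF measurable_fst this]
  have 2: "(\<lambda>w. vabs (fst w)) \<in> borel_measurable (\<mu>X \<Otimes>\<^sub>M \<mu>M)" .
  show ?thesis using 1 2 by measurable
qed

lemma nn_integral_hyper:
  assumes f: "f \<in> borel_measurable borel"
  shows "(\<integral>\<^sup>+ p. f p \<partial>hyper_measure)
     = (\<integral>\<^sup>+ y. of_bool (vabs y = 1) * (\<integral>\<^sup>+ z. of_bool (vabs (y v* z) \<le> 1) * f (hyper_proj y ** z) \<partial>\<mu>M) \<partial>\<mu>X)"
proof -
  let ?F = "\<lambda>w. of_bool (vabs (fst w) = 1 \<and> vabs (fst w v* snd w) \<le> 1) * f (hyper_proj (fst w) ** snd w)"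
  have F: "?F \<in> borel_measurable (\<mu>X \<Otimes>\<^sub>M \<mu>M)"
  proof (rule borel_measurable_times_ennreal)
    show "(\<lambda>w. of_bool (vabs (fst w) = 1 \<and> vabs (fst w v* snd w) \<le> 1) :: ennreal) \<in> borel_measurable (\<mu>X \<Otimes>\<^sub>M \<mu>M)"
      using hyper_domain by measurable
  qed (rule measurable_compose[OF measurable_hyper f])
  have "(\<integral>\<^sup>+ p. f p \<partial>hyper_measure) = (\<integral>\<^sup>+ w. ?F w \<partial>(\<mu>X \<Otimes>\<^sub>M \<mu>M))"
    unfolding hyper_measure_def by (rule nn_integral_distr_density_bool[OF hyper_domain measurable_hyper f])
  also have "\<dots> = (\<integral>\<^sup>+ y. \<integral>\<^sup>+ z. ?F (y, z) \<partial>\<mu>M \<partial>\<mu>X)"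
    by (rule M.nn_integral_fst[OF F, symmetric])
  also have "\<dots> = (\<integral>\<^sup>+ y. of_bool (vabs y = 1) * (\<integral>\<^sup>+ z. of_bool (vabs (y v* z) \<le> 1) * f (hyper_proj y ** z) \<partial>\<mu>M) \<partial>\<mu>X)"
    by (intro nn_integral_cong) (auto simp: of_bool_def)
  finally show ?thesis .
qed

lemma integral_hyper:
  fixes f :: "'a^'n^'n \<Rightarrow> complex"
  assumes f: "integrable hyper_measure f"
  shows "(\<integral> p. f p \<partial>hyper_measure)
     = (\<integral> y. of_bool (vabs y = 1) * (\<integral> z. of_bool (vabs (y v* z) \<le> 1) * f (hyper_proj y ** z) \<partial>\<mu>M) \<partial>\<mu>X)"
proof -
  let ?F = "\<lambda>w. of_bool (vabs (fst w) = 1 \<and> vabs (fst w v* snd w) \<le> 1) * f (hyper_proj (fst w) ** snd w)"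
  have fb: "f \<in> borel_measurable borel"
    using borel_measurable_integrable[OF f] by (simp add: measurable_cong_sets[OF sets_hyper refl])
  have int: "integrable (\<mu>X \<Otimes>\<^sub>M \<mu>M) ?F"
    using f integral_distr_density_bool(2)[OF hyper_domain measurable_hyper fb] unfolding hyper_measure_def[symmetric] by simp
  have "(\<integral> p. f p \<partial>hyper_measure) = (\<integral> w. ?F w \<partial>(\<mu>X \<Otimes>\<^sub>M \<mu>M))"
    unfolding hyper_measure_def by (rule integral_distr_density_bool(1)[OF hyper_domain measurable_hyper fb])
  also have "\<dots> = (\<integral> y. \<integral> z. ?F (y, z) \<partial>\<mu>M \<partial>\<mu>X)"
    by (rule XM.integral_fst'[OF int, symmetric])
  also have "\<dots> = (\<integral> y. of_bool (vabs y = 1) * (\<integral> z. of_bool (vabs (y v* z) \<le> 1) * f (hyper_proj y ** z) \<partial>\<mu>M) \<partial>\<mu>X)"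
    by (intro Bochner_Integration.integral_cong refl) (auto simp: of_bool_def)
  finally show ?thesis .
qed

lemma hyper_box_finite: "emeasure hyper_measure {z. mabs z \<le> R} < \<infinity>"
proof -
  \<comment> \<open>A matrix is its projection plus the component removed; the former is bounded by
    \<open>R\<close> and the latter by 1, so an ultrametric sum is bounded by the maximum.\<close>
  let ?R = "max R 1"
  have b: "{z :: 'a^'n^'n. mabs z \<le> R} \<in> sets borel" for R using closed_mbox[of "0 :: 'a^'n^'n" R] by simp
  have m: "{x :: 'a^'n. vabs x \<le> R} \<in> sets \<mu>X" for R using closed_vbox[of "0 :: 'a^'n" R] by simp
  have "emeasure hyper_measure {z. mabs z \<le> R} = (\<integral>\<^sup>+ z. indicator {z. mabs z \<le> R} z \<partial>hyper_measure)"
    using b by simp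
  also have "\<dots> = (\<integral>\<^sup>+ y. of_bool (vabs y = 1) * (\<integral>\<^sup>+ z. of_bool (vabs (y v* z) \<le> 1) * indicator {z. mabs z \<le> R} (hyper_proj y ** z) \<partial>\<mu>M) \<partial>\<mu>X)"
    by (rule nn_integral_hyper) (use b in simp)
  also have "\<dots> \<le> (\<integral>\<^sup>+ y. emeasure \<mu>M {z. mabs z \<le> ?R} * indicator {y. vabs y \<le> 1} y \<partial>\<mu>X)"
  proof (rule nn_integral_mono)
    fix y :: "'a^'n"
    show "of_bool (vabs y = 1) * (\<integral>\<^sup>+ z. of_bool (vabs (y v* z) \<le> 1) * indicator {z. mabs z \<le> R} (hyper_proj y ** z) \<partial>\<mu>M)
        \<le> emeasure \<mu>M {z. mabs z \<le> ?R} * indicator {y. vabs y \<le> 1} y"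
    proof (cases "vabs y = 1")
      case True
      have "(\<integral>\<^sup>+ z. of_bool (vabs (y v* z) \<le> 1) * indicator {z. mabs z \<le> R} (hyper_proj y ** z) \<partial>\<mu>M)
         \<le> (\<integral>\<^sup>+ z. indicator {z. mabs z \<le> ?R} z \<partial>\<mu>M)"
      proof (rule nn_integral_mono)
        fix z :: "'a^'n^'n"
        show "of_bool (vabs (y v* z) \<le> 1) * indicator {z. mabs z \<le> R} (hyper_proj y ** z) \<le> (indicator {z. mabs z \<le> ?R} z :: ennreal)"
        proof (cases "vabs (y v* z) \<le> 1 \<and> mabs (hyper_proj y ** z) \<le> R")
          case c: True
          have "mabs (outer (dual_vec y) (y v* z)) \<le> vabs (dual_vec y) * vabs (y v* z)" by (rule mabs_outer_le)
          also have "\<dots> \<le> 1 * 1" using c by (intro mult_mono vabs_dual[OF True]) auto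
          finally have "mabs (hyper_proj y ** z + outer (dual_vec y) (y v* z)) \<le> ?R"
            using c by (intro mabs_add_le) auto
          then show ?thesis by (auto simp: hyper_proj_mult[OF True] indicator_def)
        qed (auto simp: indicator_def)
      qed
      also have "\<dots> = emeasure \<mu>M {z. mabs z \<le> ?R}" using b by simp
      finally show ?thesis using True by simp
    qed simp
  qed
  also have "\<dots> = emeasure \<mu>M {x. mabs x \<le> ?R} * emeasure \<mu>X {y. vabs y \<le> 1}"
    using m by (simp add: nn_integral_cmult_indicator)
  also have "\<dots> < \<infinity>" using M_box_finite[of ?R] by (simp add: ennreal_mult_less_top)
  finally show ?thesis .
qed

text \<open>The Fourier identity for the explicit measures, with constant 1: for each row
  \<open>y\<close> of norm 1, the subspace of all \<open>outer x y\<close> and the hyperplane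
  \<open>{z. y v* z = 0}\<close> are annihilators of each other under the trace pairing, and
  \<open>fourier_line_integral\<close> compares their integrals.\<close>

theorem fourier_rank1_eq_hyper:
  fixes \<psi> :: "'a^'n^'n \<Rightarrow> complex"
  assumes \<psi>: "schwartz \<psi>"
  shows "(\<integral> p. fourier \<mu>M chr \<psi> p \<partial>rank1_measure) = (\<integral> p. \<psi> p \<partial>hyper_measure)"
proof -
  have "(\<integral> p. fourier \<mu>M chr \<psi> p \<partial>rank1_measure)
     = (\<integral> y. of_bool (vabs y = 1) * (\<integral> x. fourier \<mu>M chr \<psi> (outer x y) \<partial>\<mu>X) \<partial>\<mu>X)"
    by (rule integral_rank1[OF schwartz_integrable[OF fourier_schwartz[OF \<psi>] sets_rank1_measure rank1_box_finite]])
  also have "\<dots> = (\<integral> y. of_bool (vabs y = 1) * (\<integral> z. of_bool (vabs (y v* z) \<le> 1) * \<psi> (hyper_proj y ** z) \<partial>\<mu>M) \<partial>\<mu>X)"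
  proof (intro Bochner_Integration.integral_cong refl)
    fix y :: "'a^'n"
    show "of_bool (vabs y = 1) * (\<integral> x. fourier \<mu>M chr \<psi> (outer x y) \<partial>\<mu>X)
       = of_bool (vabs y = 1) * (\<integral> z. of_bool (vabs (y v* z) \<le> 1) * \<psi> (hyper_proj y ** z) \<partial>\<mu>M)"
      using fourier_line_integral[OF _ \<psi>, of y] by (cases "vabs y = 1") auto
  qed
  also have "\<dots> = (\<integral> p. \<psi> p \<partial>hyper_measure)"
    by (rule integral_hyper[OF schwartz_integrable[OF \<psi> sets_hyper hyper_box_finite], symmetric])
  finally show ?thesis .
qed

text \<open>The law is transported from the rank one side. The Fourier transform contributes the
  exponent n in each determinant, and the rank one measure, acted on by the inverses in swapped
  order, gives one power back.\<close>

lemma integral_hyper_gph: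
  fixes \<psi> :: "'a^'n^'n \<Rightarrow> complex"
  assumes \<psi>: "schwartz \<psi>" and g: "invertible g" and h: "invertible h"
  shows "(\<integral> p. \<psi> (g ** p ** h) \<partial>hyper_measure)
    = complex_of_real ((1 / absv (det g)) ^ (CARD('n) - 1) * (1 / absv (det h)) ^ (CARD('n) - 1)) * (\<integral> p. \<psi> p \<partial>hyper_measure)"
proof -
  let ?G = "absv (det g)" and ?H = "absv (det h)"
  have nz: "?G \<noteq> 0" "?H \<noteq> 0" using g h by (auto simp: invertible_det_nz)
  have pw: "(1 / x) ^ CARD('n) * x = (1 / x) ^ (CARD('n) - 1)" if "x \<noteq> 0" for x :: real
    using that power_minus_mult[of "CARD('n)" "1 / x"] by (simp add: field_simps)
  have "(\<integral> p. \<psi> (g ** p ** h) \<partial>hyper_measure) = (\<integral> p. fourier \<mu>M chr (\<lambda>p. \<psi> (g ** p ** h)) p \<partial>rank1_measure)"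
    by (rule fourier_rank1_eq_hyper[OF schwartz_gph[OF \<psi> g h], symmetric])
  also have "\<dots> = complex_of_real ((1 / ?G) ^ CARD('n) * (1 / ?H) ^ CARD('n)) *
      (\<integral> p. fourier \<mu>M chr \<psi> (matrix_inv h ** p ** matrix_inv g) \<partial>rank1_measure)"
    unfolding fourier_gph[OF \<psi> g h] by simp
  also have "(\<integral> p. fourier \<mu>M chr \<psi> (matrix_inv h ** p ** matrix_inv g) \<partial>rank1_measure)
     = complex_of_real ((1 / absv (det (matrix_inv h))) ^ 1 * (1 / absv (det (matrix_inv g))) ^ 1) * (\<integral> p. fourier \<mu>M chr \<psi> p \<partial>rank1_measure)"
    by (rule orbit_scaling_integral[OF rank1_scaling schwartz_measurable[OF fourier_schwartz[OF \<psi>]]])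
       (use matrix_inv_mult(3) g h in auto)
  also have "\<dots> = complex_of_real (?H * ?G) * (\<integral> p. \<psi> p \<partial>hyper_measure)"
    unfolding fourier_rank1_eq_hyper[OF \<psi>] by (simp add: det_matrix_inv g h abs_inverse divide_inverse)
  also have "complex_of_real ((1 / ?G) ^ CARD('n) * (1 / ?H) ^ CARD('n)) * (complex_of_real (?H * ?G) * (\<integral> p. \<psi> p \<partial>hyper_measure))
     = complex_of_real (((1 / ?G) ^ CARD('n) * ?G) * ((1 / ?H) ^ CARD('n) * ?H)) * (\<integral> p. \<psi> p \<partial>hyper_measure)"
    unfolding of_real_mult by (simp only: mult_ac)
  finally show ?thesis unfolding pw[OF nz(1)] pw[OF nz(2)] .
qed

text \<open>The law for Schwartz functions is applied to indicators of boxes and extended to Borel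
  sets. It remains to see that the measure is carried by the orbit and is not zero.\<close>

lemma hyper_scaling: "orbit_scaling (CARD('n) - 1) hyper_measure"
  unfolding orbit_scaling_def
proof (intro conjI allI impI)
  let ?O = "rank_orbit (CARD('n) - 1) :: ('a^'n^'n) set"
  show "sigma_finite_measure hyper_measure"
    by (rule mabs_finite_imp_sigma_finite[OF _ hyper_box_finite]) simp
  have O: "- ?O \<in> sets borel" using rank_orbit_borel by (rule borel_comp)
  have "emeasure hyper_measure (- ?O) = (\<integral>\<^sup>+ z. indicator (- ?O) z \<partial>hyper_measure)"
    using O by simp
  also have "\<dots> = (\<integral>\<^sup>+ y. of_bool (vabs y = 1) * (\<integral>\<^sup>+ z. of_bool (vabs (y v* z) \<le> 1) * indicator (- ?O) (hyper_proj y ** z) \<partial>\<mu>M) \<partial>\<mu>X)"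
    by (rule nn_integral_hyper) (use O in simp)
  also have "\<dots> = (\<integral>\<^sup>+ y. 0 \<partial>\<mu>X)"
  proof (rule nn_integral_cong)
    fix y :: "'a^'n"
    show "of_bool (vabs y = 1) * (\<integral>\<^sup>+ z. of_bool (vabs (y v* z) \<le> 1) * indicator (- ?O) (hyper_proj y ** z) \<partial>\<mu>M) = 0"
    proof (cases "vabs y = 1")
      case True
      \<comment> \<open>Multiplication by an invertible \<open>z\<close> preserves the rank of the
        projection, so only singular \<open>z\<close> can lead outside the orbit, and these form a
        null set.\<close>
      have r: "hyper_proj y ** z \<in> ?O" if "det z \<noteq> 0" for z
        using rank_mult_invertible[of "mat 1" z "hyper_proj y"] that rank_hyper_proj[OF True]
        by (simp add: rank_orbit_def invertible_det_nz)
      have N: "{z :: 'a^'n^'n. det z = 0} \<in> sets \<mu>M"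
      proof -
        have "{z :: 'a^'n^'n. det z = 0} \<in> sets borel"
          by (intro borel_closed closed_Collect_eq continuous_on_det continuous_on_const continuous_on_id)
        then show ?thesis by simp
      qed
      have "(\<integral>\<^sup>+ z. of_bool (vabs (y v* z) \<le> 1) * indicator (- ?O) (hyper_proj y ** z) \<partial>\<mu>M) \<le> (\<integral>\<^sup>+ z. indicator {z. det z = 0} z \<partial>\<mu>M)"
        using r by (intro nn_integral_mono) (auto simp: indicator_def)
      also have "\<dots> = 0" using emeasure_singular N by simp
      finally show ?thesis by simp
    qed simp
  qed
  finally show "emeasure hyper_measure (- ?O) = 0" by simp
  show "emeasure hyper_measure UNIV \<noteq> 0"
  proof
    assume "emeasure hyper_measure UNIV = 0"
    moreover have "emeasure hyper_measure UNIV = (\<integral>\<^sup>+ z. indicator UNIV z \<partial>hyper_measure)"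
      by (subst nn_integral_indicator) auto
    moreover have "\<dots> = (\<integral>\<^sup>+ y. of_bool (vabs y = 1) * (\<integral>\<^sup>+ z. of_bool (vabs (y v* z) \<le> 1) * indicator UNIV (hyper_proj y ** z) \<partial>\<mu>M) \<partial>\<mu>X)"
      by (rule nn_integral_hyper) simp
    \<comment> \<open>For \<open>vabs y = 1\<close> all integral matrices satisfy
      \<open>vabs (y v* z) \<le> 1\<close>, so each inner integral is at least their volume, which
      is 1.\<close>
    moreover have "\<dots> \<ge> (\<integral>\<^sup>+ y. indicator {y. vabs y = 1} y \<partial>\<mu>X)"
    proof (rule nn_integral_mono)
      fix y :: "'a^'n"
      show "indicator {y. vabs y = 1} y \<le> of_bool (vabs y = 1) * (\<integral>\<^sup>+ z. of_bool (vabs (y v* z) \<le> 1) * indicator UNIV (hyper_proj y ** z) \<partial>\<mu>M)"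
      proof (cases "vabs y = 1")
        case True
        have "1 = (\<integral>\<^sup>+ z. indicator {z. mabs z \<le> 1} z \<partial>\<mu>M)" using M.emeasure_U M.open_U by simp
        also have "\<dots> \<le> (\<integral>\<^sup>+ z. of_bool (vabs (y v* z) \<le> 1) * indicator UNIV (hyper_proj y ** z) \<partial>\<mu>M)"
        proof (rule nn_integral_mono)
          fix z :: "'a^'n^'n"
          show "indicator {z. mabs z \<le> 1} z \<le> of_bool (vabs (y v* z) \<le> 1) * (indicator UNIV (hyper_proj y ** z) :: ennreal)"
            using vabs_vm_le[of y z] True by (auto simp: indicator_def)
        qed
        finally show ?thesis using True by simp
      qed simp
    qed
    moreover have "(\<integral>\<^sup>+ y. indicator {y :: 'a^'n. vabs y = 1} y \<partial>\<mu>X) = emeasure \<mu>X {y. vabs y = 1}"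
      by (rule nn_integral_indicator) measurable
    ultimately show False using prim_nonnull by simp
  qed
  fix g h :: "'a^'n^'n" and A :: "('a^'n^'n) set"
  assume g: "invertible g" and h: "invertible h" and A: "A \<in> sets borel"
  let ?c = "(1 / absv (det g)) ^ (CARD('n) - 1) * (1 / absv (det h)) ^ (CARD('n) - 1)"
  let ?T = "\<lambda>p. g ** p ** h"
  have sp: "space hyper_measure = UNIV" using sets_eq_imp_space_eq[OF sets_hyper] by simp
  have m: "?T \<in> hyper_measure \<rightarrow>\<^sub>M borel" using measurable_gph by (simp add: measurable_cong_sets[OF sets_hyper refl])
  have d: "emeasure (distr hyper_measure borel ?T) B = emeasure hyper_measure (?T -` B)" if "B \<in> sets borel" for B
    using that m sp by (simp add: emeasure_distr)
  have "distr hyper_measure borel ?T = scale_measure (ennreal ?c) hyper_measure"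
  \<comment> \<open>Since this measure is finite on every box of the matrix space, the comparison
    runs over all points with a constant radius.\<close>
  proof (rule measure_eq_on_boxes[where Orb = UNIV and e = "\<lambda>_. 1"])
    fix c :: "'a^'n^'n" and r :: real assume r: "r > 0"
    let ?B = "{x. mabs (x - c) \<le> r}"
    have B: "?B \<in> sets borel" by (intro borel_closed closed_mbox)
    have TB: "?T -` ?B \<in> sets borel" by (rule vimage_gph[OF B])
    have s: "schwartz (indicator ?B :: 'a^'n^'n \<Rightarrow> complex)" by (rule schwartz_indicator_mbox[OF r])
    have fin: "emeasure hyper_measure S < \<infinity>" if S: "schwartz (indicator S :: 'a^'n^'n \<Rightarrow> complex)" "S \<in> sets borel" for S
    proof -
      obtain B R where "B > 0" "R > 0" "\<And>x. cmod (indicator S x) \<le> B" and R: "\<And>x. indicator S x \<noteq> (0::complex) \<Longrightarrow> mabs x \<le> R"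
        using schwartz_bounds[OF S(1)] by blast
      have "S \<subseteq> {z. mabs z \<le> R}" using R by (auto simp: indicator_def)
      then have "emeasure hyper_measure S \<le> emeasure hyper_measure {z. mabs z \<le> R}"
        using closed_mbox[of "0 :: 'a^'n^'n"] by (intro emeasure_mono) auto
      then show ?thesis using hyper_box_finite by (rule le_less_trans)
    qed
    have iT: "(\<lambda>p. indicator ?B (?T p) :: complex) = indicator (?T -` ?B)" by (auto simp: indicator_def)
    have f1: "emeasure hyper_measure ?B < \<infinity>" by (rule fin[OF s B])
    have f2: "emeasure hyper_measure (?T -` ?B) < \<infinity>"
      using schwartz_gph[OF s g h] unfolding iT by (rule fin[OF _ TB])
    have "complex_of_real (measure hyper_measure (?T -` ?B)) = (\<integral> p. indicator ?B (?T p) \<partial>hyper_measure)"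
      unfolding iT by (rule integral_indicator_complex[symmetric]) (use TB in simp)
    also have "\<dots> = complex_of_real ?c * (\<integral> p. indicator ?B p \<partial>hyper_measure)"
      by (rule integral_hyper_gph[OF s g h])
    also have "\<dots> = complex_of_real ?c * complex_of_real (measure hyper_measure ?B)"
      by (subst integral_indicator_complex) (use B in auto)
    finally have me: "measure hyper_measure (?T -` ?B) = ?c * measure hyper_measure ?B"
      unfolding of_real_mult[symmetric] of_real_eq_iff .
    have "emeasure hyper_measure (?T -` ?B) = ennreal (?c * measure hyper_measure ?B)"
      unfolding me[symmetric] using f2 by (intro emeasure_eq_ennreal_measure) simp
    also have "\<dots> = ennreal ?c * emeasure hyper_measure ?B"
      using f1 by (subst ennreal_mult) (auto simp: emeasure_eq_ennreal_measure)
    finally have eq: "emeasure hyper_measure (?T -` ?B) = ennreal ?c * emeasure hyper_measure ?B" .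
    show "emeasure (distr hyper_measure borel ?T) ?B = emeasure (scale_measure (ennreal ?c) hyper_measure) ?B
       \<and> emeasure (distr hyper_measure borel ?T) ?B \<noteq> \<infinity>"
      using d[OF B] eq f2 by simp
  qed simp_all
  then show "emeasure hyper_measure (?T -` A) = ennreal ?c * emeasure hyper_measure A"
    using d[OF A] by (metis emeasure_scale_measure)
qed simp

end

section \<open>The quotient by the torus\<close>

context local_field_haar
begin

text \<open>The measure on columns is the slice \<open>A \<mapsto> \<mu>W (A \<times> U)\<close>
  with \<open>U\<close> the unit box. Its square is translation invariant with mass 1 on
  \<open>U \<times> U\<close>, so uniqueness identifies it with \<open>\<mu>W\<close> and makes
  Fubini available on the symplectic space.\<close>

lemma haar_W_split:
  fixes \<mu>W :: "('a,'n::finite) W measure"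
  assumes hW: "haar_W absv \<mu>W"
  obtains \<mu>X :: "('a^'n) measure" where "haar_normalized \<mu>X {x. vabs x \<le> 1}" "\<mu>X \<Otimes>\<^sub>M \<mu>X = \<mu>W"
proof -
  let ?U = "{x :: 'a^'n. vabs x \<le> 1}"
  have oU: "open ?U" using open_vbox[of 1 "0 :: 'a^'n"] by simp
  have UU: "{(x,y). \<forall>i. absv (x $ i) \<le> 1 \<and> absv (y $ i) \<le> 1} = ?U \<times> ?U"
    by (auto simp: vabs_le_iff)
  interpret W: haar_space \<mu>W "?U \<times> ?U"
  proof
    show "separable_metric TYPE(('a^'n) \<times> ('a^'n))" by (intro separable_metric_prod separable_V)
    have "continuous_on UNIV (\<lambda>p :: (('a^'n) \<times> ('a^'n)) \<times> (('a^'n) \<times> ('a^'n)).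
        (fst (fst p) - fst (snd p), snd (fst p) - snd (snd p)))"
      by (intro continuous_on_Pair continuous_on_diff_V continuous_on_fst continuous_on_snd continuous_on_id)
    then show "continuous_on UNIV (\<lambda>p :: (('a^'n) \<times> ('a^'n)) \<times> (('a^'n) \<times> ('a^'n)). fst p - snd p)"
      by (rule continuous_on_eq) (simp add: prod_eq_iff)
    show "open (?U \<times> ?U)" by (intro open_Times oU)
    show "compact (?U \<times> ?U)" by (intro compact_Times compact_vbox)
    show "0 \<in> ?U \<times> ?U" by (simp add: zero_prod_def)
    show "haar_normalized \<mu>W (?U \<times> ?U)" using hW unfolding haar_W_def UU .
  qed
  have pr: "sets (borel \<Otimes>\<^sub>M borel) = sets (borel :: (('a^'n) \<times> ('a^'n)) measure)"
    by (rule borel_prod_separable[OF separable_V separable_V])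
  have Tb: "A \<times> B \<in> sets borel" if "A \<in> sets borel" "B \<in> sets borel" for A B :: "('a^'n) set"
    using pair_measureI[OF that] unfolding pr .
  define \<mu>X :: "('a^'n) measure" where "\<mu>X = distr (density \<mu>W (indicator (UNIV \<times> ?U))) borel fst"
  have Ub: "?U \<in> sets borel" using oU by simp
  have e: "emeasure \<mu>X A = emeasure \<mu>W (A \<times> ?U)" if A: "A \<in> sets borel" for A
  proof -
    have "fst -` A \<inter> space \<mu>W = A \<times> UNIV" by auto
    moreover have "fst \<in> \<mu>W \<rightarrow>\<^sub>M borel"
      unfolding measurable_cong_sets[OF W.sets_haar refl]
      by (intro borel_measurable_continuous_onI continuous_on_fst continuous_on_id)
    ultimately have "emeasure \<mu>X A = (\<integral>\<^sup>+ w. indicator (UNIV \<times> ?U) w * indicator (A \<times> UNIV) w \<partial>\<mu>W)"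
      unfolding \<mu>X_def using A Tb[OF _ Ub, of UNIV] Tb[OF A, of UNIV] by (simp add: emeasure_distr emeasure_density)
    also have "\<dots> = (\<integral>\<^sup>+ w. indicator (A \<times> ?U) w \<partial>\<mu>W)"
      by (intro nn_integral_cong) (auto simp: indicator_def)
    also have "\<dots> = emeasure \<mu>W (A \<times> ?U)" using Tb[OF A Ub] by simp
    finally show ?thesis .
  qed
  have hX: "haar_normalized \<mu>X ?U"
    unfolding haar_normalized_def
  proof (intro conjI allI impI)
    show "sets \<mu>X = sets borel" by (simp add: \<mu>X_def)
    show "emeasure \<mu>X ?U = 1" using e[OF Ub] W.emeasure_U by simp
    fix c and A :: "('a^'n) set" assume A: "A \<in> sets borel"
    have m: "(\<lambda>x. - c + x) \<in> borel_measurable (borel :: ('a^'n) measure)"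
    proof -
      have "continuous_on UNIV (\<lambda>x :: 'a^'n. x - c)" by (intro continuous_on_diff_V continuous_on_const continuous_on_id)
      then show ?thesis by (intro borel_measurable_continuous_onI) simp
    qed
    have "(\<lambda>x. x + c) ` A = (\<lambda>x. - c + x) -` A \<inter> space borel"
    proof (intro equalityI subsetI)
      fix x assume "x \<in> (\<lambda>x. - c + x) -` A \<inter> space borel"
      then show "x \<in> (\<lambda>x. x + c) ` A" by (intro image_eqI[of _ _ "- c + x"]) auto
    qed auto
    then have Ac: "(\<lambda>x. x + c) ` A \<in> sets borel" using measurable_sets[OF m A] by simp
    have "((\<lambda>x. x + c) ` A) \<times> ?U = (\<lambda>w. w + (c, 0)) ` (A \<times> ?U)" by (auto simp: image_iff)
    then show "emeasure \<mu>X ((\<lambda>x. x + c) ` A) = emeasure \<mu>X A"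
      using e[OF Ac] e[OF A] W.emeasure_translate[OF Tb[OF A Ub], of "(c, 0)"] by simp
  qed
  interpret haar_vector absv \<mu>F \<mu>X by unfold_locales (rule hX)
  let ?XX = "\<mu>X \<Otimes>\<^sub>M \<mu>X"
  have XU: "emeasure ?XX (?U \<times> ?U) = 1"
    using Ub by (subst X.emeasure_pair_measure_Times) (auto simp: X.emeasure_U)
  have "?XX = scale_measure (emeasure ?XX (?U \<times> ?U)) \<mu>W"
  proof (rule W.haar_unique)
    show "sets ?XX = sets borel" by (rule X_prod_sets)
    show "emeasure ?XX (?U \<times> ?U) < \<infinity>" "emeasure ?XX (?U \<times> ?U) \<noteq> 0" unfolding XU by simp_all
    fix c :: "('a^'n) \<times> ('a^'n)" and A :: "(('a^'n) \<times> ('a^'n)) set" assume A: "A \<in> sets borel"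
    have tr: "distr \<mu>X \<mu>X (\<lambda>x. d + x) = \<mu>X" for d
    proof (rule measure_eqI)
      have m: "(\<lambda>x. d + x) \<in> \<mu>X \<rightarrow>\<^sub>M \<mu>X"
        unfolding measurable_cong_sets[OF X.sets_haar X.sets_haar]
        by (intro borel_measurable_continuous_onI X.continuous_on_add_b continuous_on_const continuous_on_id)
      fix B assume "B \<in> sets (distr \<mu>X \<mu>X (\<lambda>x. d + x))"
      then show "emeasure (distr \<mu>X \<mu>X (\<lambda>x. d + x)) B = emeasure \<mu>X B"
        using m by (simp add: emeasure_distr X.emeasure_vimage_translate)
    qed simp
    have md: "(\<lambda>x. d + x) \<in> \<mu>X \<rightarrow>\<^sub>M \<mu>X" for d
      unfolding measurable_cong_sets[OF X.sets_haar X.sets_haar]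
      by (intro borel_measurable_continuous_onI X.continuous_on_add_b continuous_on_const continuous_on_id)
    have "distr \<mu>X \<mu>X (\<lambda>x. - fst c + x) \<Otimes>\<^sub>M distr \<mu>X \<mu>X (\<lambda>x. - snd c + x)
       = distr ?XX ?XX (\<lambda>(x, y). (- fst c + x, - snd c + y))"
      by (rule pair_measure_distr[OF md md]) (unfold tr, rule X.sigma_finite_measure_axioms)
    then have "?XX = distr ?XX ?XX (\<lambda>(x, y). (- fst c + x, - snd c + y))" unfolding tr .
    then have "emeasure ?XX A = emeasure (distr ?XX ?XX (\<lambda>(x, y). (- fst c + x, - snd c + y))) A" by simp
    also have "\<dots> = emeasure ?XX ((\<lambda>(x, y). (- fst c + x, - snd c + y)) -` A \<inter> space ?XX)"
    proof (rule emeasure_distr)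
      show "(\<lambda>(x, y). (- fst c + x, - snd c + y)) \<in> ?XX \<rightarrow>\<^sub>M ?XX"
        using md unfolding case_prod_beta'
        by (intro measurable_Pair measurable_compose[OF measurable_fst md] measurable_compose[OF measurable_snd md])
    qed (unfold X_prod_sets, rule A)
    also have "(\<lambda>(x, y). (- fst c + x, - snd c + y)) -` A \<inter> space ?XX = (\<lambda>w. w + c) ` A"
    proof (intro equalityI subsetI)
      fix w assume "w \<in> (\<lambda>(x, y). (- fst c + x, - snd c + y)) -` A \<inter> space ?XX"
      then show "w \<in> (\<lambda>w. w + c) ` A"
        by (intro image_eqI[of _ _ "(- fst c + fst w, - snd c + snd w)"]) (auto simp: prod_eq_iff case_prod_beta')
    next
      fix w assume "w \<in> (\<lambda>w. w + c) ` A"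
      then obtain w' where w': "w' \<in> A" "w = w' + c" by blast
      then have "(- fst c + fst w, - snd c + snd w) = w'" by (simp add: prod_eq_iff)
      then show "w \<in> (\<lambda>(x, y). (- fst c + x, - snd c + y)) -` A \<inter> space ?XX"
        using w'(1) by (simp add: case_prod_beta' space_pair_measure)
    qed
    finally show "emeasure ?XX ((\<lambda>w. w + c) ` A) = emeasure ?XX A" by simp
  qed
  then have "?XX = \<mu>W" unfolding XU by simp
  then show ?thesis using that hX by blast
qed

end

context haar_vector
begin

lemma outer_torus: "a \<noteq> 0 \<Longrightarrow> outer (a *s x) (inverse a *s y) = outer x y"
  by (simp add: outer_def vec_eq_iff)

text \<open>The measurable sets of \<open>\<nu>\<close> are the torus invariant Borel sets.
  Preimages under \<open>outer\<close> are of this kind because \<open>outer\<close> is constant on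
  torus orbits.\<close>

lemma measurable_outer_quot:
  assumes \<nu>: "orbit_quot_measure absv \<mu>F (\<mu>X \<Otimes>\<^sub>M \<mu>X) \<nu>"
  shows "(\<lambda>w. outer (fst w) (snd w)) \<in> \<nu> \<rightarrow>\<^sub>M (borel :: ('a^'n^'n) measure)"
proof (rule measurableI)
  have sp: "space \<nu> = Wx" and st: "sets \<nu> = inv_sets" using \<nu> unfolding orbit_quot_measure_def by auto
  fix A :: "('a^'n^'n) set" assume A: "A \<in> sets borel"
  have "(\<lambda>w. outer (fst w) (snd w)) -` A \<inter> Wx \<in> inv_sets"
    unfolding inv_sets_def
  proof (intro CollectI conjI allI impI)
    have "(\<lambda>w :: ('a^'n) \<times> ('a^'n). outer (fst w) (snd w)) \<in> borel_measurable borel"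
      using measurable_outer by (simp add: case_prod_beta')
    from measurable_sets[OF this A] have "(\<lambda>w. outer (fst w) (snd w)) -` A \<in> sets borel" by simp
    moreover have "Wx \<in> sets (borel :: ('a,'n) W measure)"
    proof -
      have "open {w :: ('a^'n) \<times> ('a^'n). fst w \<noteq> 0}" "open {w :: ('a^'n) \<times> ('a^'n). snd w \<noteq> 0}"
        by (intro open_Collect_neq continuous_on_fst continuous_on_snd continuous_on_const continuous_on_id)+
      then have "{w :: ('a^'n) \<times> ('a^'n). fst w \<noteq> 0} \<inter> {w. snd w \<noteq> 0} \<in> sets borel" by (intro borel_open open_Int)
      moreover have "(Wx :: ('a,'n) W set) = {w. fst w \<noteq> 0} \<inter> {w. snd w \<noteq> 0}" by (auto simp: Wx_def)
      ultimately show ?thesis by simp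
    qed
    ultimately show "(\<lambda>w. outer (fst w) (snd w)) -` A \<inter> Wx \<in> sets borel" by (rule sets.Int)
    fix a :: 'a and w :: "('a,'n) W" assume "a \<noteq> 0" "w \<in> (\<lambda>w. outer (fst w) (snd w)) -` A \<inter> Wx"
    then show "torus_act a w \<in> (\<lambda>w. outer (fst w) (snd w)) -` A \<inter> Wx"
      by (auto simp: torus_act_def outer_torus Wx_def)
  qed simp
  then show "(\<lambda>w. outer (fst w) (snd w)) -` A \<inter> space \<nu> \<in> sets \<nu>" unfolding sp st .
qed simp

text \<open>The defining formula of the quotient measure is applied to a function of
  \<open>outer x y\<close> cut off to \<open>vabs y = 1\<close>. The function is constant on torus
  orbits, so the inner integral only sees the cut-off and equals \<open>unit_vol\<close>.\<close>

lemma distr_outer_quot: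
  assumes \<nu>: "orbit_quot_measure absv \<mu>F (\<mu>X \<Otimes>\<^sub>M \<mu>X) \<nu>"
  shows "rank1_measure = scale_measure (ennreal unit_vol) (distr \<nu> borel (\<lambda>w. outer (fst w) (snd w)))"
proof (rule measure_eqI)
  let ?o = "\<lambda>w :: ('a,'n) W. outer (fst w) (snd w)"
  have sp: "space \<nu> = Wx" and int: "\<And>\<phi>. \<phi> \<in> borel_measurable borel \<Longrightarrow>
      (\<integral>\<^sup>+ w \<in> Wx. \<phi> w \<partial>(\<mu>X \<Otimes>\<^sub>M \<mu>X)) =
        (\<integral>\<^sup>+ w. (\<integral>\<^sup>+ a. indicator (-{0}) a * \<phi> (torus_act a w) * ennreal (1 / absv a) \<partial>\<mu>F) \<partial>\<nu>)"
    using \<nu> unfolding orbit_quot_measure_def by auto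
  fix A assume "A \<in> sets rank1_measure"
  then have A: "A \<in> sets borel" by simp
  have O: "rank_orbit 1 \<in> sets (borel :: ('a^'n^'n) measure)" by (rule rank_orbit_borel)
  let ?f = "indicator A :: 'a^'n^'n \<Rightarrow> ennreal"
  let ?\<phi> = "\<lambda>w :: ('a,'n) W. of_bool (vabs (snd w) = 1) * ?f (?o w)"
  have ob: "?o \<in> borel_measurable borel" using measurable_outer by (simp add: case_prod_beta')
  have pb: "(\<lambda>w :: ('a,'n) W. of_bool (vabs (snd w) = 1) :: ennreal) \<in> borel_measurable borel"
    using measurable_prim by (simp add: case_prod_beta' measurable_cong_sets[OF X_prod_sets refl])
  have \<phi>: "?\<phi> \<in> borel_measurable borel"
    by (intro borel_measurable_times_ennreal pb measurable_compose[OF ob borel_measurable_indicator[OF A]])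
  have AO: "A \<inter> rank_orbit 1 \<in> sets borel" using A O by (rule sets.Int)
  \<comment> \<open>Restricting to the rank one orbit removes the pairs with \<open>x = 0\<close>,
    so that the integral runs over \<open>Wx\<close> as the quotient formula requires.\<close>
  have "emeasure rank1_measure A = emeasure rank1_measure (A \<inter> rank_orbit 1)"
  proof (rule emeasure_eq_AE)
    have "AE p in rank1_measure. p \<in> rank_orbit 1"
      by (rule AE_I[of _ _ "- rank_orbit 1"]) (use orbit_scalingD(3)[OF rank1_scaling] borel_comp[OF O] in auto)
    then show "AE x in rank1_measure. x \<in> A \<longleftrightarrow> x \<in> A \<inter> rank_orbit 1" by (auto elim!: eventually_mono)
  qed (use A AO in auto)
  also have "\<dots> = (\<integral>\<^sup>+ p. indicator (A \<inter> rank_orbit 1) p \<partial>rank1_measure)" using AO by simp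
  also have "\<dots> = (\<integral>\<^sup>+ w. of_bool (vabs (snd w) = 1) * indicator (A \<inter> rank_orbit 1) (?o w) \<partial>(\<mu>X \<Otimes>\<^sub>M \<mu>X))"
  proof -
    have P: "{w \<in> space (\<mu>X \<Otimes>\<^sub>M \<mu>X). vabs (snd w) = 1} \<in> sets (\<mu>X \<Otimes>\<^sub>M \<mu>X)"
    proof -
      have "vabs \<in> borel_measurable \<mu>X" by (simp add: measurable_cong_sets[OF X.sets_haar refl])
      from measurable_compose[OF measurable_snd this] show ?thesis by measurable
    qed
    have T: "?o \<in> \<mu>X \<Otimes>\<^sub>M \<mu>X \<rightarrow>\<^sub>M borel" using ob unfolding measurable_cong_sets[OF X_prod_sets refl] .
    show ?thesis
      unfolding rank1_measure_def case_prod_beta'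
      by (rule nn_integral_distr_density_bool[OF P T]) (use AO in simp)
  qed
  also have "\<dots> = (\<integral>\<^sup>+ w \<in> Wx. ?\<phi> w \<partial>(\<mu>X \<Otimes>\<^sub>M \<mu>X))"
  proof (rule nn_integral_cong)
    fix w :: "('a,'n) W"
    have "w \<in> Wx \<longleftrightarrow> ?o w \<in> rank_orbit 1" if "vabs (snd w) = 1"
    proof -
      have y: "snd w \<noteq> 0" using that by auto
      show ?thesis
      proof (cases "fst w = 0")
        case True
        then have "?o w = diag_mat (\<lambda>_. 0)" by (simp add: outer_def diag_mat_def vec_eq_iff)
        then show ?thesis using True by (auto simp: Wx_def rank_orbit_def rank_diag_mat)
      next
        case False
        then show ?thesis using y rank_outer[OF False y] by (simp add: Wx_def rank_orbit_def mem_Times_iff case_prod_beta')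
      qed
    qed
    then show "of_bool (vabs (snd w) = 1) * indicator (A \<inter> rank_orbit 1) (?o w) = ?\<phi> w * indicator Wx w"
      by (auto simp: indicator_def)
  qed
  also have "\<dots> = (\<integral>\<^sup>+ w. (\<integral>\<^sup>+ a. indicator (-{0}) a * ?\<phi> (torus_act a w) * ennreal (1 / absv a) \<partial>\<mu>F) \<partial>\<nu>)"
    by (rule int[OF \<phi>])
  also have "\<dots> = (\<integral>\<^sup>+ w. ennreal unit_vol * indicator (?o -` A \<inter> space \<nu>) w \<partial>\<nu>)"
  proof (rule nn_integral_cong)
    fix w :: "('a,'n) W" assume w: "w \<in> space \<nu>"
    then have "w \<in> Wx" unfolding sp .
    then have y: "snd w \<noteq> 0" by (cases w) (simp add: Wx_def)
    let ?t = "\<lambda>a. indicator (-{0}) a * of_bool (vabs (snd w) = absv a) * ennreal (1 / absv a)"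
    have tm: "?t \<in> borel_measurable \<mu>F"
      unfolding measurable_cong_sets[OF F.sets_haar refl] by measurable
    have "(\<integral>\<^sup>+ a. indicator (-{0}) a * ?\<phi> (torus_act a w) * ennreal (1 / absv a) \<partial>\<mu>F) = (\<integral>\<^sup>+ a. ?t a * ?f (?o w) \<partial>\<mu>F)"
    proof (rule nn_integral_cong)
      fix a
      show "indicator (-{0}) a * ?\<phi> (torus_act a w) * ennreal (1 / absv a) = ?t a * ?f (?o w)"
      proof (cases "a = 0")
        case False
        have "vabs (inverse a *s snd w) = 1 \<longleftrightarrow> vabs (snd w) = absv a"
          unfolding vabs_scale abs_inverse using False by (auto simp: inverse_eq_divide)
        then show ?thesis using False by (simp add: torus_act_def outer_torus mult_ac)
      qed simp
    qed
    also have "\<dots> = (\<integral>\<^sup>+ a. ?t a \<partial>\<mu>F) * ?f (?o w)" by (rule nn_integral_multc[OF tm])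
    also have "(\<integral>\<^sup>+ a. ?t a \<partial>\<mu>F) = ennreal unit_vol" by (rule nn_integral_torus(2)[OF y])
    finally show "(\<integral>\<^sup>+ a. indicator (-{0}) a * ?\<phi> (torus_act a w) * ennreal (1 / absv a) \<partial>\<mu>F)
        = ennreal unit_vol * indicator (?o -` A \<inter> space \<nu>) w"
      using w by (simp add: indicator_def)
  qed
  also have "\<dots> = ennreal unit_vol * emeasure \<nu> (?o -` A \<inter> space \<nu>)"
    by (rule nn_integral_cmult_indicator) (rule measurable_sets[OF measurable_outer_quot[OF \<nu>] A])
  also have "\<dots> = ennreal unit_vol * emeasure (distr \<nu> borel ?o) A"
    using A by (simp add: emeasure_distr[OF measurable_outer_quot[OF \<nu>]])
  finally show "emeasure rank1_measure A = emeasure (scale_measure (ennreal unit_vol) (distr \<nu> borel ?o)) A" by simp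
qed simp

end

section \<open>The distribution chc as a Fourier integral over rank one matrices\<close>

context haar_fourier
begin

text \<open>Both terms of the symplectic form equal the row-matrix-column product, hence the factor
  2; the sign is the one in the Fourier kernel. The trailing \<open>mat 1\<close> brings the
  argument into the two-sided form for which the transformation laws are stated.\<close>

lemma sympl_Wact: "sympl (Wact z w) w = - trace (mat (- 2) ** outer (fst w) (snd w) ** mat 1 ** z)"
proof -
  have 1: "rowcol (snd w) (z *v fst w) = rowcol (snd w v* z) (fst w)"
  proof -
    have "rowcol (snd w) (z *v fst w) = (\<Sum>i\<in>UNIV. \<Sum>j\<in>UNIV. snd w $ i * (z $ i $ j * fst w $ j))"
      by (simp add: rowcol_def matrix_vector_mult_def sum_distrib_left)
    also have "\<dots> = (\<Sum>j\<in>UNIV. \<Sum>i\<in>UNIV. snd w $ i * (z $ i $ j * fst w $ j))" by (rule sum.swap)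
    also have "\<dots> = rowcol (snd w v* z) (fst w)"
      by (simp add: rowcol_def vector_matrix_mult_def sum_distrib_left sum_distrib_right mult_ac)
    finally show ?thesis .
  qed
  have 2: "mat (- 2) ** outer (fst w) (snd w) ** mat 1 = outer ((- 2) *s fst w) (snd w)"
    unfolding outer_mult mat_scale_mult by simp
  have "trace (mat (- 2) ** outer (fst w) (snd w) ** mat 1 ** z) = - (2 * rowcol (snd w v* z) (fst w))"
    unfolding 2 trace_outer_mult rowcol_scale by simp
  moreover have "sympl (Wact z w) w = 2 * rowcol (snd w v* z) (fst w)"
    unfolding sympl_def Wact_def fst_conv snd_conv 1 by (simp add: rowcol_def sum_negf)
  ultimately show ?thesis by simp
qed

lemma chc_inner_eq_fourier:
  "chc_inner \<mu>M chr \<psi> w = fourier \<mu>M chr \<psi> (mat (- 2) ** outer (fst w) (snd w) ** mat 1)"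
  unfolding chc_inner_def fourier_def sympl_Wact by (simp only: mult.commute)

lemma invertible_minus_2: "invertible (mat (- 2) :: 'a^'n^'n)"
  by (rule invertible_mat) simp

text \<open>The inner integral is a Schwartz function of \<open>outer x y\<close>, which gives
  integrability over the quotient. The constant combines \<open>unit_vol\<close>, from the passage
  to \<open>rank1_measure\<close>, with the determinant of the dilation by \<open>- 2\<close>, to
  the first power because the measure lives on rank one matrices.\<close>

lemma chc_eq_rank1:
  fixes \<psi> :: "'a^'n^'n \<Rightarrow> complex"
  assumes \<nu>: "orbit_quot_measure absv \<mu>F (\<mu>X \<Otimes>\<^sub>M \<mu>X) \<nu>" and \<psi>: "schwartz \<psi>"
  shows "integrable \<nu> (chc_inner \<mu>M chr \<psi>)"
    and "complex_of_real (unit_vol * absv (det (mat (- 2) :: 'a^'n^'n))) * chc \<mu>M \<nu> chr \<psi> = (\<integral> p. fourier \<mu>M chr \<psi> p \<partial>rank1_measure)"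
proof -
  let ?o = "\<lambda>w :: ('a,'n) W. outer (fst w) (snd w)"
  let ?m = "mat (- 2) :: 'a^'n^'n"
  let ?F = "\<lambda>p. fourier \<mu>M chr \<psi> (?m ** p ** mat 1)"
  have i1: "invertible (mat 1 :: 'a^'n^'n)" by simp
  have s: "schwartz ?F" by (rule schwartz_gph[OF fourier_schwartz[OF \<psi>] invertible_minus_2 i1])
  have Fm: "?F \<in> borel_measurable borel" by (rule schwartz_measurable[OF s])
  let ?D = "distr \<nu> borel ?o"
  have Fm': "?F \<in> borel_measurable ?D" using Fm by simp
  have r: "rank1_measure = scale_measure (ennreal unit_vol) ?D" by (rule distr_outer_quot[OF \<nu>])
  have fin: "emeasure ?D {z. mabs z \<le> R} < \<infinity>" for R
  proof -
    have "ennreal unit_vol * emeasure ?D {z. mabs z \<le> R} < \<infinity>"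
      using rank1_box_finite[of R] unfolding r by simp
    then show ?thesis using unit_vol_pos by (auto simp: ennreal_mult_less_top)
  qed
  have "integrable ?D ?F" by (rule schwartz_integrable[OF s _ fin]) simp
  then have "integrable \<nu> (\<lambda>w. ?F (?o w))"
    by (rule integrable_distr[OF measurable_outer_quot[OF \<nu>]])
  then show "integrable \<nu> (chc_inner \<mu>M chr \<psi>)" unfolding chc_inner_eq_fourier[abs_def] .
  have "chc \<mu>M \<nu> chr \<psi> = (\<integral> w. ?F (?o w) \<partial>\<nu>)" unfolding chc_def chc_inner_eq_fourier ..
  also have "\<dots> = (\<integral> p. ?F p \<partial>?D)" by (rule integral_distr[OF measurable_outer_quot[OF \<nu>] Fm, symmetric])
  finally have "complex_of_real unit_vol * chc \<mu>M \<nu> chr \<psi> = (\<integral> p. ?F p \<partial>rank1_measure)"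
    unfolding r integral_scale_measure(1)[OF unit_vol_pos Fm'] by simp
  also have "\<dots> = complex_of_real ((1 / absv (det ?m)) ^ 1 * (1 / absv (det (mat 1 :: 'a^'n^'n))) ^ 1) * (\<integral> p. fourier \<mu>M chr \<psi> p \<partial>rank1_measure)"
    by (rule orbit_scaling_integral[OF rank1_scaling schwartz_measurable[OF fourier_schwartz[OF \<psi>]] invertible_minus_2 i1])
  finally have eq: "complex_of_real unit_vol * chc \<mu>M \<nu> chr \<psi>
     = complex_of_real (1 / absv (det ?m)) * (\<integral> p. fourier \<mu>M chr \<psi> p \<partial>rank1_measure)" by simp
  have nz: "absv (det ?m) \<noteq> 0" using invertible_minus_2 by (simp add: invertible_det_nz)
  have "complex_of_real (unit_vol * absv (det ?m)) * chc \<mu>M \<nu> chr \<psi>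
     = complex_of_real (absv (det ?m)) * (complex_of_real unit_vol * chc \<mu>M \<nu> chr \<psi>)" by simp
  also have "\<dots> = complex_of_real (absv (det ?m) * (1 / absv (det ?m))) * (\<integral> p. fourier \<mu>M chr \<psi> p \<partial>rank1_measure)"
    unfolding eq of_real_mult by (simp only: mult.assoc)
  also have "\<dots> = (\<integral> p. fourier \<mu>M chr \<psi> p \<partial>rank1_measure)" using nz by simp
  finally show "complex_of_real (unit_vol * absv (det ?m)) * chc \<mu>M \<nu> chr \<psi> = (\<integral> p. fourier \<mu>M chr \<psi> p \<partial>rank1_measure)" .
qed

lemma orbit_measure_proportional:
  shows "orbit_measure absv 1 \<mu> \<Longrightarrow> \<exists>b::real. b > 0 \<and> \<mu> = scale_measure (ennreal b) rank1_measure"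
    and "orbit_measure absv (CARD('n) - 1) \<mu> \<Longrightarrow> \<exists>b::real. b > 0 \<and> \<mu> = scale_measure (ennreal b) hyper_measure"
  by (rule orbit_scaling_unique[OF rank1_scaling orbit_measure_imp_scaling], assumption)
     (rule orbit_scaling_unique[OF hyper_scaling orbit_measure_imp_scaling], assumption)

end

theorem mainTheorem8:
  fixes absv :: "'a::{field,metric_space} \<Rightarrow> real"
    and chr :: "'a \<Rightarrow> complex"
    and \<mu>F :: "'a measure"
    and \<mu>M :: "('a^'n::finite^'n) measure"
    and \<mu>W :: "('a,'n) W measure"
  assumes "nonarch_local_field absv"
    and "additive_char absv chr"
    and "haar_F absv \<mu>F"
    and "haar_mat absv \<mu>M"
    and "haar_W absv \<mu>W"
    and "CARD('n) \<ge> 2"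
  shows
    "(\<forall>k \<in> {1, CARD('n) - 1}. \<forall>\<mu> :: ('a^'n^'n) measure. orbit_measure absv k \<mu> \<longrightarrow>
        (\<forall>\<psi>. schwartz \<psi> \<longrightarrow> integrable \<mu> \<psi> \<and>
           (\<forall>g h. invertible g \<longrightarrow> invertible h \<longrightarrow>
              integral\<^sup>L \<mu> (LR g h \<psi>) =
                complex_of_real (absv (det g) ^ k / absv (det h) ^ k) * integral\<^sup>L \<mu> \<psi>)))
     \<and>
     (\<forall>\<mu>1 \<mu>2 \<nu>. orbit_measure absv 1 \<mu>1 \<longrightarrow> orbit_measure absv (CARD('n) - 1) \<mu>2 \<longrightarrow>
        orbit_quot_measure absv \<mu>F \<mu>W \<nu> \<longrightarrow>
        (\<exists>c1 c2 :: real. c1 > 0 \<and> c2 > 0 \<and>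
           (\<forall>\<psi>. schwartz \<psi> \<longrightarrow>
              (\<forall>w \<in> space \<nu>. integrable \<mu>M (\<lambda>z. chr (sympl (Wact z w) w) * \<psi> z)) \<and>
              integrable \<nu> (chc_inner \<mu>M chr \<psi>) \<and>
              complex_of_real c2 * integral\<^sup>L \<mu>2 \<psi> =
                complex_of_real c1 * integral\<^sup>L \<mu>1 (fourier \<mu>M chr \<psi>) \<and>
              complex_of_real c1 * integral\<^sup>L \<mu>1 (fourier \<mu>M chr \<psi>) = chc \<mu>M \<nu> chr \<psi>)))"
proof -
  interpret local_field_haar absv \<mu>F by unfold_locales (rule assms)+
  obtain \<mu>X :: "('a^'n) measure" where X: "haar_normalized \<mu>X {x. vabs x \<le> 1}" "\<mu>X \<Otimes>\<^sub>M \<mu>X = \<mu>W"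
    using haar_W_split[OF assms(5)] .
  interpret haar_fourier absv \<mu>F \<mu>X \<mu>M chr by unfold_locales (rule assms X)+
  have part1: "integrable \<mu> \<psi> \<and>
           (\<forall>g h. invertible g \<longrightarrow> invertible h \<longrightarrow>
              integral\<^sup>L \<mu> (LR g h \<psi>) = complex_of_real (absv (det g) ^ k / absv (det h) ^ k) * integral\<^sup>L \<mu> \<psi>)"
    if k: "k \<in> {1, CARD('n) - 1}" and \<mu>: "orbit_measure absv k \<mu>" and \<psi>: "schwartz \<psi>"
    for k and \<mu> :: "('a^'n^'n) measure" and \<psi>
  proof (intro conjI allI impI)
    \<comment> \<open>The orbit measure inherits finiteness on all boxes from its explicit model.
      For n = 2 the two values of \<open>k\<close> coincide and the rank one model is taken.\<close>
    have "\<exists>b L. b > 0 \<and> \<mu> = scale_measure (ennreal b) L \<and> sets L = sets borel \<and> (\<forall>R. emeasure L {z. mabs z \<le> R} < \<infinity>)"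
    proof (cases "k = 1")
      case True
      then show ?thesis using orbit_measure_proportional(1)[of \<mu>] \<mu> sets_rank1_measure rank1_box_finite by blast
    next
      case False
      then show ?thesis using orbit_measure_proportional(2)[of \<mu>] \<mu> k sets_hyper hyper_box_finite by blast
    qed
    then obtain b L where b: "b > 0" "\<mu> = scale_measure (ennreal b) L" "sets L = sets borel"
      "\<And>R. emeasure L {z. mabs z \<le> R} < \<infinity>" by blast
    have iL: "integrable L \<psi>" by (rule schwartz_integrable[OF \<psi> b(3,4)])
    show "integrable \<mu> \<psi>"
      unfolding b(2) by (rule integral_scale_measure(2)[OF b(1) borel_measurable_integrable[OF iL] iL])
    show "integral\<^sup>L \<mu> (LR g h \<psi>) = complex_of_real (absv (det g) ^ k / absv (det h) ^ k) * integral\<^sup>L \<mu> \<psi>"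
      if "invertible g" "invertible h" for g h
      by (rule orbit_scaling_LR[OF orbit_measure_imp_scaling[OF \<mu>] schwartz_measurable[OF \<psi>] that])
  qed
  have part2: "\<exists>c1 c2 :: real. c1 > 0 \<and> c2 > 0 \<and>
           (\<forall>\<psi>. schwartz \<psi> \<longrightarrow>
              (\<forall>w \<in> space \<nu>. integrable \<mu>M (\<lambda>z. chr (sympl (Wact z w) w) * \<psi> z)) \<and>
              integrable \<nu> (chc_inner \<mu>M chr \<psi>) \<and>
              complex_of_real c2 * integral\<^sup>L \<mu>2 \<psi> =
                complex_of_real c1 * integral\<^sup>L \<mu>1 (fourier \<mu>M chr \<psi>) \<and>
              complex_of_real c1 * integral\<^sup>L \<mu>1 (fourier \<mu>M chr \<psi>) = chc \<mu>M \<nu> chr \<psi>)"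
    if m1: "orbit_measure absv 1 \<mu>1" and m2: "orbit_measure absv (CARD('n) - 1) \<mu>2"
      and \<nu>: "orbit_quot_measure absv \<mu>F \<mu>W \<nu>" for \<mu>1 \<mu>2 \<nu>
  proof -
    obtain b1 where b1: "b1 > 0" "\<mu>1 = scale_measure (ennreal b1) rank1_measure"
      using orbit_measure_proportional(1)[OF m1] by blast
    obtain b2 where b2: "b2 > 0" "\<mu>2 = scale_measure (ennreal b2) hyper_measure"
      using orbit_measure_proportional(2)[OF m2] by blast
    have \<nu>': "orbit_quot_measure absv \<mu>F (\<mu>X \<Otimes>\<^sub>M \<mu>X) \<nu>" using \<nu> X(2) by simp
    define K where "K = unit_vol * absv (det (mat (- 2) :: 'a^'n^'n))"
    have K: "K > 0" unfolding K_def using unit_vol_pos invertible_minus_2 by (simp add: invertible_det_nz)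
    show ?thesis
    \<comment> \<open>The factors \<open>b1\<close> and \<open>b2\<close> compare the given orbit
      measures with the explicit ones, and \<open>K\<close> is the constant relating chc to the rank
      one Fourier integral. Dividing by both leaves normalizations that do not depend on
      \<open>\<psi>\<close>.\<close>
    proof (rule exI[of _ "1 / (K * b1)"], rule exI[of _ "1 / (K * b2)"], intro conjI allI impI ballI)
      show "1 / (K * b1) > 0" "1 / (K * b2) > 0" using K b1 b2 by simp_all
      fix \<psi> :: "'a^'n^'n \<Rightarrow> complex" assume \<psi>: "schwartz \<psi>"
      show "integrable \<mu>M (\<lambda>z. chr (sympl (Wact z w) w) * \<psi> z)" if "w \<in> space \<nu>" for w
        using integrable_fourier[OF \<psi>] unfolding sympl_Wact by (simp only: mult.commute)
      show "integrable \<nu> (chc_inner \<mu>M chr \<psi>)" by (rule chc_eq_rank1(1)[OF \<nu>' \<psi>])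
      let ?I = "\<integral> p. fourier \<mu>M chr \<psi> p \<partial>rank1_measure"
      have I1: "integral\<^sup>L \<mu>1 (fourier \<mu>M chr \<psi>) = complex_of_real b1 * ?I"
        unfolding b1(2)
        by (rule integral_scale_measure(1)[OF b1(1)])
           (use schwartz_measurable[OF fourier_schwartz[OF \<psi>]] in \<open>simp add: measurable_cong_sets[OF sets_rank1_measure refl]\<close>)
      have I2: "integral\<^sup>L \<mu>2 \<psi> = complex_of_real b2 * ?I"
        unfolding b2(2) fourier_rank1_eq_hyper[OF \<psi>]
        by (rule integral_scale_measure(1)[OF b2(1)])
           (use schwartz_measurable[OF \<psi>] in \<open>simp add: measurable_cong_sets[OF sets_hyper refl]\<close>)
      have I3: "complex_of_real K * chc \<mu>M \<nu> chr \<psi> = ?I"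
        unfolding K_def by (rule chc_eq_rank1(2)[OF \<nu>' \<psi>])
      have c1: "complex_of_real (1 / (K * b1)) * (complex_of_real b1 * ?I) = complex_of_real (1 / K) * ?I"
        using b1(1) by simp
      have c2: "complex_of_real (1 / (K * b2)) * (complex_of_real b2 * ?I) = complex_of_real (1 / K) * ?I"
        using b2(1) by simp
      show "complex_of_real (1 / (K * b2)) * integral\<^sup>L \<mu>2 \<psi> = complex_of_real (1 / (K * b1)) * integral\<^sup>L \<mu>1 (fourier \<mu>M chr \<psi>)"
        unfolding I1 I2 c1 c2 ..
      show "complex_of_real (1 / (K * b1)) * integral\<^sup>L \<mu>1 (fourier \<mu>M chr \<psi>) = chc \<mu>M \<nu> chr \<psi>"
        unfolding I1 c1 I3[symmetric] using K b1(1) by simp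
    qed
  qed
  show ?thesis using part1 part2 by blast
qed

end
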